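(* Let $\ell>0$ be the bicycle length. An infinitely long bicycle path $\gamma:\mathbb R\to Q$ (with front track parametrized by arc length) is a global minimizer, that is, all of its restrictions to compact intervals minimize length between their end points, if and only if it is of one of the following two types: (1) its front track is a straight line and its back track is a tractrix or a straight line; or (2) its front track is an Euler soliton of width $2\ell$ and its back track is a tractrix. Furthermore, there is an isometric involution of the bicycle configuration space $Q$, namely $\Phi(\mathbf b,\mathbf f)=(\mathbf b,2\mathbf b-\mathbf f)$, which takes paths of one type to paths of the other, provided the back track of the path is a tractrix and not a line.
   Context: Bicycle configuration space: $Q=\{(\mathbf b,\mathbf f)\in\mathbb R^2\times\mathbb R^2: \|\mathbf f-\mathbf b\|=\ell\}$ ($\mathbf b$ = back wheel, $\mathbf f$ = front wheel). A bicycle path is a curve $\gamma(t)=(\mathbf b(t),\mathbf f(t))$ in $Q$ satisfying the no-skid condition: $\dot{\mathbf b}(t)$ is a multiple of $\mathbf f(t)-\mathbf b(t)$ (curves are absolutely continuous, the condition holding for almost every $t$). Its front and back tracks are the plane curves $\mathbf f(t)$ and $\mathbf b(t)$; its length is the Euclidean length of the front track. A front track that "is a straight line" means a unit speed parametrization of a full straight line, and similarly for the Euler soliton. Minimizing is among all bicycle paths connecting the same two points of $Q$. The no-skid condition defines a rank 2 distribution $D\subset TQ$, and the inner product on $D$ is $\langle(\dot{\mathbf b},\dot{\mathbf f}),(\dot{\mathbf b}',\dot{\mathbf f}')\rangle=\dot{\mathbf f}\cdot\dot{\mathbf f}'$. An isometry of $Q$ is a diffeomorphism of $Q$ preserving $D$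 and this inner product. An elastica is an immersed plane curve whose curvature $\kappa(t)$, as a function of arc length, satisfies $\ddot\kappa+\frac12\kappa^3+A\kappa=0$ for some constant $A$; then $\frac12\dot\kappa^2+\frac18\kappa^4+\frac A2\kappa^2=B$ for some constant $B$. An Euler soliton is a complete elastica with $B=0$, $A<0$, $\kappa\not\equiv0$. The width of a plane curve is the infimum of the distances between two parallel lines bounding a strip which contains the curve. A tractrix here means a tractrix of width $\ell$: the image under a Euclidean isometry of the curve $t\mapsto(t-\ell\tanh(t/\ell),\ \ell\,\mathrm{sech}(t/\ell))$, $t\in\mathbb R$. *)

theory Defs
  imports "HOL-Analysis.Analysis"
begin

type_synonym plane = "real ^ 2"

text \<open>A configuration is a pair (back wheel, front wheel).\<close>

type_synonym config = "plane \<times> plane"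

definition Q :: "real \<Rightarrow> config set" where
  "Q l = {(b, f). norm (f - b) = l}"

text \<open>The usual epsilon-delta definition; a division of a subset of \<open>{a..b}\<close> is a finite family of
  non-overlapping compact intervals \<open>K = {Inf K..Sup K}\<close>.\<close>

definition abs_continuous_on :: "real \<Rightarrow> real \<Rightarrow> (real \<Rightarrow> 'a::metric_space) \<Rightarrow> bool" where
  "abs_continuous_on a b g \<longleftrightarrow>
     (\<forall>\<epsilon>>0. \<exists>\<delta>>0. \<forall>D T. D division_of T \<and> T \<subseteq> {a..b} \<and> (\<Sum>K\<in>D. Sup K - Inf K) < \<delta> \<longrightarrow>
        (\<Sum>K\<in>D. dist (g (Inf K)) (g (Sup K))) < \<epsilon>)"

text \<open>Here \<open>I\<close> is an interval. On a non-compact interval, absolute continuity means absolute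
  continuity on all compact subintervals. Only the values of \<open>\<gamma>\<close> on \<open>I\<close> matter.\<close>

definition bicycle_path :: "real \<Rightarrow> real set \<Rightarrow> (real \<Rightarrow> config) \<Rightarrow> bool" where
  "bicycle_path l I \<gamma> \<longleftrightarrow>
     (\<forall>t\<in>I. \<gamma> t \<in> Q l) \<and>
     (\<forall>a b. a \<le> b \<and> {a..b} \<subseteq> I \<longrightarrow> abs_continuous_on a b \<gamma>) \<and>
     (AE t in lebesgue. t \<in> I \<longrightarrow>
        (\<exists>c::real. ((\<lambda>s. fst (\<gamma> s)) has_vector_derivative c *\<^sub>R (snd (\<gamma> t) - fst (\<gamma> t)))
                     (at t within I)))"

text \<open>An absolutely continuous curve is differentiable almost everywhere with integrable
  derivative, so the integral below is the Euclidean length of the front track.\<close>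

definition front_length :: "(real \<Rightarrow> config) \<Rightarrow> real \<Rightarrow> real \<Rightarrow> real" where
  "front_length \<gamma> a b =
     integral {a..b} (\<lambda>t. norm (vector_derivative (\<lambda>s. snd (\<gamma> s)) (at t within {a..b})))"

definition front_arc_length_param :: "(real \<Rightarrow> config) \<Rightarrow> bool" where
  "front_arc_length_param \<gamma> \<longleftrightarrow>
     (AE t in lebesgue. \<exists>v. norm v = 1 \<and> ((\<lambda>s. snd (\<gamma> s)) has_vector_derivative v) (at t))"

definition infinite_bicycle_path :: "real \<Rightarrow> (real \<Rightarrow> config) \<Rightarrow> bool" where
  "infinite_bicycle_path l \<gamma> \<longleftrightarrow> bicycle_path l UNIV \<gamma> \<and> front_arc_length_param \<gamma>"

definition minimizing_on :: "real \<Rightarrow> (real \<Rightarrow> config) \<Rightarrow> real \<Rightarrow> real \<Rightarrow> bool" where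
  "minimizing_on l \<gamma> a b \<longleftrightarrow>
     (\<forall>\<eta> c d. c \<le> d \<and> bicycle_path l {c..d} \<eta> \<and> \<eta> c = \<gamma> a \<and> \<eta> d = \<gamma> b \<longrightarrow>
        front_length \<gamma> a b \<le> front_length \<eta> c d)"

definition global_minimizer :: "real \<Rightarrow> (real \<Rightarrow> config) \<Rightarrow> bool" where
  "global_minimizer l \<gamma> \<longleftrightarrow> (\<forall>a b. a \<le> b \<longrightarrow> minimizing_on l \<gamma> a b)"

text \<open>\<open>C\<^sup>k\<close> maps on an open set \<open>S\<close>, by iterated directional derivatives.\<close>

primrec Ck_on :: "nat \<Rightarrow> 'a::real_normed_vector set \<Rightarrow> ('a \<Rightarrow> 'b::real_normed_vector) \<Rightarrow> bool" where
  "Ck_on 0 S g \<longleftrightarrow> continuous_on S g"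
| "Ck_on (Suc k) S g \<longleftrightarrow>
     g differentiable_on S \<and> (\<forall>v. Ck_on k S (\<lambda>x. frechet_derivative g (at x) v))"

definition smooth_on :: "'a::real_normed_vector set \<Rightarrow> ('a \<Rightarrow> 'b::real_normed_vector) \<Rightarrow> bool" where
  "smooth_on S g \<longleftrightarrow> (\<forall>k. Ck_on k S g)"

text \<open>Smoothness on an arbitrary subset \<open>M\<close> (here, an embedded submanifold): local existence of
  smooth extensions to open sets of the ambient space.\<close>

definition smooth_map_on :: "'a::real_normed_vector set \<Rightarrow> ('a \<Rightarrow> 'b::real_normed_vector) \<Rightarrow> bool" where
  "smooth_map_on M g \<longleftrightarrow>
     (\<forall>x\<in>M. \<exists>U h. open U \<and> x \<in> U \<and> smooth_on U h \<and> (\<forall>y\<in>M \<inter> U. h y = g y))"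

definition diffeomorphism_of :: "'a::real_normed_vector set \<Rightarrow> ('a \<Rightarrow> 'a) \<Rightarrow> bool" where
  "diffeomorphism_of M g \<longleftrightarrow>
     bij_betw g M M \<and> smooth_map_on M g \<and> smooth_map_on M (inv_into M g)"

text \<open>Tangent vectors are the velocities of curves in \<open>Q l\<close>.\<close>

definition tangent_space :: "real \<Rightarrow> config \<Rightarrow> config set" where
  "tangent_space l q =
     {u. \<exists>c::real \<Rightarrow> config. (\<forall>t. c t \<in> Q l) \<and> c 0 = q \<and> (c has_vector_derivative u) (at 0)}"

definition no_skid_distribution :: "real \<Rightarrow> config \<Rightarrow> config set" where
  "no_skid_distribution l q =
     {u \<in> tangent_space l q. \<exists>c::real. fst u = c *\<^sub>R (snd q - fst q)}"

text \<open>A derivative of \<open>\<Phi>\<close> at \<open>q\<close> within \<open>Q l\<close> is determined on the tangent space, where it is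
  the differential of \<open>\<Phi>\<close>; its values on other vectors are irrelevant.\<close>

definition isometry_of_Q :: "real \<Rightarrow> (config \<Rightarrow> config) \<Rightarrow> bool" where
  "isometry_of_Q l \<Phi> \<longleftrightarrow>
     diffeomorphism_of (Q l) \<Phi> \<and>
     (\<forall>q\<in>Q l. \<exists>d\<Phi>. (\<Phi> has_derivative d\<Phi>) (at q within Q l) \<and>
        d\<Phi> ` no_skid_distribution l q = no_skid_distribution l (\<Phi> q) \<and>
        (\<forall>u\<in>no_skid_distribution l q. \<forall>w\<in>no_skid_distribution l q.
           snd (d\<Phi> u) \<bullet> snd (d\<Phi> w) = snd u \<bullet> snd w))"

definition flip :: "config \<Rightarrow> config" where
  "flip q = (fst q, 2 *\<^sub>R fst q - snd q)"

definition is_line :: "plane set \<Rightarrow> bool" where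
  "is_line S \<longleftrightarrow> (\<exists>p v. v \<noteq> 0 \<and> S = range (\<lambda>s::real. p + s *\<^sub>R v))"

definition unit_speed_line :: "(real \<Rightarrow> plane) \<Rightarrow> bool" where
  "unit_speed_line c \<longleftrightarrow> (\<exists>p v. norm v = 1 \<and> (\<forall>t. c t = p + t *\<^sub>R v))"

definition is_tractrix :: "real \<Rightarrow> plane set \<Rightarrow> bool" where
  "is_tractrix l S \<longleftrightarrow>
     (\<exists>g :: plane \<Rightarrow> plane. (\<forall>x y. dist (g x) (g y) = dist x y) \<and>
        S = g ` range (\<lambda>t::real. vector [t - l * tanh (t / l), l / cosh (t / l)]))"

text \<open>Signed curvature of a plane curve parametrized by arc length.\<close>

definition curvature :: "(real \<Rightarrow> plane) \<Rightarrow> real \<Rightarrow> real" where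
  "curvature c t =
     (let v = vector_derivative c (at t);
          w = vector_derivative (\<lambda>s. vector_derivative c (at s)) (at t)
      in v $ 1 * w $ 2 - v $ 2 * w $ 1)"

text \<open>Complete elasticae, parametrized by arc length.\<close>

definition elastica :: "real \<Rightarrow> (real \<Rightarrow> plane) \<Rightarrow> bool" where
  "elastica A c \<longleftrightarrow>
     smooth_on UNIV c \<and> (\<forall>t. norm (vector_derivative c (at t)) = 1) \<and>
     (\<forall>t. deriv (deriv (curvature c)) t + (1/2) * curvature c t ^ 3 + A * curvature c t = 0)"

text \<open>The quantity that is constant along an elastica, denoted \<open>B\<close> in the literature.\<close>

definition elastica_energy :: "real \<Rightarrow> (real \<Rightarrow> plane) \<Rightarrow> real \<Rightarrow> real" where
  "elastica_energy A c t =
     (1/2) * (deriv (curvature c) t)\<^sup>2 + (1/8) * curvature c t ^ 4 + (A/2) * (curvature c t)\<^sup>2"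

definition euler_soliton :: "(real \<Rightarrow> plane) \<Rightarrow> bool" where
  "euler_soliton c \<longleftrightarrow>
     (\<exists>A<0. elastica A c \<and> (\<forall>t. elastica_energy A c t = 0) \<and> (\<exists>t. curvature c t \<noteq> 0))"

text \<open>The parallel lines are \<open>n \<bullet> x = r\<close> and \<open>n \<bullet> x = s\<close>; the width is \<open>\<infinity>\<close> if no strip
  contains the set.\<close>

definition width :: "plane set \<Rightarrow> ereal" where
  "width S = Inf {ereal (s - r) | r s. r \<le> s \<and>
     (\<exists>n. norm n = 1 \<and> S \<subseteq> {x. r \<le> n \<bullet> x \<and> n \<bullet> x \<le> s})}"

definition front_track :: "(real \<Rightarrow> config) \<Rightarrow> real \<Rightarrow> plane" where
  "front_track \<gamma> t = snd (\<gamma> t)"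

definition back_track :: "(real \<Rightarrow> config) \<Rightarrow> real \<Rightarrow> plane" where
  "back_track \<gamma> t = fst (\<gamma> t)"

definition type1_path :: "real \<Rightarrow> (real \<Rightarrow> config) \<Rightarrow> bool" where
  "type1_path l \<gamma> \<longleftrightarrow>
     unit_speed_line (front_track \<gamma>) \<and>
     (is_tractrix l (range (back_track \<gamma>)) \<or> is_line (range (back_track \<gamma>)))"

definition type2_path :: "real \<Rightarrow> (real \<Rightarrow> config) \<Rightarrow> bool" where
  "type2_path l \<gamma> \<longleftrightarrow>
     euler_soliton (front_track \<gamma>) \<and> width (range (front_track \<gamma>)) = ereal (2 * l) \<and>
     is_tractrix l (range (back_track \<gamma>))"

end

theory Submission
  imports Defs
begin

text \<open>Write \<open>w\<close> for the unit vector from the back to the front wheel. The flip replaces \<open>w\<close> by \<open>-w\<close> and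
  preserves the front speed, since the component of the front velocity orthogonal to \<open>w\<close> only changes
  sign. A straight front track is a shortest path because the length of a front track is at least the
  distance of its end points; flipping gives minimality of the solitons.

  Conversely, turning the frame on the spot, riding straight and turning again joins two
  configurations with length at most the displacement of the back wheel plus a constant. Hence the
  excess of length over displacement of a global minimizer is bounded, and along suitable times
  tending to \<open>\<plusminus>\<infinity>\<close> the frame becomes parallel to the direction of travel. If it has the same sign at
  both ends, or if it turns from backward to forward, then comparison with a short turn, a straight
  ride or a ride along a tractrix, and another short turn shows that the excess of the front track
  tends to \<open>0\<close>, so that the front track is straight. The remaining case is the flip of this one.

  If the front track is straight, then \<open>w\<close> solves an explicitly solvable equation on the circle. If
  the front track is a soliton and the back track a tractrix, then \<open>w\<close> is tangent to the tractrix
  wherever the back wheel moves; it cannot rest, because the soliton contains no circular arc. So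
  the front wheel or its mirror image in the back wheel moves on the asymptote of the tractrix.\<close>


subsection \<open>Absolutely continuous curves\<close>

text \<open>No geodesic equation is derived: minimality is tested only against explicit competitors.
  What makes the comparison sharp is a balance of constants. If the back wheel is displaced by
  \<open>r\<close> along \<open>u\<close> while the frame goes from about
  \<open>\<sigma>' *\<^sub>R u\<close> to about \<open>\<sigma> *\<^sub>R u\<close>, the front wheel
  is displaced by about \<open>r + l * (\<sigma> - \<sigma>')\<close>. For equal signs this is
  \<open>r\<close>, the length of a straight ride. From backward to forward it is
  \<open>r + 2 * l\<close>, and a long tractrix arc has this length up to an error tending to 0.
  Since the excess of length over displacement grows with the interval, it then vanishes on every
  interval. From forward to backward the front wheel is displaced by only about
  \<open>r - 2 * l\<close>, and nothing is forced; this is where the solitons live, and the flip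
  exchanges the signs. Absolute continuity is the \<epsilon>-\<delta> notion, so almost everywhere
  differentiability and the fundamental theorem are derived from it by Vitali coverings and
  gauges.\<close>

lemma division_of_real_interval:
  fixes D :: "real set set"
  assumes "D division_of T" "K \<in> D"
  obtains u v where "u \<le> v" "K = {u..v}" "Sup K = v" "Inf K = u"
proof -
  obtain u v where "K = cbox u v" "K \<noteq> {}"
    using assms by (metis division_ofD(3) division_ofD(4))
  then show thesis by (intro that[of u v]) auto
qed

lemma division_telescope:
  fixes g :: "real \<Rightarrow> 'a::real_normed_vector"
  assumes "D division_of {a..b}" "a \<le> b"
  shows "(\<Sum>K\<in>D. g (Sup K) - g (Inf K)) = g b - g a"
proof -
  have "(\<lambda>K. (Inf K, K)) ` D tagged_division_of {a..b}"
  proof (rule tagged_division_ofI)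
    show "finite ((\<lambda>K. (Inf K, K)) ` D)" using assms by auto
    have "{K. \<exists>x. (x, K) \<in> (\<lambda>K. (Inf K, K)) ` D} = D" by auto
    then show "\<Union> {K. \<exists>x. (x, K) \<in> (\<lambda>K. (Inf K, K)) ` D} = {a..b}"
      using division_ofD(6)[OF assms(1)] by simp
  next
    fix x K assume "(x, K) \<in> (\<lambda>K. (Inf K, K)) ` D"
    then have K: "K \<in> D" "x = Inf K" by auto
    obtain u v where uv: "u \<le> v" "K = {u..v}" "Inf K = u" using division_of_real_interval assms(1) K by metis
    show "x \<in> K" using uv K by auto
    show "K \<subseteq> {a..b}" using K assms by blast
    show "\<exists>a b. K = cbox a b" using uv by auto
    fix x' K' assume "(x', K') \<in> (\<lambda>K. (Inf K, K)) ` D" "(x, K) \<noteq> (x', K')"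
    then show "interior K \<inter> interior K' = {}"
      using division_ofD(5)[OF assms(1)] K by auto
  qed
  from additive_tagged_division_1[OF assms(2) this, of g]
  have "(\<Sum>(x,K)\<in>(\<lambda>K. (Inf K, K)) ` D. g (Sup K) - g (Inf K)) = g b - g a" .
  then show ?thesis
    by (subst (asm) sum.reindex) (auto simp: inj_on_def)
qed

text \<open>One and the same family of intervals completes every division of \<open>T\<close> to a
  division of a large interval, where the increments telescope to a value that does not depend on
  the division.\<close>

lemma division_sum_unique:
  fixes g :: "real \<Rightarrow> 'a::real_normed_vector"
  assumes "D division_of T" "E division_of T"
  shows "(\<Sum>K\<in>D. g (Sup K) - g (Inf K)) = (\<Sum>K\<in>E. g (Sup K) - g (Inf K))"
proof (cases "T = {}")
  case True
  then show ?thesis using assms by (metis division_ofD(2) division_ofD(3) all_not_in_conv subset_empty)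
next
  case False
  obtain a b where ab: "T \<subseteq> cbox a b"
    using assms(1) by (meson elementary_subset_cbox)
  then have ab': "a \<le> b" "T \<subseteq> {a..b}" using False by auto
  obtain F where F: "D \<subseteq> F" "F division_of {a..b}"
    using partial_division_extend_interval[of D a b] assms ab' division_ofD(6)[OF assms(1)]
    by (metis box_real(2) division_of_union_self)
  let ?R = "F - D"
  have R: "?R division_of \<Union>?R" using F by (metis Diff_subset division_of_subset division_of_union_self)
  have fin: "finite F" "finite D" "finite E" using F assms by auto
  have int: "interior T \<inter> interior (\<Union>?R) = {}"
  proof (rule Int_interior_Union_intervals)
    show "finite ?R" using fin by auto
    show "open (interior T)" by auto
    fix K assume K: "K \<in> ?R"
    then show "\<exists>a b. K = cbox a b" using F by blast
    have "interior K \<inter> interior (\<Union>D) = {}"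
    proof (rule Int_interior_Union_intervals)
      fix L assume "L \<in> D"
      then show "\<exists>a b. L = cbox a b" using assms by blast
      show "interior K \<inter> interior L = {}" using \<open>L \<in> D\<close> K F division_ofD(5)[OF F(2)] by blast
    qed (use fin in auto)
    then show "interior T \<inter> interior K = {}" using division_ofD(6)[OF assms(1)] by auto
  qed
  have key: "(\<Sum>K\<in>G. g (Sup K) - g (Inf K)) + (\<Sum>K\<in>?R. g (Sup K) - g (Inf K)) = g b - g a"
    if G: "G division_of T" for G
  proof -
    have "G \<union> ?R division_of (T \<union> \<Union>?R)" by (rule division_disjoint_union[OF G R int])
    moreover have "\<Union>D \<union> \<Union>?R = \<Union>F" using F(1) by (metis Un_Diff_cancel Union_Un_distrib sup.absorb2)
    ultimately have "G \<union> ?R division_of {a..b}"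
      unfolding division_ofD(6)[OF F(2)] division_ofD(6)[OF assms(1)] by simp
    then have 1: "(\<Sum>K\<in>G \<union> ?R. g (Sup K) - g (Inf K)) = g b - g a"
      using ab'(1) by (rule division_telescope)
    have "(\<Sum>K\<in>G \<union> ?R. g (Sup K) - g (Inf K)) + (\<Sum>K\<in>G \<inter> ?R. g (Sup K) - g (Inf K)) =
      (\<Sum>K\<in>G. g (Sup K) - g (Inf K)) + (\<Sum>K\<in>?R. g (Sup K) - g (Inf K))"
      by (rule sum.union_inter) (use G fin in auto)
    \<comment> \<open>A common member has empty interior, lying both in \<open>T\<close> and in the
      complementary family: it is a single point.\<close>
    moreover have "(\<Sum>K\<in>G \<inter> ?R. g (Sup K) - g (Inf K)) = 0"
    proof (rule sum.neutral, safe)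
      fix K assume K: "K \<in> G" "K \<in> F" "K \<notin> D"
      obtain u v where uv: "u \<le> v" "K = {u..v}" "Sup K = v" "Inf K = u"
        using division_of_real_interval[OF G K(1)] by metis
      have "interior K \<subseteq> interior T" using K G by (meson division_ofD(2) interior_mono)
      moreover have "interior K \<subseteq> interior (\<Union>?R)" using K by (intro interior_mono) auto
      ultimately have "interior K = {}" using int by blast
      then have "u = v" using uv by auto
      then show "g (Sup K) - g (Inf K) = 0" using uv by auto
    qed
    ultimately show ?thesis using 1 by simp
  qed
  show ?thesis using key[OF assms(1)] key[OF assms(2)] by (metis add_right_cancel)
qed

lemma division_content_sum:
  fixes D :: "real set set"
  assumes "D division_of T"
  shows "(\<Sum>K\<in>D. Sup K - Inf K) = measure lebesgue T"
proof -
  have "(\<Sum>K\<in>D. Sup K - Inf K) = (\<Sum>K\<in>D. measure lebesgue K)"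
    by (rule sum.cong) (use division_of_real_interval[OF assms] in \<open>force+\<close>)
  also have "\<dots> = measure lebesgue T"
    using content_division[OF assms] by simp
  finally show ?thesis .
qed

section \<open>Vitali coverings and almost everywhere differentiability\<close>

text \<open>\<open>P\<close> stands for a condition on the slope over \<open>{u..v}\<close>. The
  countable Vitali theorem gives disjoint intervals covering \<open>A\<close> up to a null set;
  finitely many of them exhaust the measure of the union up to \<open>e\<close>, and what they miss
  is put into \<open>H\<close>.\<close>

lemma Vitali_finite:
  fixes A U :: "real set"
  assumes U: "open U" "bounded U" "A \<subseteq> U"
    and cov: "\<And>x d. x \<in> A \<Longrightarrow> 0 < d \<Longrightarrow> \<exists>u v. u < v \<and> v - u < d \<and> x \<in> {u..v} \<and> P u v"
    and e: "e > 0"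
  obtains D H where "D division_of \<Union>D" "\<Union>D \<subseteq> U" "\<forall>K\<in>D. \<exists>u v. u < v \<and> K = {u..v} \<and> P u v"
    "A - \<Union>D \<subseteq> H" "H \<in> lmeasurable" "measure lebesgue H < e"
proof -
  let ?K = "{(u, v). u < v \<and> {u..v} \<subseteq> U \<and> P u v}"
  \<comment> \<open>The covering theorem speaks of balls, so intervals are encoded by midpoint and
    half length.\<close>
  let ?a = "\<lambda>(u,v). (u + v) / 2 :: real" and ?r = "\<lambda>(u,v). (v - u) / 2 :: real"
  have cb: "cball (?a i) (?r i) = {fst i..snd i}" for i :: "real \<times> real"
    by (cases i) (auto simp: cball_def dist_real_def abs_if field_simps split: if_splits)
  have 1: "0 < ?r i" if "i \<in> ?K" for i using that by auto
  have 2: "\<exists>i. i \<in> ?K \<and> x \<in> cball (?a i) (?r i) \<and> ?r i < d" if x: "x \<in> A" "0 < d" for x d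
  proof -
    obtain d' where d': "d' > 0" "cball x d' \<subseteq> U" using U x open_contains_cball by blast
    obtain u v where uv: "u < v" "v - u < min d d'" "x \<in> {u..v}" "P u v"
      using cov[of x "min d d'"] x d' by auto
    have "{u..v} \<subseteq> cball x d'" using uv by (auto simp: dist_real_def)
    then have "(u,v) \<in> ?K" using uv d' by auto
    then show ?thesis
      unfolding cb using uv by (intro exI[of _ "(u,v)"]) auto
  qed
  obtain C where C: "countable C" "C \<subseteq> ?K" 
     "pairwise (\<lambda>i j. disjnt (cball (?a i) (?r i)) (cball (?a j) (?r j))) C"
     "negligible(A - (\<Union>i \<in> C. cball (?a i) (?r i)))"
    by (rule Vitali_covering_theorem_cballs[of ?K ?r A ?a, OF 1 2])
  let ?I = "\<lambda>i::real\<times>real. {fst i..snd i}"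
  let ?D = "?I ` C"
  have neg: "negligible (A - \<Union>?D)" using C(4) unfolding cb by simp
  have disj: "i \<in> C \<Longrightarrow> j \<in> C \<Longrightarrow> i \<noteq> j \<Longrightarrow> ?I i \<inter> ?I j = {}" for i j
    using C(3) unfolding cb pairwise_def disjnt_def by blast
  have Ulm: "U \<in> lmeasurable" using U by (simp add: lmeasurable_open)
  have sub: "\<Union>?D \<subseteq> U" using C(2) by fastforce
  have lmI: "K \<in> ?D \<Longrightarrow> K \<in> lmeasurable" for K by auto
  have cD: "countable ?D" using C(1) by auto
  have cm: "\<Union>?D \<in> sets lebesgue" using cD by (intro sets.countable_Union) auto
  then have clm: "\<Union>?D \<in> lmeasurable" using Ulm sub fmeasurableI2 by metis
  have bnd: "\<And>\<D>'. \<D>' \<subseteq> ?D \<Longrightarrow> finite \<D>' \<Longrightarrow> measure lebesgue (\<Union>\<D>') \<le> measure lebesgue U"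
    using lmI sub Ulm by (intro measure_mono_fmeasurable) (auto intro!: sets.finite_Union)
  obtain D where D: "D \<subseteq> ?D" "finite D" "measure lebesgue (\<Union>?D) - e < measure lebesgue (\<Union>D)"
    by (rule measure_countable_Union_approachable[OF cD e lmI bnd]) auto
  have DU: "\<Union>D \<subseteq> \<Union>?D" using D by auto
  have Dlm: "\<Union>D \<in> lmeasurable" using D lmI by (intro fmeasurable.finite_Union) auto
  show thesis
  proof (rule that[of D "(A - \<Union>?D) \<union> (\<Union>?D - \<Union>D)"])
    show "D division_of \<Union>D"
      unfolding division_of_def
    proof (intro conjI ballI impI)
      fix K assume "K \<in> D"
      then obtain i where "i \<in> C" "K = ?I i" using D(1) by blast
      then show "K \<noteq> {}" "\<exists>a b. K = cbox a b" using C(2) by fastforce+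
      fix L assume L: "L \<in> D" "K \<noteq> L"
      obtain i j where ij: "i \<in> C" "K = ?I i" "j \<in> C" "L = ?I j" using \<open>K \<in> D\<close> L D by blast
      then have "K \<inter> L = {}" using disj L by metis
      then show "interior K \<inter> interior L = {}" using interior_subset by blast
    qed (auto simp: D(2))
    show "\<Union>D \<subseteq> U" by (rule order_trans[OF DU sub])
    show "\<forall>K\<in>D. \<exists>u v. u < v \<and> K = {u..v} \<and> P u v"
    proof
      fix K assume "K \<in> D"
      then obtain i where "i \<in> C" "K = ?I i" using D(1) by blast
      then show "\<exists>u v. u < v \<and> K = {u..v} \<and> P u v" using C(2) by (cases i) auto
    qed
    show "A - \<Union> D \<subseteq> A - \<Union> ?D \<union> (\<Union> ?D - \<Union> D)" by auto
    have "A - \<Union> ?D \<in> lmeasurable" "measure lebesgue (A - \<Union> ?D) = 0"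
      using neg by (auto simp: negligible_imp_measurable negligible_imp_measure0)
    moreover have 2: "\<Union> ?D - \<Union> D \<in> lmeasurable" using clm Dlm by blast
    moreover have "measure lebesgue (\<Union> ?D - \<Union> D) = measure lebesgue (\<Union> ?D) - measure lebesgue (\<Union> D)"
      using clm Dlm DU by (intro measurable_measure_Diff) auto
    ultimately show "A - \<Union> ?D \<union> (\<Union> ?D - \<Union> D) \<in> lmeasurable" 
       "measure lebesgue (A - \<Union> ?D \<union> (\<Union> ?D - \<Union> D)) < e"
      using measure_Un_le[of "A - \<Union> ?D" lebesgue "\<Union> ?D - \<Union> D"] D(3) by (auto simp: fmeasurableD)
  qed
qed

lemma abs_continuous_onD:
  assumes "abs_continuous_on a b g" "\<epsilon> > 0"
  obtains \<delta> where "\<delta> > 0" "\<And>D T. D division_of T \<Longrightarrow> T \<subseteq> {a..b} \<Longrightarrow> (\<Sum>K\<in>D. Sup K - Inf K) < \<delta> \<Longrightarrow>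
        (\<Sum>K\<in>D. dist (g (Inf K)) (g (Sup K))) < \<epsilon>"
  using assms unfolding abs_continuous_on_def by metis

lemma abs_continuous_on_subinterval:
  assumes "abs_continuous_on a b g" "{c..d} \<subseteq> {a..b}"
  shows "abs_continuous_on c d g"
  unfolding abs_continuous_on_def
proof (intro allI impI)
  fix \<epsilon> :: real assume "\<epsilon> > 0"
  obtain \<delta> where "\<delta> > 0" "\<And>D T. D division_of T \<Longrightarrow> T \<subseteq> {a..b} \<Longrightarrow> (\<Sum>K\<in>D. Sup K - Inf K) < \<delta> \<Longrightarrow>
        (\<Sum>K\<in>D. dist (g (Inf K)) (g (Sup K))) < \<epsilon>"
    by (rule abs_continuous_onD[OF assms(1) \<open>\<epsilon> > 0\<close>], rule that) (assumption | blast)+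
  then show "\<exists>\<delta>>0. \<forall>D T. D division_of T \<and> T \<subseteq> {c..d} \<and> (\<Sum>K\<in>D. Sup K - Inf K) < \<delta> \<longrightarrow>
        (\<Sum>K\<in>D. dist (g (Inf K)) (g (Sup K))) < \<epsilon>"
    using assms(2) by (meson order_trans)
qed

lemma abs_continuous_on_id: "abs_continuous_on a b (\<lambda>x. x)"
  unfolding abs_continuous_on_def
proof (intro allI impI)
  fix \<epsilon> :: real assume "\<epsilon> > 0"
  moreover have "(\<Sum>K\<in>D. dist (Inf K) (Sup K)) = (\<Sum>K\<in>D. Sup K - Inf K)" if "D division_of T" for D T
    by (rule sum.cong) (use division_of_real_interval[OF that] in \<open>force simp: dist_real_def\<close>)+
  ultimately show "\<exists>\<delta>>0. \<forall>D T. D division_of T \<and> T \<subseteq> {a..b} \<and> (\<Sum>K\<in>D. Sup K - Inf K) < \<delta> \<longrightarrow>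
        (\<Sum>K\<in>D. dist (Inf K) (Sup K)) < \<epsilon>"
    by (intro exI[of _ \<epsilon>]) auto
qed

text \<open>Two dominating curves are allowed in view of the later uses: a function with a linear
  part subtracted, and the frame, which depends on both wheels.\<close>

lemma abs_continuous_on_dominated2:
  fixes g1 :: "real \<Rightarrow> 'a::metric_space" and g2 :: "real \<Rightarrow> 'b::metric_space" and h :: "real \<Rightarrow> 'c::metric_space"
  assumes g: "abs_continuous_on a b g1" "abs_continuous_on a b g2"
    and h: "\<And>x y. x \<in> {a..b} \<Longrightarrow> y \<in> {a..b} \<Longrightarrow> dist (h x) (h y) \<le> C * dist (g1 x) (g1 y) + C * dist (g2 x) (g2 y)"
  shows "abs_continuous_on a b h"
  unfolding abs_continuous_on_def
proof (intro allI impI)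
  fix \<epsilon> :: real assume e: "\<epsilon> > 0"
  let ?C = "\<bar>C\<bar> + 1"
  have e': "\<epsilon> / (2 * ?C) > 0" using e by auto
  obtain d1 where d1: "d1 > 0" "\<And>D T. D division_of T \<Longrightarrow> T \<subseteq> {a..b} \<Longrightarrow> (\<Sum>K\<in>D. Sup K - Inf K) < d1 \<Longrightarrow>
        (\<Sum>K\<in>D. dist (g1 (Inf K)) (g1 (Sup K))) < \<epsilon> / (2 * ?C)"
    by (rule abs_continuous_onD[OF g(1) e'], rule that) (assumption | blast)+
  obtain d2 where d2: "d2 > 0" "\<And>D T. D division_of T \<Longrightarrow> T \<subseteq> {a..b} \<Longrightarrow> (\<Sum>K\<in>D. Sup K - Inf K) < d2 \<Longrightarrow>
        (\<Sum>K\<in>D. dist (g2 (Inf K)) (g2 (Sup K))) < \<epsilon> / (2 * ?C)"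
    by (rule abs_continuous_onD[OF g(2) e'], rule that) (assumption | blast)+
  show "\<exists>\<delta>>0. \<forall>D T. D division_of T \<and> T \<subseteq> {a..b} \<and> (\<Sum>K\<in>D. Sup K - Inf K) < \<delta> \<longrightarrow>
        (\<Sum>K\<in>D. dist (h (Inf K)) (h (Sup K))) < \<epsilon>"
  proof (intro exI[of _ "min d1 d2"] conjI allI impI; (elim conjE)?)
    fix D T assume D: "D division_of T" "T \<subseteq> {a..b}" "(\<Sum>K\<in>D. Sup K - Inf K) < min d1 d2"
    have "(\<Sum>K\<in>D. dist (h (Inf K)) (h (Sup K))) \<le> (\<Sum>K\<in>D. ?C * dist (g1 (Inf K)) (g1 (Sup K)) + ?C * dist (g2 (Inf K)) (g2 (Sup K)))"
    proof (rule sum_mono)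
      fix K assume K: "K \<in> D"
      obtain u v where uv: "u \<le> v" "K = {u..v}" "Sup K = v" "Inf K = u"
        using division_of_real_interval[OF D(1) K] by metis
      have "K \<subseteq> {a..b}" using K D by blast
      then have "Inf K \<in> {a..b}" "Sup K \<in> {a..b}" using uv by auto
      from h[OF this] have "dist (h (Inf K)) (h (Sup K)) \<le> C * dist (g1 (Inf K)) (g1 (Sup K)) + C * dist (g2 (Inf K)) (g2 (Sup K))" .
      also have "\<dots> \<le> ?C * dist (g1 (Inf K)) (g1 (Sup K)) + ?C * dist (g2 (Inf K)) (g2 (Sup K))"
        by (intro add_mono mult_right_mono) auto
      finally show "dist (h (Inf K)) (h (Sup K)) \<le> ?C * dist (g1 (Inf K)) (g1 (Sup K)) + ?C * dist (g2 (Inf K)) (g2 (Sup K))" .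
    qed
    also have "\<dots> = ?C * (\<Sum>K\<in>D. dist (g1 (Inf K)) (g1 (Sup K))) + ?C * (\<Sum>K\<in>D. dist (g2 (Inf K)) (g2 (Sup K)))"
      by (simp add: sum.distrib sum_distrib_left)
    also have "\<dots> < ?C * (\<epsilon> / (2 * ?C)) + ?C * (\<epsilon> / (2 * ?C))"
      using D d1 d2 by (intro add_strict_mono mult_strict_left_mono) auto
    also have "?C * (\<epsilon> / (2 * ?C)) + ?C * (\<epsilon> / (2 * ?C)) = \<epsilon>"
    proof -
      have "c * (\<epsilon> / (2 * c)) + c * (\<epsilon> / (2 * c)) = \<epsilon>" if "c > 0" for c :: real
        using that by (simp add: field_simps)
      from this[of ?C] show ?thesis by simp
    qed
    finally show "(\<Sum>K\<in>D. dist (h (Inf K)) (h (Sup K))) < \<epsilon>" .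
  qed (use d1 d2 in auto)
qed

lemma abs_continuous_on_dominated:
  fixes g :: "real \<Rightarrow> 'a::metric_space" and h :: "real \<Rightarrow> 'c::metric_space"
  assumes g: "abs_continuous_on a b g"
    and h: "\<And>x y. x \<in> {a..b} \<Longrightarrow> y \<in> {a..b} \<Longrightarrow> dist (h x) (h y) \<le> C * dist (g x) (g y)"
  shows "abs_continuous_on a b h"
proof (rule abs_continuous_on_dominated2[OF g g, of _ "\<bar>C\<bar>"])
  fix x y assume "x \<in> {a..b}" "y \<in> {a..b}"
  from h[OF this] show "dist (h x) (h y) \<le> \<bar>C\<bar> * dist (g x) (g y) + \<bar>C\<bar> * dist (g x) (g y)"
    by (smt (verit) abs_ge_self mult_nonneg_nonneg mult_right_mono zero_le_dist)
qed

lemma lipschitz_abs_continuous_on: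
  assumes "\<And>x y. x \<in> {a..b} \<Longrightarrow> y \<in> {a..b} \<Longrightarrow> dist (g x) (g y) \<le> C * \<bar>x - y\<bar>"
  shows "abs_continuous_on a b g"
  by (rule abs_continuous_on_dominated[OF abs_continuous_on_id, of _ _ g C]) (use assms in \<open>auto simp: dist_real_def\<close>)

text \<open>After subtracting \<open>p * x\<close>, cover \<open>A\<close> up to small measure by finitely many intervals with slope
  at least \<open>q - p\<close>, and then again, inside these, by finitely many intervals with slope at most \<open>0\<close>. The
  increments over the first family come from the gaps between the two, which have small total length.\<close>

lemma abs_continuous_on_slope_gap_negligible:
  fixes g :: "real \<Rightarrow> real"
  assumes g: "abs_continuous_on a b g" and pq: "p < q"
    and A: "\<And>x. x \<in> A \<Longrightarrow> a < x \<and> x < b"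
    and lo: "\<And>x d. x \<in> A \<Longrightarrow> d > 0 \<Longrightarrow> \<exists>u v. u < v \<and> v - u < d \<and> x \<in> {u..v} \<and> g v - g u \<le> p * (v - u)"
    and hi: "\<And>x d. x \<in> A \<Longrightarrow> d > 0 \<Longrightarrow> \<exists>u v. u < v \<and> v - u < d \<and> x \<in> {u..v} \<and> g v - g u \<ge> q * (v - u)"
  shows "negligible A"
proof -
  define h where "h = (\<lambda>x. g x - p * x)"
  have h: "abs_continuous_on a b h"
  proof (rule abs_continuous_on_dominated2[OF g abs_continuous_on_id, of _ "1 + \<bar>p\<bar>"])
    fix x y
    have "dist (h x) (h y) \<le> \<bar>g x - g y\<bar> + \<bar>p * (x - y)\<bar>" by (simp add: h_def dist_real_def algebra_simps)
    also have "\<dots> \<le> (1 + \<bar>p\<bar>) * dist (g x) (g y) + (1 + \<bar>p\<bar>) * dist x y"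
    proof -
      have "\<bar>p * (x - y)\<bar> \<le> (1 + \<bar>p\<bar>) * \<bar>x - y\<bar>" "\<bar>g x - g y\<bar> \<le> (1 + \<bar>p\<bar>) * \<bar>g x - g y\<bar>"
        unfolding abs_mult by (simp_all add: distrib_right)
      then show ?thesis by (simp add: dist_real_def)
    qed
    finally show "dist (h x) (h y) \<le> (1 + \<bar>p\<bar>) * dist (g x) (g y) + (1 + \<bar>p\<bar>) * dist x y" .
  qed
  define \<alpha> where "\<alpha> = q - p"
  have \<alpha>: "\<alpha> > 0" using pq by (simp add: \<alpha>_def)
  let ?M = "{measure lebesgue B |B. B \<in> lmeasurable \<and> A \<subseteq> B}"
  \<comment> \<open>\<open>m\<close> is the outer measure of \<open>A\<close>, which is not known to
    be measurable.\<close>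
  define m where "m = Inf ?M"
  have "measure lebesgue {a..b} \<in> ?M" using A by (force intro!: exI[of _ "{a..b}"])
  then have ne: "?M \<noteq> {}" by blast
  have bdd: "bdd_below ?M" by (rule bdd_belowI[of _ 0]) auto
  have m: "m \<le> measure lebesgue B" if "B \<in> lmeasurable" "A \<subseteq> B" for B
    unfolding m_def by (rule cInf_lower[OF _ bdd]) (use that in auto)
  \<comment> \<open>With \<open>\<epsilon>\<close> a fixed part of \<open>m\<close> and
    \<open>\<eta>\<close> small, this is possible only for \<open>m \<le> 0\<close>.\<close>
  have key: "\<alpha> * (m - \<epsilon>) \<le> \<eta>" if e: "\<epsilon> > 0" and eta: "\<eta> > 0" for \<epsilon> \<eta>
  proof -
    obtain d where d: "d > 0" "\<And>D T. D division_of T \<Longrightarrow> T \<subseteq> {a..b} \<Longrightarrow> (\<Sum>K\<in>D. Sup K - Inf K) < d \<Longrightarrow>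
        (\<Sum>K\<in>D. dist (h (Inf K)) (h (Sup K))) < \<eta>"
      by (rule abs_continuous_onD[OF h eta], rule that) (assumption | blast)+
    \<comment> \<open>The gaps between the two families will have total length below
      \<open>3 * \<epsilon>'\<close>: the first family measures less than
      \<open>m + \<epsilon>'\<close>, the second at least
      \<open>m - 2 * \<epsilon>'\<close>.\<close>
    define \<epsilon>' where "\<epsilon>' = min \<epsilon> (d / 4)"
    have e': "\<epsilon>' > 0" "\<epsilon>' \<le> \<epsilon>" "3 * \<epsilon>' < d" using e d by (auto simp: \<epsilon>'_def)
    have "m < m + \<epsilon>' / 2" using e' by simp
    then obtain B where B: "B \<in> lmeasurable" "A \<subseteq> B" "measure lebesgue B < m + \<epsilon>' / 2"
      using cInf_lessD[OF ne, of "m + \<epsilon>' / 2"] unfolding m_def by auto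
    have "\<epsilon>' / 2 > 0" using e' by simp
    then obtain V where V: "open V" "B \<subseteq> V" "V - B \<in> lmeasurable" "emeasure lebesgue (V - B) < ennreal (\<epsilon>' / 2)"
      using sets_lebesgue_outer_open[of B "\<epsilon>' / 2"] fmeasurableD[OF B(1)] by metis
    have "measure lebesgue (V - B) < \<epsilon>' / 2"
      using V(3,4) e' by (metis emeasure_eq_measure2 ennreal_less_iff measure_nonneg)
    moreover have VB: "V = B \<union> (V - B)" using V by auto
    moreover have "measure lebesgue (B \<union> (V - B)) \<le> measure lebesgue B + measure lebesgue (V - B)"
      using B(1) V(3) by (intro measure_Un_le) (auto dest: fmeasurableD)
    ultimately have Vm: "V \<in> lmeasurable" "measure lebesgue V < m + \<epsilon>'"
      using fmeasurable.Un[OF B(1) V(3)] B(3) by auto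
    define U where "U = V \<inter> {a<..<b}"
    have U: "open U" "bounded U" "A \<subseteq> U" "U \<subseteq> {a..b}" "U \<subseteq> V"
      using V B A unfolding U_def by (auto intro: bounded_subset[OF bounded_closed_interval[of a b]])
    have hi': "\<exists>u v. u < v \<and> v - u < d \<and> x \<in> {u..v} \<and> h v - h u \<ge> \<alpha> * (v - u)" if "x \<in> A" "0 < d" for x d
      using hi[OF that] unfolding h_def \<alpha>_def by (auto simp: algebra_simps)
    obtain D1 H1 where D1: "D1 division_of \<Union>D1" "\<Union>D1 \<subseteq> U"
       "\<forall>K\<in>D1. \<exists>u v. u < v \<and> K = {u..v} \<and> h v - h u \<ge> \<alpha> * (v - u)"
       "A - \<Union>D1 \<subseteq> H1" "H1 \<in> lmeasurable" "measure lebesgue H1 < \<epsilon>'"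
      by (rule Vitali_finite[OF U(1-3) hi' e'(1)])
    \<comment> \<open>Open, so that the second covering can be confined to it; only the finitely
      many end points in \<open>F\<close> are lost.\<close>
    define W where "W = (\<Union>K\<in>D1. interior K)"
    have W: "open W" unfolding W_def by (intro open_UN ballI open_interior)
    have W2: "W \<subseteq> \<Union>D1" unfolding W_def using interior_subset by blast
    have bW: "bounded W" using W2 D1(2) U(2) by (meson bounded_subset order_trans)
    define F where "F = Inf ` D1 \<union> Sup ` D1"
    have fin: "finite D1" using D1 by auto
    then have F: "finite F" unfolding F_def by auto
    have WF: "\<Union>D1 \<subseteq> W \<union> F"
    proof
      fix x assume "x \<in> \<Union>D1"
      then obtain K where K: "K \<in> D1" "x \<in> K" by auto
      obtain u v where "u \<le> v" "K = {u..v}" "Sup K = v" "Inf K = u" using division_of_real_interval[OF D1(1) K(1)] by metis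
      then show "x \<in> W \<union> F" unfolding W_def F_def using K by (cases "x = u \<or> x = v") force+
    qed
    have lo': "\<exists>u v. u < v \<and> v - u < d \<and> x \<in> {u..v} \<and> h v - h u \<le> 0" if "x \<in> A \<inter> W" "0 < d" for x d
      using lo[OF _ that(2), of x] that(1) unfolding h_def by (auto simp: algebra_simps)
    obtain D2 H2 where D2: "D2 division_of \<Union>D2" "\<Union>D2 \<subseteq> W"
       "\<forall>K\<in>D2. \<exists>u v. u < v \<and> K = {u..v} \<and> h v - h u \<le> 0"
       "A \<inter> W - \<Union>D2 \<subseteq> H2" "H2 \<in> lmeasurable" "measure lebesgue H2 < \<epsilon>'"
      by (rule Vitali_finite[OF W bW Int_lower2 lo' e'(1)])
    have D21: "\<Union>D2 \<subseteq> \<Union>D1" using D2(2) W2 by (rule order_trans)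
    obtain R where R: "D2 \<subseteq> R" "R division_of \<Union>D1"
      using partial_division_extend[OF D2(1) D1(1) D21] by metis
    have finR: "finite R" using R by auto
    have lm1: "\<Union>D1 \<in> lmeasurable" "\<Union>D2 \<in> lmeasurable" using D1(1) D2(1) lmeasurable_division by blast+
    have m1: "measure lebesgue (\<Union>D1) < m + \<epsilon>'"
    proof -
      have "measure lebesgue (\<Union>D1) \<le> measure lebesgue V"
        using D1(2) U(5) lm1 Vm by (intro measure_mono_fmeasurable) (auto dest: fmeasurableD)
      then show ?thesis using Vm by simp
    qed
    have m2: "m \<le> measure lebesgue (\<Union>D1) + \<epsilon>'"
    proof -
      have "m \<le> measure lebesgue (\<Union>D1 \<union> H1)" using D1 lm1 by (intro m) auto
      also have "\<dots> \<le> measure lebesgue (\<Union>D1) + measure lebesgue H1" using D1 lm1 by (intro measure_Un_le) (auto dest: fmeasurableD)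
      finally show ?thesis using D1 by simp
    qed
    have m3: "m \<le> measure lebesgue (\<Union>D2) + 2 * \<epsilon>'"
    proof -
      have nF: "F \<in> lmeasurable" "measure lebesgue F = 0"
        using negligible_finite[OF F] by (auto simp: negligible_imp_measurable negligible_imp_measure0)
      have "A \<subseteq> (\<Union>D2 \<union> H2) \<union> (H1 \<union> F)" using D1(4) D2(4) WF by blast
      then have "m \<le> measure lebesgue ((\<Union>D2 \<union> H2) \<union> (H1 \<union> F))" using D1 D2 lm1 nF by (intro m) auto
      also have "\<dots> \<le> measure lebesgue (\<Union>D2 \<union> H2) + measure lebesgue (H1 \<union> F)" 
         using D1 D2 lm1 nF by (intro measure_Un_le) (auto dest: fmeasurableD)
      also have "\<dots> \<le> (measure lebesgue (\<Union>D2) + measure lebesgue H2) + (measure lebesgue H1 + measure lebesgue F)" 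
         using D1 D2 lm1 nF by (intro add_mono measure_Un_le) (auto dest: fmeasurableD)
      finally show ?thesis using D1 D2 nF by simp
    qed
    have sR: "(\<Sum>K\<in>R. w K) = (\<Sum>K\<in>D2. w K) + (\<Sum>K\<in>R - D2. w K)" for w :: "real set \<Rightarrow> real"
      using sum.subset_diff[OF R(1) finR, of w] by simp
    have "(\<Sum>K\<in>R - D2. Sup K - Inf K) = measure lebesgue (\<Union>D1) - measure lebesgue (\<Union>D2)"
      using sR[of "\<lambda>K. Sup K - Inf K"] division_content_sum[OF R(2)] division_content_sum[OF D2(1)] by simp
    also have "\<dots> < d" using m1 m3 e' by linarith
    finally have small: "(\<Sum>K\<in>R - D2. Sup K - Inf K) < d" .
    have RD: "R - D2 division_of \<Union>(R - D2)" using R by (metis Diff_subset division_of_subset division_of_union_self)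
    have "\<Union>(R - D2) \<subseteq> {a..b}" using division_ofD(6)[OF R(2)] D1(2) U(4) by (metis Diff_subset Union_mono order_trans)
    from d(2)[OF RD this small] have sm: "(\<Sum>K\<in>R - D2. dist (h (Inf K)) (h (Sup K))) < \<eta>" .
    have "\<alpha> * measure lebesgue (\<Union>D1) = (\<Sum>K\<in>D1. \<alpha> * (Sup K - Inf K))"
      unfolding division_content_sum[OF D1(1), symmetric] by (rule sum_distrib_left)
    also have "\<dots> \<le> (\<Sum>K\<in>D1. h (Sup K) - h (Inf K))"
    proof (rule sum_mono)
      fix K assume "K \<in> D1"
      from D1(3)[rule_format, OF this] show "\<alpha> * (Sup K - Inf K) \<le> h (Sup K) - h (Inf K)" by auto
    qed
    also have "\<dots> = (\<Sum>K\<in>R. h (Sup K) - h (Inf K))" by (rule division_sum_unique[OF D1(1) R(2)])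
    also have "\<dots> = (\<Sum>K\<in>D2. h (Sup K) - h (Inf K)) + (\<Sum>K\<in>R - D2. h (Sup K) - h (Inf K))" by (rule sR)
    also have "\<dots> \<le> 0 + (\<Sum>K\<in>R - D2. dist (h (Inf K)) (h (Sup K)))"
    proof (intro add_mono sum_mono sum_nonpos)
      fix K assume "K \<in> D2"
      from D2(3)[rule_format, OF this] show "h (Sup K) - h (Inf K) \<le> 0" by auto
    qed (auto simp: dist_real_def)
    finally have "\<alpha> * measure lebesgue (\<Union>D1) \<le> \<eta>" using sm by simp
    moreover have "\<alpha> * (m - \<epsilon>) \<le> \<alpha> * measure lebesgue (\<Union>D1)" using m2 e' \<alpha> by (intro mult_left_mono) auto
    ultimately show ?thesis by simp
  qed
  have "m \<le> 0"
  proof (rule ccontr)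
    assume "\<not> m \<le> 0"
    then have "\<alpha> * (m / 2) \<le> \<alpha> * (m / 4)" using key[of "m/2" "\<alpha> * (m / 4)"] \<alpha> by auto
    then show False using \<alpha> \<open>\<not> m \<le> 0\<close> by auto
  qed
  show ?thesis
    unfolding negligible_outer
  proof (intro allI impI)
    fix e :: real assume "e > 0"
    then have "Inf ?M < e" using \<open>m \<le> 0\<close> unfolding m_def by simp
    then show "\<exists>T. A \<subseteq> T \<and> T \<in> lmeasurable \<and> measure lebesgue T < e"
      using cInf_lessD[OF ne] by blast
  qed
qed

text \<open>Choose disjoint intervals of slope at least \<open>n\<close> that almost cover
  \<open>A\<close>. If their total length is below the \<open>d\<close> belonging to the bound 1,
  then it is even below \<open>1 / n\<close>, and \<open>n\<close> is arbitrary. Working inside a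
  ball of radius \<open>d/4\<close> keeps the total length below \<open>d\<close> from the start;
  the null sets are then glued locally.\<close>

lemma abs_continuous_on_infinite_slope_negligible:
  fixes g :: "real \<Rightarrow> real"
  assumes g: "abs_continuous_on a b g"
    and A: "\<And>x. x \<in> A \<Longrightarrow> a < x \<and> x < b"
    and inf: "\<And>x d n. x \<in> A \<Longrightarrow> d > 0 \<Longrightarrow> \<exists>u v. u < v \<and> v - u < d \<and> x \<in> {u..v} \<and> real n * (v - u) \<le> \<bar>g v - g u\<bar>"
  shows "negligible A"
proof -
  obtain d where d: "d > 0" "\<And>D T. D division_of T \<Longrightarrow> T \<subseteq> {a..b} \<Longrightarrow> (\<Sum>K\<in>D. Sup K - Inf K) < d \<Longrightarrow>
        (\<Sum>K\<in>D. dist (g (Inf K)) (g (Sup K))) < 1"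
    by (rule abs_continuous_onD[OF g zero_less_one], rule that) (assumption | blast)+
  have "negligible (A \<inter> ball x (d/4))" for x
    unfolding negligible_outer_le
  proof (intro allI impI)
    fix e :: real assume e: "e > 0"
    then have e2: "e / 2 > 0" by simp
    obtain n :: nat where n: "1 / (e/2) < real n" using reals_Archimedean2 by blast
    then have n0: "real n > 0" using e2 by (meson divide_pos_pos less_trans zero_less_one)
    let ?U = "{a<..<b} \<inter> ball x (d/4)"
    have U: "open ?U" "bounded ?U" "A \<inter> ball x (d/4) \<subseteq> ?U" using A by auto
    have cov: "\<exists>u v. u < v \<and> v - u < d' \<and> y \<in> {u..v} \<and> real n * (v - u) \<le> \<bar>g v - g u\<bar>" if "y \<in> A \<inter> ball x (d/4)" "0 < d'" for y d'
      using inf[of y d'] that by auto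
    obtain D H where D: "D division_of \<Union>D" "\<Union>D \<subseteq> ?U"
        "\<forall>K\<in>D. \<exists>u v. u < v \<and> K = {u..v} \<and> real n * (v - u) \<le> \<bar>g v - g u\<bar>"
        "A \<inter> ball x (d/4) - \<Union>D \<subseteq> H" "H \<in> lmeasurable" "measure lebesgue H < e / 2"
      by (rule Vitali_finite[OF U cov e2])
    have lm: "\<Union>D \<in> lmeasurable" using D(1) lmeasurable_division by blast
    have "measure lebesgue (\<Union>D) \<le> measure lebesgue {x - d/4..x + d/4}"
      using D(2) lm by (intro measure_mono_fmeasurable) (auto dest: fmeasurableD simp: dist_real_def abs_if split: if_splits)
    also have "\<dots> < d" using d by simp
    finally have "(\<Sum>K\<in>D. Sup K - Inf K) < d" using division_content_sum[OF D(1)] by simp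
    moreover have "\<Union>D \<subseteq> {a..b}" using D(2) by (meson greaterThanLessThan_subseteq_atLeastAtMost_iff le_inf_iff order_trans order_refl)
    ultimately have "(\<Sum>K\<in>D. dist (g (Inf K)) (g (Sup K))) < 1" using d(2)[OF D(1)] by blast
    moreover have "real n * measure lebesgue (\<Union>D) \<le> (\<Sum>K\<in>D. dist (g (Inf K)) (g (Sup K)))"
      unfolding division_content_sum[OF D(1), symmetric] sum_distrib_left
    proof (rule sum_mono)
      fix K assume "K \<in> D"
      from D(3)[rule_format, OF this] show "real n * (Sup K - Inf K) \<le> dist (g (Inf K)) (g (Sup K))" by (auto simp: dist_real_def abs_minus_commute)
    qed
    ultimately have "real n * measure lebesgue (\<Union>D) < 1" by simp
    then have "measure lebesgue (\<Union>D) < 1 / real n" using n0 by (simp add: field_simps)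
    also have "\<dots> < e / 2" using n n0 e by (simp add: field_simps)
    finally have "measure lebesgue (\<Union>D) + measure lebesgue H \<le> e" using D(6) by simp
    moreover have "measure lebesgue (\<Union>D \<union> H) \<le> measure lebesgue (\<Union>D) + measure lebesgue H"
      using D lm by (intro measure_Un_le) (auto dest: fmeasurableD)
    moreover have "A \<inter> ball x (d/4) \<subseteq> \<Union>D \<union> H" "\<Union>D \<union> H \<in> lmeasurable" using D(4) fmeasurable.Un[OF lm D(5)] by auto
    ultimately show "\<exists>T. A \<inter> ball x (d/4) \<subseteq> T \<and> T \<in> lmeasurable \<and> measure lebesgue T \<le> e" by (metis order_trans)
  qed
  note neg = this
  show ?thesis
  proof (rule locally_negligible_alt[THEN iffD2], intro ballI exI conjI)
    fix x assume "x \<in> A"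
    show "openin (top_of_set A) (A \<inter> ball x (d/4))" by (simp add: openin_open_Int)
    show "x \<in> A \<inter> ball x (d/4)" using \<open>x \<in> A\<close> d(1) by simp
    show "negligible (A \<inter> ball x (d/4))" by (rule neg)
  qed
qed

text \<open>A bad point is an end point, a point with unbounded slopes, or one where rationals
  \<open>p < q\<close> separate the lower and the upper limit of the difference quotient. This
  leaves countably many exceptional sets, each handled by one of the two preceding lemmas.\<close>

theorem abs_continuous_on_differentiable_ae:
  fixes g :: "real \<Rightarrow> real"
  assumes g: "abs_continuous_on a b g"
  shows "negligible {x \<in> {a..b}. \<not> g differentiable (at x)}"
proof -
  \<comment> \<open>Slopes are taken over all small intervals containing \<open>x\<close>, as in the
    covering lemma; difference quotients at \<open>x\<close> are the special case with
    \<open>x\<close> as an end point.\<close>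
  define lo where "lo = (\<lambda>p x. \<forall>d>0. \<exists>u v. u < v \<and> v - u < d \<and> x \<in> {u..v} \<and> g v - g u \<le> p * (v - u))"
  define hi where "hi = (\<lambda>p x. \<forall>d>0. \<exists>u v. u < v \<and> v - u < d \<and> x \<in> {u..v} \<and> g v - g u \<ge> p * (v - u))"
  define A where "A = (\<lambda>p q. {x. a < x \<and> x < b \<and> lo p x \<and> hi q x})"
  define I where "I = {x. a < x \<and> x < b \<and> (\<forall>d>0. \<forall>n. \<exists>u v. u < v \<and> v - u < d \<and> x \<in> {u..v} \<and> real n * (v - u) \<le> \<bar>g v - g u\<bar>)}"
  let ?J = "{(p, q). p < q} :: (rat \<times> rat) set"
  let ?A = "\<lambda>(p, q). A (of_rat p) (of_rat q)"
  have "negligible I"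
    by (rule abs_continuous_on_infinite_slope_negligible[OF g]) (auto simp: I_def)
  moreover have "negligible (A p q)" if "p < q" for p q
    by (rule abs_continuous_on_slope_gap_negligible[OF g that]) (auto simp: A_def lo_def hi_def)
  then have "negligible (\<Union>(?A ` ?J))"
    by (intro negligible_countable_Union) (auto simp: of_rat_less)
  ultimately have neg: "negligible (I \<union> \<Union>(?A ` ?J) \<union> {a, b})" by (intro negligible_Un) auto
  have "g differentiable (at x)" if x: "x \<in> {a..b}" "x \<notin> I \<union> \<Union>(?A ` ?J) \<union> {a, b}" for x
  proof -
    have xab: "a < x" "x < b" using x by auto
    let ?f = "\<lambda>y. (g y - g x) / (y - x)"
    let ?F = "at x"
    obtain d n where dn: "d > 0" "\<forall>u v. u < v \<and> v - u < d \<and> x \<in> {u..v} \<longrightarrow> \<not> (real n * (v - u) \<le> \<bar>g v - g u\<bar>)"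
    proof -
      have "\<not> (\<forall>d>0. \<forall>n. \<exists>u v. u < v \<and> v - u < d \<and> x \<in> {u..v} \<and> real n * (v - u) \<le> \<bar>g v - g u\<bar>)"
        using x(2) xab unfolding I_def by blast
      then show ?thesis using that by blast
    qed
    have slope: "\<exists>u v. u < v \<and> v - u = \<bar>y - x\<bar> \<and> x \<in> {u..v} \<and> g v - g u = ?f y * (v - u)" if "y \<noteq> x" for y
    proof (cases "x < y")
      case True then show ?thesis by (intro exI[of _ x] exI[of _ y]) auto
    next
      case False then show ?thesis using that by (intro exI[of _ y] exI[of _ x]) (auto simp: field_simps)
    qed
    have near: "eventually (\<lambda>y. y \<noteq> x \<and> \<bar>y - x\<bar> < e) ?F" if "e > 0" for e
      unfolding eventually_at using that by (intro exI[of _ e]) (auto simp: dist_real_def)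
    have bd: "eventually (\<lambda>y. \<bar>?f y\<bar> \<le> real n) ?F"
      using near[OF dn(1)]
    proof eventually_elim
      case (elim y)
      then obtain u v where uv: "u < v" "v - u = \<bar>y - x\<bar>" "x \<in> {u..v}" "g v - g u = ?f y * (v - u)" using slope by blast
      then have "\<bar>?f y\<bar> * (v - u) < real n * (v - u)" using dn(2)[rule_format, of u v] elim by (simp add: abs_mult not_le)
      then show ?case using uv(1) by (meson mult_less_cancel_right_pos diff_gt_0_iff_gt less_imp_le)
    qed
    let ?e = "\<lambda>y. ereal (?f y)"
    let ?L = "Limsup ?F ?e" and ?l = "Liminf ?F ?e"
    have lL: "?l \<le> ?L" by (rule Liminf_le_Limsup) simp
    have l1: "ereal (- real n) \<le> ?l"
      by (rule Liminf_bounded, rule eventually_mono[OF bd]) (simp only: abs_le_iff ereal_less_eq, linarith)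
    have L1: "?L \<le> ereal (real n)"
      by (rule Limsup_bounded, rule eventually_mono[OF bd]) (simp only: abs_le_iff ereal_less_eq)
    have "\<not> ?l < ?L"
    proof
      assume "?l < ?L"
      then obtain p where p: "?l < ereal (of_rat p)" "ereal (of_rat p) < ?L" using ereal_dense3 by blast
      obtain q where q: "ereal (of_rat p) < ereal (of_rat q)" "ereal (of_rat q) < ?L" using ereal_dense3[OF p(2)] by blast
      have "lo (of_rat p) x"
        unfolding lo_def
      proof (intro allI impI)
        fix e :: real assume e: "e > 0"
        have "\<not> eventually (\<lambda>y. ereal (of_rat p) \<le> ?e y) ?F" 
        proof
          assume "eventually (\<lambda>y. ereal (of_rat p) \<le> ?e y) ?F"
          then have "ereal (of_rat p) \<le> ?l" by (rule Liminf_bounded)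
          then show False using p(1) by simp
        qed
        moreover have "eventually (\<lambda>y. ereal (of_rat p) \<le> ?e y) ?F"
          if "\<nexists>y. \<not> (ereal (of_rat p) \<le> ?e y) \<and> y \<noteq> x \<and> \<bar>y - x\<bar> < e"
          by (rule eventually_mono[OF near[OF e]]) (use that in blast)
        ultimately have "\<exists>y. \<not> (ereal (of_rat p) \<le> ?e y) \<and> y \<noteq> x \<and> \<bar>y - x\<bar> < e" by blast
        then obtain y where y: "?f y < of_rat p" "y \<noteq> x" "\<bar>y - x\<bar> < e" by (auto simp: not_le)
        obtain u v where uv: "u < v" "v - u = \<bar>y - x\<bar>" "x \<in> {u..v}" "g v - g u = ?f y * (v - u)" using slope[OF y(2)] by blast
        have "?f y * (v - u) \<le> of_rat p * (v - u)" using y uv by (intro mult_right_mono) auto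
        then show "\<exists>u v. u < v \<and> v - u < e \<and> x \<in> {u..v} \<and> g v - g u \<le> of_rat p * (v - u)"
          using uv y by (intro exI[of _ u] exI[of _ v]) auto
      qed
      moreover have "hi (of_rat q) x"
        unfolding hi_def
      proof (intro allI impI)
        fix e :: real assume e: "e > 0"
        have "\<not> eventually (\<lambda>y. ?e y \<le> ereal (of_rat q)) ?F" 
        proof
          assume "eventually (\<lambda>y. ?e y \<le> ereal (of_rat q)) ?F"
          then have "?L \<le> ereal (of_rat q)" by (rule Limsup_bounded)
          then show False using q(2) by simp
        qed
        moreover have "eventually (\<lambda>y. ?e y \<le> ereal (of_rat q)) ?F"
          if "\<nexists>y. \<not> (?e y \<le> ereal (of_rat q)) \<and> y \<noteq> x \<and> \<bar>y - x\<bar> < e"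
          by (rule eventually_mono[OF near[OF e]]) (use that in blast)
        ultimately have "\<exists>y. \<not> (?e y \<le> ereal (of_rat q)) \<and> y \<noteq> x \<and> \<bar>y - x\<bar> < e" by blast
        then obtain y where y: "?f y > of_rat q" "y \<noteq> x" "\<bar>y - x\<bar> < e" by (auto simp: not_le)
        obtain u v where uv: "u < v" "v - u = \<bar>y - x\<bar>" "x \<in> {u..v}" "g v - g u = ?f y * (v - u)" using slope[OF y(2)] by blast
        have "?f y * (v - u) \<ge> of_rat q * (v - u)" using y uv by (intro mult_right_mono) auto
        then show "\<exists>u v. u < v \<and> v - u < e \<and> x \<in> {u..v} \<and> g v - g u \<ge> of_rat q * (v - u)"
          using uv y by (intro exI[of _ u] exI[of _ v]) auto
      qed
      moreover have "p < q" using q(1) by (simp add: of_rat_less)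
      ultimately have "x \<in> \<Union>(?A ` ?J)" using xab unfolding A_def by auto
      then show False using x by auto
    qed
    then have eq: "?l = ?L" using lL by auto
    obtain r where r: "?L = ereal r" using l1 L1 eq by (cases ?L) auto
    have "(?e \<longlongrightarrow> ereal r) ?F" by (rule Liminf_eq_Limsup) (use eq r in auto)
    then have "(?f \<longlongrightarrow> r) ?F" by simp
    then have "(g has_field_derivative r) (at x)" by (simp add: has_field_derivative_iff)
    then show ?thesis using real_differentiable_def by blast
  qed
  then have "{x \<in> {a..b}. \<not> g differentiable (at x)} \<subseteq> I \<union> \<Union>(?A ` ?J) \<union> {a, b}" by blast
  then show ?thesis using neg negligible_subset by blast
qed

section \<open>The fundamental theorem and the length of a curve\<close>

text \<open>Gauge argument: a tag outside \<open>N\<close> is controlled by the derivative, as for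
  differentiable functions. Intervals with a tag in \<open>N\<close> are forced into an open set of
  measure below the \<open>d\<close> of absolute continuity, so the increments of \<open>g\<close>
  over them sum to at most \<open>\<epsilon>\<close>.\<close>

theorem fundamental_theorem_of_calculus_abs_continuous:
  fixes g :: "real \<Rightarrow> 'a::banach"
  assumes ab: "a \<le> b" and g: "abs_continuous_on a b g" and N: "negligible N"
    and h: "\<And>x. x \<in> {a..b} - N \<Longrightarrow> (g has_vector_derivative h x) (at x within {a..b})"
  shows "(h has_integral (g b - g a)) {a..b}"
proof (cases "a = b")
  case True then show ?thesis by (simp add: has_integral_refl)
next
  case False
  then have ab: "a < b" using ab by simp
  \<comment> \<open>With value 0 on \<open>N\<close>, a tag in \<open>N\<close> adds nothing to the
    Riemann sum and leaves only an increment of \<open>g\<close>.\<close>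
  define h' where "h' = (\<lambda>x. if x \<in> N then 0 else h x)"
  have "(h' has_integral (g b - g a)) {a..b}"
    unfolding has_integral_factor_content_real
  proof (intro allI impI)
    fix e :: real assume e: "e > 0"
    define \<epsilon> where "\<epsilon> = e / 2 * (b - a)"
    have \<epsilon>: "\<epsilon> > 0" using e ab by (simp add: \<epsilon>_def)
    obtain d where d: "d > 0" "\<And>D T. D division_of T \<Longrightarrow> T \<subseteq> {a..b} \<Longrightarrow> (\<Sum>K\<in>D. Sup K - Inf K) < d \<Longrightarrow>
        (\<Sum>K\<in>D. dist (g (Inf K)) (g (Sup K))) < \<epsilon>"
      by (rule abs_continuous_onD[OF g \<epsilon>], rule that) (assumption | blast)+
    have Ns: "N \<in> lmeasurable" "measure lebesgue N = 0"
      using N by (auto simp: negligible_imp_measurable negligible_imp_measure0)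
    obtain V where V: "open V" "N \<subseteq> V" "V - N \<in> lmeasurable" "emeasure lebesgue (V - N) < ennreal d"
      using sets_lebesgue_outer_open[OF fmeasurableD[OF Ns(1)] d(1)] by metis
    have "measure lebesgue (V - N) < d"
      using V(3,4) d by (metis emeasure_eq_measure2 ennreal_less_iff measure_nonneg)
    moreover have VN: "V = N \<union> (V - N)" using V by auto
    moreover have "measure lebesgue (N \<union> (V - N)) \<le> measure lebesgue N + measure lebesgue (V - N)"
      using Ns V(3) by (intro measure_Un_le) (auto dest: fmeasurableD)
    ultimately have Vm: "V \<in> lmeasurable" "measure lebesgue V < d"
      using fmeasurable.Un[OF Ns(1) V(3)] Ns(2) by auto
    have "\<exists>r>0. \<forall>y\<in>{a..b}. \<bar>y - x\<bar> < r \<longrightarrow> norm (g y - g x - (y - x) *\<^sub>R h x) \<le> e / 2 * \<bar>y - x\<bar>" if x: "x \<in> {a..b} - N" for x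
      using h[OF x] e unfolding has_vector_derivative_def has_derivative_within_alt
      by (metis half_gt_zero real_norm_def)
    then obtain r where r: "\<And>x. x \<in> {a..b} - N \<Longrightarrow> r x > 0" 
       "\<And>x y. x \<in> {a..b} - N \<Longrightarrow> y \<in> {a..b} \<Longrightarrow> \<bar>y - x\<bar> < r x \<Longrightarrow> norm (g y - g x - (y - x) *\<^sub>R h x) \<le> e / 2 * \<bar>y - x\<bar>"
      by metis
    define \<gamma> where "\<gamma> = (\<lambda>x. if x \<in> N then V else if x \<in> {a..b} then ball x (r x) else UNIV)"
    have gauge: "gauge \<gamma>" using V r(1) unfolding gauge_def \<gamma>_def by auto
    have bound: "norm ((\<Sum>(x,k)\<in>p. measure lborel k *\<^sub>R h' x) - (g b - g a)) \<le> e * measure lborel {a..b}"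
      if p: "p tagged_division_of {a..b}" "\<gamma> fine p" for p
    proof -
      have fin: "finite p" using p by auto
      define p1 where "p1 = {(x, k) \<in> p. x \<in> N}"
      have p1: "p1 \<subseteq> p" "finite p1" using fin unfolding p1_def by (auto intro: finite_subset[OF _ fin])
      let ?s = "\<lambda>(x, k). measure lborel k *\<^sub>R h' x - (g (Sup k) - g (Inf k))"
      have iv: "\<exists>u v. u \<le> v \<and> k = {u..v} \<and> x \<in> {u..v} \<and> {u..v} \<subseteq> {a..b}" if "(x, k) \<in> p" for x k
        using tagged_division_ofD(2-4)[OF p(1) that] by (metis atLeastatMost_empty_iff box_real(2) empty_iff)
      have "(\<Sum>(x,k)\<in>p. measure lborel k *\<^sub>R h' x) - (g b - g a) = (\<Sum>z\<in>p. ?s z)"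
        using additive_tagged_division_1[OF less_imp_le[OF ab] p(1), of g]
        by (simp add: sum_subtractf case_prod_unfold)
      also have "\<dots> = (\<Sum>z\<in>p - p1. ?s z) + (\<Sum>z\<in>p1. ?s z)" by (rule sum.subset_diff[OF p1(1) fin])
      finally have "norm ((\<Sum>(x,k)\<in>p. measure lborel k *\<^sub>R h' x) - (g b - g a)) \<le> norm (\<Sum>z\<in>p - p1. ?s z) + norm (\<Sum>z\<in>p1. ?s z)"
        by (simp add: norm_triangle_ineq)
      moreover have "norm (\<Sum>z\<in>p - p1. ?s z) \<le> e / 2 * (b - a)"
      proof -
        have "norm (\<Sum>z\<in>p - p1. ?s z) \<le> (\<Sum>z\<in>p - p1. e / 2 * measure lborel (snd z))"
        proof (rule sum_norm_le)
          fix z assume z: "z \<in> p - p1"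
          obtain x k where zx: "z = (x, k)" by (cases z)
          then have xk: "(x, k) \<in> p" "x \<notin> N" using z unfolding p1_def by auto
          obtain u v where uv: "u \<le> v" "k = {u..v}" "x \<in> {u..v}" "{u..v} \<subseteq> {a..b}" using iv[OF xk(1)] by blast
          have x: "x \<in> {a..b} - N" using uv xk by auto
          have "k \<subseteq> ball x (r x)" using fineD[OF p(2) xk(1)] xk(2) x by (simp add: \<gamma>_def)
          then have "u \<in> ball x (r x)" "v \<in> ball x (r x)"
            using uv(1) unfolding uv(2) by (meson atLeastAtMost_iff order_refl subsetD)+
          then have "\<bar>u - x\<bar> < r x" "\<bar>v - x\<bar> < r x" by (auto simp: dist_real_def)
          moreover have "u \<in> {a..b}" "v \<in> {a..b}" using uv by auto
          ultimately have "norm (g u - g x - (u - x) *\<^sub>R h x) \<le> e / 2 * \<bar>u - x\<bar>" "norm (g v - g x - (v - x) *\<^sub>R h x) \<le> e / 2 * \<bar>v - x\<bar>"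
            using r(2)[OF x] by blast+
          then have "norm ((g u - g x - (u - x) *\<^sub>R h x) - (g v - g x - (v - x) *\<^sub>R h x)) \<le> e / 2 * \<bar>u - x\<bar> + e / 2 * \<bar>v - x\<bar>"
            by (meson add_mono norm_triangle_ineq4 order_trans)
          also have "(g u - g x - (u - x) *\<^sub>R h x) - (g v - g x - (v - x) *\<^sub>R h x) = (v - u) *\<^sub>R h x - (g v - g u)"
            by (simp add: algebra_simps)
          also have "e / 2 * \<bar>u - x\<bar> + e / 2 * \<bar>v - x\<bar> = e / 2 * (v - u)" using uv(3) by (auto simp: field_simps)
          finally show "norm (?s z) \<le> e / 2 * measure lborel (snd z)"
            using uv(1) xk(2) by (simp add: zx uv(2) h'_def)
        qed
        also have "\<dots> \<le> (\<Sum>z\<in>p. e / 2 * measure lborel (snd z))"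
          using fin e by (intro sum_mono2) auto
        also have "\<dots> = e / 2 * (b - a)"
        proof -
          have "(\<Sum>z\<in>p. measure lborel (snd z)) = b - a"
            using additive_content_tagged_division[of p a b] p(1) ab by (simp add: case_prod_unfold)
          then show ?thesis by (simp only: sum_distrib_left[symmetric])
        qed
        finally show ?thesis .
      qed
      moreover have "norm (\<Sum>z\<in>p1. ?s z) \<le> \<epsilon>"
      proof -
        have "p tagged_partial_division_of {a..b}" using p(1) by (simp add: tagged_division_of_def)
        then have "p1 tagged_partial_division_of {a..b}" using p1(1) tagged_partial_division_subset by blast
        then have dv: "(snd ` p1) division_of \<Union>(snd ` p1)" by (rule partial_division_of_tagged_division)
        have sub: "\<Union>(snd ` p1) \<subseteq> {a..b}" "\<Union>(snd ` p1) \<subseteq> V"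
          using iv p1 p(2) unfolding p1_def fine_def \<gamma>_def by fastforce+
        have "(\<Sum>K\<in>snd ` p1. Sup K - Inf K) = measure lebesgue (\<Union>(snd ` p1))" by (rule division_content_sum[OF dv])
        also have "\<dots> \<le> measure lebesgue V"
          using sub Vm lmeasurable_division[OF dv] by (intro measure_mono_fmeasurable) (auto dest: fmeasurableD)
        also have "\<dots> < d" by (rule Vm)
        finally have sm: "(\<Sum>K\<in>snd ` p1. dist (g (Inf K)) (g (Sup K))) < \<epsilon>" using d(2)[OF dv sub(1)] by blast
        have "norm (\<Sum>z\<in>p1. ?s z) \<le> (\<Sum>z\<in>p1. dist (g (Inf (snd z))) (g (Sup (snd z))))"
        proof (rule sum_norm_le)
          fix z assume "z \<in> p1"
          then show "norm (?s z) \<le> dist (g (Inf (snd z))) (g (Sup (snd z)))"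
            unfolding p1_def h'_def by (auto simp: dist_norm)
        qed
        also have "\<dots> = (\<Sum>K\<in>snd ` p1. dist (g (Inf K)) (g (Sup K)))"
        \<comment> \<open>Different tags can carry the same interval only if it is degenerate, and
          then the increment is 0.\<close>
        proof (subst sum.reindex_nontrivial[OF p1(2)])
          fix z z' assume z: "z \<in> p1" "z' \<in> p1" "z \<noteq> z'" "snd z = snd z'"
          obtain x k where zx: "z = (x, k)" by (cases z)
          obtain x' k' where zx': "z' = (x', k')" by (cases z')
          have "interior k \<inter> interior k' = {}"
            using tagged_division_ofD(5)[OF p(1), of x k x' k'] z p1(1) zx zx' by blast
          moreover obtain u v where "u \<le> v" "k = {u..v}" using iv[of x k] z p1(1) zx by blast
          ultimately have "k = {u..u}" using z zx zx' by auto
          then show "dist (g (Inf (snd z))) (g (Sup (snd z))) = 0" using zx by simp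
        qed (simp add: o_def)
        finally show ?thesis using sm by simp
      qed
      ultimately show ?thesis using ab by (simp add: \<epsilon>_def field_simps)
    qed
    show "\<exists>d. gauge d \<and> (\<forall>p. p tagged_division_of {a..b} \<and> d fine p \<longrightarrow>
             norm ((\<Sum>(x,k)\<in>p. measure lborel k *\<^sub>R h' x) - (g b - g a)) \<le> e * measure lborel {a..b})"
      by (rule exI[of _ \<gamma>], rule conjI, rule gauge, intro allI impI, elim conjE, rule bound)
  qed
  then show ?thesis
    by (rule has_integral_spike[OF N, rotated]) (auto simp: h'_def)
qed

lemma abs_continuous_on_norm_diff_le:
  fixes g :: "real \<Rightarrow> 'a::banach"
  assumes ab: "a \<le> b" and g: "abs_continuous_on a b g" and N: "negligible N"
    and h: "\<And>x. x \<in> {a..b} - N \<Longrightarrow> (g has_vector_derivative h x) (at x within {a..b})"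
    and K: "0 \<le> K" "\<And>x. x \<in> {a..b} - N \<Longrightarrow> norm (h x) \<le> K"
  shows "norm (g b - g a) \<le> K * (b - a)"
proof -
  define h' where "h' = (\<lambda>x. if x \<in> N then 0 else h x)"
  have "(h' has_integral (g b - g a)) {a..b}"
    by (rule fundamental_theorem_of_calculus_abs_continuous[OF ab g N]) (use h in \<open>simp add: h'_def\<close>)
  from has_integral_bound_real[OF K(1) _ this, of "{}"] show ?thesis
    using K ab by (auto simp: h'_def)
qed

lemma abs_continuous_on_vector_differentiable_ae:
  fixes g :: "real \<Rightarrow> 'a::euclidean_space"
  assumes g: "abs_continuous_on a b g"
  shows "negligible {x \<in> {a..b}. \<not> g differentiable (at x)}"
proof -
  have "negligible {x \<in> {a..b}. \<not> (\<lambda>t. g t \<bullet> i) differentiable (at x)}" if "i \<in> Basis" for i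
  proof (rule abs_continuous_on_differentiable_ae, rule abs_continuous_on_dominated[OF g, of _ 1])
    fix x y
    have "\<bar>(g x - g y) \<bullet> i\<bar> \<le> norm (g x - g y)" by (rule Basis_le_norm[OF that])
    then show "dist (g x \<bullet> i) (g y \<bullet> i) \<le> 1 * dist (g x) (g y)" by (simp add: dist_norm inner_diff_left)
  qed
  then have "negligible (\<Union>i\<in>Basis. {x \<in> {a..b}. \<not> (\<lambda>t. g t \<bullet> i) differentiable (at x)})"
    by (intro negligible_Union) auto
  moreover have "{x \<in> {a..b}. \<not> g differentiable (at x)} \<subseteq> (\<Union>i\<in>Basis. {x \<in> {a..b}. \<not> (\<lambda>t. g t \<bullet> i) differentiable (at x)})"
    by (auto simp: differentiable_componentwise_within[of g _ UNIV])
  ultimately show ?thesis using negligible_subset by blast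
qed

text \<open>On an interval shorter than the \<open>\<delta>\<close> for the bound 1, the indefinite
  integral of \<open>h\<close>, which is \<open>g\<close> up to a constant, has variation at most 1,
  and bounded variation gives absolute integrability. A longer interval is cut into pieces of length
  \<open>\<delta> / 2\<close>.\<close>

lemma abs_continuous_on_derivative_absolutely_integrable:
  fixes g :: "real \<Rightarrow> 'a::euclidean_space"
  assumes g: "abs_continuous_on a b g" and N: "negligible N"
    and h: "\<And>x. x \<in> {a..b} - N \<Longrightarrow> (g has_vector_derivative h x) (at x)"
  shows "h absolutely_integrable_on {a..b}"
proof -
  have ftc: "(h has_integral (g v - g u)) {u..v}" if "u \<le> v" "{u..v} \<subseteq> {a..b}" for u v
    by (rule fundamental_theorem_of_calculus_abs_continuous[OF that(1) abs_continuous_on_subinterval[OF g that(2)] N])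
      (use h that in \<open>blast intro: has_vector_derivative_at_within\<close>)
  obtain \<delta> where \<delta>: "\<delta> > 0" "\<And>D T. D division_of T \<Longrightarrow> T \<subseteq> {a..b} \<Longrightarrow> (\<Sum>K\<in>D. Sup K - Inf K) < \<delta> \<Longrightarrow>
        (\<Sum>K\<in>D. dist (g (Inf K)) (g (Sup K))) < 1"
    by (rule abs_continuous_onD[OF g zero_less_one], rule that) (assumption | blast)+
  have small: "h absolutely_integrable_on {c..d}" if cd: "{c..d} \<subseteq> {a..b}" "d - c < \<delta>" "c \<le> d" for c d
  proof -
    have "h absolutely_integrable_on cbox c d"
    proof (rule bounded_variation_absolutely_integrable_interval)
      show "h integrable_on cbox c d" using ftc[OF cd(3,1)] by (auto simp: integrable_on_def)
      fix D assume D: "D division_of cbox c d"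
      have "(\<Sum>K\<in>D. norm (integral K h)) = (\<Sum>K\<in>D. dist (g (Inf K)) (g (Sup K)))"
      proof (rule sum.cong)
        fix K assume K: "K \<in> D"
        obtain u v where uv: "u \<le> v" "K = {u..v}" "Sup K = v" "Inf K = u" using division_of_real_interval[OF D K] by metis
        have "K \<subseteq> {a..b}" using division_ofD(2)[OF D K] cd(1) by auto
        then have "integral K h = g v - g u" using ftc[OF uv(1)] uv(2) by (simp add: integral_unique)
        then show "norm (integral K h) = dist (g (Inf K)) (g (Sup K))" using uv by (simp add: dist_norm norm_minus_commute)
      qed simp
      moreover have "(\<Sum>K\<in>D. Sup K - Inf K) < \<delta>" using division_content_sum[OF D] cd by simp
      ultimately show "(\<Sum>K\<in>D. norm (integral K h)) \<le> 1" using \<delta>(2)[OF D] cd by simp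
    qed
    then show ?thesis by simp
  qed
  have "\<forall>c d. {c..d} \<subseteq> {a..b} \<longrightarrow> d - c \<le> real n * (\<delta> / 2) \<longrightarrow> c \<le> d \<longrightarrow> h absolutely_integrable_on {c..d}" for n
  proof (induction n)
    case 0
    show ?case using \<delta>(1) by (intro allI impI small) auto
  next
    case (Suc n)
    show ?case
    proof (intro allI impI)
      fix c d assume cd: "{c..d} \<subseteq> {a..b}" "d - c \<le> real (Suc n) * (\<delta> / 2)" "c \<le> d"
      show "h absolutely_integrable_on {c..d}"
      proof (cases "d - c \<le> \<delta> / 2")
        case True
        then show ?thesis using small cd \<delta>(1) by auto
      next
        case False
        let ?m = "c + \<delta> / 2"
        have "h absolutely_integrable_on {c..?m}" using cd False \<delta>(1) by (intro small) auto
        moreover have "h absolutely_integrable_on {?m..d}" using cd False \<delta>(1) 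
          by (intro Suc.IH[rule_format]) (auto simp: algebra_simps)
        ultimately show ?thesis by (rule absolutely_integrable_on_combine) (use False \<delta>(1) in auto)
      qed
    qed
  qed
  note ind = this
  show ?thesis
  proof (cases "a \<le> b")
    case True
    obtain n :: nat where "(b - a) / (\<delta> / 2) \<le> real n" using real_arch_simple by blast
    then have "b - a \<le> real n * (\<delta> / 2)" using \<delta>(1) by (simp add: field_simps)
    then show ?thesis using ind[of n] True by blast
  qed simp
qed

text \<open>The lower bound for lengths of front tracks. The chord is the integral of the velocity;
  absolute integrability matters because \<open>integral\<close> would return 0 for a speed that is
  not integrable.\<close>

theorem abs_continuous_on_norm_diff_le_length:
  fixes g :: "real \<Rightarrow> 'a::euclidean_space"
  assumes ab: "a \<le> b" and g: "abs_continuous_on a b g"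
  shows "norm (g b - g a) \<le> integral {a..b} (\<lambda>t. norm (vector_derivative g (at t within {a..b})))"
proof -
  let ?N = "{x \<in> {a..b}. \<not> g differentiable (at x)} \<union> {a, b}"
  let ?h = "\<lambda>t. vector_derivative g (at t within {a..b})"
  have N: "negligible ?N" using abs_continuous_on_vector_differentiable_ae[OF g] by (intro negligible_Un) auto
  have h: "(g has_vector_derivative ?h x) (at x)" if x: "x \<in> {a..b} - ?N" for x
  proof -
    have "at x within {a..b} = at x" using x by (intro at_within_Icc_at) auto
    moreover have "g differentiable (at x)" using x by auto
    ultimately show ?thesis using vector_derivative_works by metis
  qed
  have "(?h has_integral (g b - g a)) {a..b}"
    by (rule fundamental_theorem_of_calculus_abs_continuous[OF ab g N]) (use h in \<open>blast intro: has_vector_derivative_at_within\<close>)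
  then have "norm (g b - g a) = norm (integral {a..b} ?h)" by (simp add: integral_unique)
  also have "\<dots> \<le> integral {a..b} (\<lambda>t. norm (?h t))"
  proof (rule integral_norm_bound_integral)
    have "?h absolutely_integrable_on {a..b}" by (rule abs_continuous_on_derivative_absolutely_integrable[OF g N h])
    then show "?h integrable_on {a..b}" "(\<lambda>t. norm (?h t)) integrable_on {a..b}"
      by (auto simp: absolutely_integrable_on_def)
  qed simp
  finally show ?thesis .
qed

subsection \<open>The flip of the configuration space\<close>

lemma AE_lebesgue_iff_negligible:
  "(AE t in lebesgue. P t) \<longleftrightarrow> negligible {t::'a::euclidean_space. \<not> P t}"
proof
  assume "AE t in lebesgue. P t"
  then obtain N where "N \<in> null_sets lebesgue" "{t. \<not> P t} \<subseteq> N" by (auto simp: eventually_ae_filter)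
  then show "negligible {t. \<not> P t}" using negligible_iff_null_sets negligible_subset by blast
next
  assume "negligible {t. \<not> P t}"
  then show "AE t in lebesgue. P t" unfolding eventually_ae_filter using negligible_iff_null_sets by auto
qed

lemma Q_iff: "q \<in> Q l \<longleftrightarrow> norm (snd q - fst q) = l"
  by (auto simp: Q_def split: prod.splits)

lemma flip_flip [simp]: "flip (flip q) = q"
  by (simp add: flip_def scaleR_2 prod_eq_iff)

lemma fst_flip [simp]: "fst (flip q) = fst q" and snd_flip: "snd (flip q) = 2 *\<^sub>R fst q - snd q"
  by (simp_all add: flip_def)

lemma flip_in_Q [simp]: "flip q \<in> Q l \<longleftrightarrow> q \<in> Q l"
proof -
  have "snd (flip q) - fst (flip q) = - (snd q - fst q)" by (simp add: flip_def scaleR_2)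
  then show ?thesis unfolding Q_iff by (metis norm_minus_cancel)
qed

lemma bounded_linear_flip: "bounded_linear flip"
proof -
  have "bounded_linear (\<lambda>q::config. (fst q, 2 *\<^sub>R fst q - snd q))"
    by (intro bounded_linear_Pair bounded_linear_sub bounded_linear_scaleR_right bounded_linear_compose[OF bounded_linear_scaleR_right] bounded_linear_fst bounded_linear_snd)
  then show ?thesis by (simp add: flip_def[abs_def])
qed

lemma dist_flip_le: "dist (flip x) (flip y) \<le> 4 * dist x y"
proof -
  have "dist (flip x) (flip y) \<le> dist (fst (flip x)) (fst (flip y)) + dist (snd (flip x)) (snd (flip y))"
    unfolding dist_norm by (metis fst_diff snd_diff norm_Pair_le prod.collapse)
  also have "dist (snd (flip x)) (snd (flip y)) = norm (2 *\<^sub>R (fst x - fst y) - (snd x - snd y))"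
    by (simp add: snd_flip dist_norm algebra_simps)
  also have "\<dots> \<le> 2 * dist (fst x) (fst y) + dist (snd x) (snd y)"
    using norm_triangle_ineq4[of "2 *\<^sub>R (fst x - fst y)" "snd x - snd y"] by (simp add: dist_norm)
  finally show ?thesis using dist_fst_le[of x y] dist_snd_le[of x y] by simp
qed

lemma has_vector_derivative_inner_self:
  fixes w :: "real \<Rightarrow> 'a::real_inner"
  assumes "(w has_vector_derivative w') (at t within I)"
  shows "((\<lambda>s. w s \<bullet> w s) has_vector_derivative 2 * (w t \<bullet> w')) (at t within I)"
proof -
  have "((\<lambda>s. w s \<bullet> w s) has_derivative (\<lambda>h. w t \<bullet> (h *\<^sub>R w') + (h *\<^sub>R w') \<bullet> w t)) (at t within I)"
    using assms unfolding has_vector_derivative_def by (auto intro!: derivative_eq_intros)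
  then show ?thesis unfolding has_vector_derivative_def
    by (simp add: inner_commute algebra_simps)
qed

text \<open>The frame has constant length, hence its velocity \<open>v - u\<close> is orthogonal to
  it. The derivative is taken within \<open>I\<close> to include end points, and the nontrivial
  filter makes it unique.\<close>

lemma no_skid_inner:
  assumes Q: "\<And>s. s \<in> I \<Longrightarrow> \<gamma> s \<in> Q l" and t: "t \<in> I" "at t within I \<noteq> bot"
    and b: "((\<lambda>s. fst (\<gamma> s)) has_vector_derivative u) (at t within I)"
    and f: "((\<lambda>s. snd (\<gamma> s)) has_vector_derivative v) (at t within I)"
  shows "(snd (\<gamma> t) - fst (\<gamma> t)) \<bullet> v = (snd (\<gamma> t) - fst (\<gamma> t)) \<bullet> u"
proof -
  let ?w = "\<lambda>s. snd (\<gamma> s) - fst (\<gamma> s)"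
  have "(?w has_vector_derivative v - u) (at t within I)" using f b by (rule has_vector_derivative_diff)
  from has_vector_derivative_inner_self[OF this]
  have "((\<lambda>s. ?w s \<bullet> ?w s) has_vector_derivative 2 * (?w t \<bullet> (v - u))) (at t within I)" .
  moreover have "((\<lambda>s. ?w s \<bullet> ?w s) has_vector_derivative 0) (at t within I)"
  proof (rule has_vector_derivative_transform[OF t(1)])
    fix s assume "s \<in> I"
    then have "norm (?w s) = l" using Q by (simp add: Q_iff)
    then show "?w s \<bullet> ?w s = l\<^sup>2" by (metis power2_norm_eq_inner)
  qed simp
  ultimately have "2 * (?w t \<bullet> (v - u)) = 0"
    by (rule vector_derivative_unique_within[OF t(2)])
  then show ?thesis by (simp add: inner_diff_right)
qed

text \<open>By the hypotheses \<open>u\<close> is the orthogonal projection of \<open>v\<close> to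
  the line of \<open>w\<close>, so \<open>2 *\<^sub>R u - v\<close> is the mirror image of
  \<open>v\<close> in that line.\<close>

lemma norm_reflect_eq:
  fixes w u v :: "'a::real_inner"
  assumes "w \<bullet> v = w \<bullet> u" "u = c *\<^sub>R w"
  shows "norm (2 *\<^sub>R u - v) = norm v"
proof -
  have "(2 *\<^sub>R u - v) \<bullet> (2 *\<^sub>R u - v) = v \<bullet> v + 4 * (c * (w \<bullet> u - w \<bullet> v))"
    by (simp add: assms(2) inner_diff_left inner_diff_right inner_commute algebra_simps)
  then show ?thesis using assms(1) by (simp add: norm_eq_sqrt_inner)
qed

lemma bicycle_pathD:
  assumes "bicycle_path l I \<gamma>"
  shows "t \<in> I \<Longrightarrow> \<gamma> t \<in> Q l"
    "a \<le> b \<Longrightarrow> {a..b} \<subseteq> I \<Longrightarrow> abs_continuous_on a b \<gamma>"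
    "negligible {t \<in> I. \<not> (\<exists>c::real. ((\<lambda>s. fst (\<gamma> s)) has_vector_derivative c *\<^sub>R (snd (\<gamma> t) - fst (\<gamma> t))) (at t within I))}"
  using assms unfolding bicycle_path_def AE_lebesgue_iff_negligible by auto

lemma bicycle_path_abs_continuous:
  assumes "bicycle_path l I \<gamma>" "a \<le> b" "{a..b} \<subseteq> I"
  shows "abs_continuous_on a b (\<lambda>t. fst (\<gamma> t))" "abs_continuous_on a b (\<lambda>t. snd (\<gamma> t))"
  by (rule abs_continuous_on_dominated[OF bicycle_pathD(2)[OF assms], of _ 1]; simp add: dist_fst_le dist_snd_le)+

lemma bicycle_path_subset:
  assumes "bicycle_path l I \<gamma>" "I' \<subseteq> I"
  shows "bicycle_path l I' \<gamma>"
  unfolding bicycle_path_def AE_lebesgue_iff_negligible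
proof (intro conjI ballI allI impI)
  show "negligible {t. \<not> (t \<in> I' \<longrightarrow> (\<exists>c::real. ((\<lambda>s. fst (\<gamma> s)) has_vector_derivative c *\<^sub>R (snd (\<gamma> t) - fst (\<gamma> t))) (at t within I')))}"
    by (rule negligible_subset[OF bicycle_pathD(3)[OF assms(1)]])
       (use assms(2) in \<open>auto intro: has_vector_derivative_within_subset\<close>)
qed (use assms bicycle_pathD in \<open>auto intro: order_trans\<close>)

lemma bicycle_path_flip:
  assumes "bicycle_path l I \<gamma>"
  shows "bicycle_path l I (flip \<circ> \<gamma>)"
  unfolding bicycle_path_def AE_lebesgue_iff_negligible
proof (intro conjI ballI allI impI)
  show "(flip \<circ> \<gamma>) t \<in> Q l" if "t \<in> I" for t using bicycle_pathD(1)[OF assms that] by simp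
  show "abs_continuous_on a b (flip \<circ> \<gamma>)" if "a \<le> b \<and> {a..b} \<subseteq> I" for a b
    by (rule abs_continuous_on_dominated[OF bicycle_pathD(2)[OF assms], of _ _ _ 4]) (use that dist_flip_le in auto)
  have "\<exists>c. ((\<lambda>s. fst ((flip \<circ> \<gamma>) s)) has_vector_derivative c *\<^sub>R (snd ((flip \<circ> \<gamma>) t) - fst ((flip \<circ> \<gamma>) t))) (at t within I)"
    if "((\<lambda>s. fst (\<gamma> s)) has_vector_derivative c *\<^sub>R (snd (\<gamma> t) - fst (\<gamma> t))) (at t within I)" for t c
  proof -
    have "(- c) *\<^sub>R (snd ((flip \<circ> \<gamma>) t) - fst ((flip \<circ> \<gamma>) t)) = c *\<^sub>R (snd (\<gamma> t) - fst (\<gamma> t))"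
      by (simp add: snd_flip scaleR_2 algebra_simps)
    then show ?thesis using that by (intro exI[of _ "- c"]) simp
  qed
  then show "negligible {t. \<not> (t \<in> I \<longrightarrow> (\<exists>c. ((\<lambda>s. fst ((flip \<circ> \<gamma>) s)) has_vector_derivative c *\<^sub>R (snd ((flip \<circ> \<gamma>) t) - fst ((flip \<circ> \<gamma>) t))) (at t within I)))}"
    by (intro negligible_subset[OF bicycle_pathD(3)[OF assms]]) blast
qed

lemma front_length_flip:
  assumes \<eta>: "bicycle_path l {c..d} \<eta>" and cd: "c \<le> d"
  shows "front_length (flip \<circ> \<eta>) c d = front_length \<eta> c d"
proof (cases "c = d")
  \<comment> \<open>Within a single point derivatives are not unique, but the integral is 0
    anyway.\<close>
  case True
  then show ?thesis by (simp add: front_length_def)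
next
  case False
  then have cd: "c < d" using cd by simp
  let ?N = "{t \<in> {c..d}. \<not> (\<exists>k::real. ((\<lambda>s. fst (\<eta> s)) has_vector_derivative k *\<^sub>R (snd (\<eta> t) - fst (\<eta> t))) (at t within {c..d}))}
     \<union> {t \<in> {c..d}. \<not> (\<lambda>s. snd (\<eta> s)) differentiable (at t)}"
  have AC: "abs_continuous_on c d (\<lambda>t. snd (\<eta> t))" using bicycle_path_abs_continuous[OF \<eta>] cd by simp
  have N: "negligible ?N"
    by (intro negligible_Un bicycle_pathD(3)[OF \<eta>] abs_continuous_on_vector_differentiable_ae[OF AC])
  have nt: "at t within {c..d} \<noteq> bot" if "t \<in> {c..d}" for t
    using cd that trivial_limit_within[of t "{c..d}"] islimpt_Icc[of c d t] by simp
  show ?thesis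
    unfolding front_length_def
  proof (rule integral_spike[OF N])
    fix t assume t: "t \<in> {c..d} - ?N"
    then have tI: "t \<in> {c..d}" by simp
    obtain k where k: "((\<lambda>s. fst (\<eta> s)) has_vector_derivative k *\<^sub>R (snd (\<eta> t) - fst (\<eta> t))) (at t within {c..d})"
      using t by auto
    have "(\<lambda>s. snd (\<eta> s)) differentiable (at t within {c..d})" using t differentiable_at_withinI by auto
    then obtain v where v: "((\<lambda>s. snd (\<eta> s)) has_vector_derivative v) (at t within {c..d})"
      using vector_derivative_works by blast
    have "((\<lambda>s. snd ((flip \<circ> \<eta>) s)) has_vector_derivative 2 *\<^sub>R (k *\<^sub>R (snd (\<eta> t) - fst (\<eta> t))) - v) (at t within {c..d})"
      unfolding o_def snd_flip by (intro has_vector_derivative_diff v bounded_linear.has_vector_derivative[OF bounded_linear_scaleR_right k])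
    then have "vector_derivative (\<lambda>s. snd ((flip \<circ> \<eta>) s)) (at t within {c..d}) = 2 *\<^sub>R (k *\<^sub>R (snd (\<eta> t) - fst (\<eta> t))) - v"
      using vector_derivative_within[OF nt[OF tI]] by blast
    moreover have "vector_derivative (\<lambda>s. snd (\<eta> s)) (at t within {c..d}) = v"
      using vector_derivative_within[OF nt[OF tI] v] .
    moreover have "norm (2 *\<^sub>R (k *\<^sub>R (snd (\<eta> t) - fst (\<eta> t))) - v) = norm v"
      by (rule norm_reflect_eq[OF no_skid_inner[OF bicycle_pathD(1)[OF \<eta>] tI nt[OF tI] k v] refl])
    ultimately show "norm (vector_derivative (\<lambda>s. snd (\<eta> s)) (at t within {c..d})) =
         norm (vector_derivative (\<lambda>s. snd ((flip \<circ> \<eta>) s)) (at t within {c..d}))" by simp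
  qed
qed

lemma infinite_bicycle_path_flip:
  assumes "infinite_bicycle_path l \<gamma>"
  shows "infinite_bicycle_path l (flip \<circ> \<gamma>)"
proof -
  have b: "bicycle_path l UNIV \<gamma>" and f: "front_arc_length_param \<gamma>"
    using assms by (auto simp: infinite_bicycle_path_def)
  have "AE t in lebesgue. \<exists>c::real. ((\<lambda>s. fst (\<gamma> s)) has_vector_derivative c *\<^sub>R (snd (\<gamma> t) - fst (\<gamma> t))) (at t)"
    using b by (simp add: bicycle_path_def)
  then have "AE t in lebesgue. \<exists>v. norm v = 1 \<and> ((\<lambda>s. snd ((flip \<circ> \<gamma>) s)) has_vector_derivative v) (at t)"
    using f[unfolded front_arc_length_param_def]
  proof eventually_elim
    case (elim t)
    then obtain c v where c: "((\<lambda>s. fst (\<gamma> s)) has_vector_derivative c *\<^sub>R (snd (\<gamma> t) - fst (\<gamma> t))) (at t)"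
      and v: "norm v = 1" "((\<lambda>s. snd (\<gamma> s)) has_vector_derivative v) (at t)" by blast
    have "((\<lambda>s. snd ((flip \<circ> \<gamma>) s)) has_vector_derivative 2 *\<^sub>R (c *\<^sub>R (snd (\<gamma> t) - fst (\<gamma> t))) - v) (at t)"
      unfolding o_def snd_flip by (intro has_vector_derivative_diff v bounded_linear.has_vector_derivative[OF bounded_linear_scaleR_right c])
    moreover have "norm (2 *\<^sub>R (c *\<^sub>R (snd (\<gamma> t) - fst (\<gamma> t))) - v) = norm v"
      by (rule norm_reflect_eq[OF no_skid_inner[of UNIV \<gamma> l] refl]) (use bicycle_pathD(1)[OF b] c v in auto)
    ultimately show ?case using v(1) by metis
  qed
  then show ?thesis using bicycle_path_flip[OF b] by (simp add: infinite_bicycle_path_def front_arc_length_param_def)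
qed

lemma flip_comp_flip [simp]: "flip \<circ> (flip \<circ> \<gamma>) = \<gamma>"
  by (simp add: fun_eq_iff)

lemma global_minimizer_flip:
  assumes "infinite_bicycle_path l \<gamma>" "global_minimizer l \<gamma>"
  shows "global_minimizer l (flip \<circ> \<gamma>)"
  unfolding global_minimizer_def minimizing_on_def
proof (intro allI impI; elim conjE)
  fix a b :: real and \<eta> c d
  assume ab: "a \<le> b" and \<eta>: "c \<le> d" "bicycle_path l {c..d} \<eta>" "\<eta> c = (flip \<circ> \<gamma>) a" "\<eta> d = (flip \<circ> \<gamma>) b"
  have b: "bicycle_path l {a..b} \<gamma>"
    using assms(1) bicycle_path_subset[of l UNIV \<gamma> "{a..b}"] by (simp add: infinite_bicycle_path_def)
  have "front_length (flip \<circ> \<gamma>) a b = front_length \<gamma> a b" by (rule front_length_flip[OF b ab])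
  also have "\<dots> \<le> front_length (flip \<circ> \<eta>) c d"
    using assms(2) ab \<eta> bicycle_path_flip[OF \<eta>(2)] unfolding global_minimizer_def minimizing_on_def
    by (metis comp_apply flip_flip)
  also have "\<dots> = front_length \<eta> c d" by (rule front_length_flip[OF \<eta>(2,1)])
  finally show "front_length (flip \<circ> \<gamma>) a b \<le> front_length \<eta> c d" .
qed

lemma Ck_on_const: "Ck_on k S (\<lambda>x. c)"
  by (induction k arbitrary: c) auto

lemma smooth_on_bounded_linear:
  assumes "bounded_linear g"
  shows "smooth_on S g"
  unfolding smooth_on_def
proof
  fix k
  have "frechet_derivative g (at x) = g" for x
    using assms bounded_linear_imp_has_derivative frechet_derivative_at by metis
  then show "Ck_on k S g"
    using assms by (cases k) (auto simp: Ck_on_const bounded_linear.linear linear_continuous_on bounded_linear_imp_differentiable_on)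
qed

text \<open>\<open>flip\<close> is linear and its own inverse, hence its own differential. For the
  inner product, \<open>fst u\<close> is the projection of \<open>snd u\<close> to the frame
  direction, so all mixed products in the expansion reduce to \<open>fst u \<bullet> fst w\<close>
  and cancel.\<close>

lemma isometry_of_Q_flip: "isometry_of_Q l flip"
proof -
  have inj: "inj_on flip (Q l)" by (metis flip_flip inj_onI)
  have img: "flip ` Q l = Q l"
  proof (intro subset_antisym subsetI)
    fix q assume "q \<in> Q l"
    then show "q \<in> flip ` Q l" by (intro image_eqI[of _ _ "flip q"]) simp_all
  qed auto
  have inv: "inv_into (Q l) flip y = flip y" if "y \<in> Q l" for y
    using that inj by (metis flip_flip flip_in_Q inv_into_f_f)
  have sm: "smooth_on UNIV flip" by (rule smooth_on_bounded_linear[OF bounded_linear_flip])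
  have "diffeomorphism_of (Q l) flip"
    unfolding diffeomorphism_of_def smooth_map_on_def bij_betw_def
  proof (intro conjI ballI)
    fix x :: config
    show "\<exists>U h. open U \<and> x \<in> U \<and> smooth_on U h \<and> (\<forall>y\<in>Q l \<inter> U. h y = flip y)"
      "\<exists>U h. open U \<and> x \<in> U \<and> smooth_on U h \<and> (\<forall>y\<in>Q l \<inter> U. h y = inv_into (Q l) flip y)"
      by (rule exI[of _ UNIV], rule exI[of _ flip], use sm inv in simp)+
  qed (use inj img in auto)
  moreover have tang: "flip u \<in> tangent_space l (flip q)" if u: "u \<in> tangent_space l q" for u q
  proof -
    obtain c where c: "\<forall>t::real. c t \<in> Q l" "c 0 = q" "(c has_vector_derivative u) (at 0)"
      using u by (auto simp: tangent_space_def)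
    show ?thesis unfolding tangent_space_def mem_Collect_eq
      by (rule exI[of _ "\<lambda>t. flip (c t)"]) (use c bounded_linear.has_vector_derivative[OF bounded_linear_flip] in auto)
  qed
  have dist_flip: "flip u \<in> no_skid_distribution l (flip q)" if u: "u \<in> no_skid_distribution l q" for u q
  proof -
    obtain c where c: "fst u = c *\<^sub>R (snd q - fst q)" using u by (auto simp: no_skid_distribution_def)
    have "fst (flip u) = (- c) *\<^sub>R (snd (flip q) - fst (flip q))" by (simp add: c snd_flip scaleR_2 algebra_simps)
    then show ?thesis using tang u unfolding no_skid_distribution_def by blast
  qed
  have dimg: "flip ` no_skid_distribution l q = no_skid_distribution l (flip q)" for q
    using dist_flip[of _ q] dist_flip[of _ "flip q"] by (auto simp: image_iff) (metis flip_flip)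
  have orth: "(snd q - fst q) \<bullet> snd u = (snd q - fst q) \<bullet> fst u" if u: "u \<in> no_skid_distribution l q" for u q
  proof -
    obtain c where c: "\<forall>t::real. c t \<in> Q l" "c 0 = q" "(c has_vector_derivative u) (at 0)"
      using u by (auto simp: tangent_space_def no_skid_distribution_def)
    have "((\<lambda>t. fst (c t)) has_vector_derivative fst u) (at 0)" "((\<lambda>t. snd (c t)) has_vector_derivative snd u) (at 0)"
      using c(3) bounded_linear.has_vector_derivative[OF bounded_linear_fst] bounded_linear.has_vector_derivative[OF bounded_linear_snd] by blast+
    from no_skid_inner[of UNIV c l, OF _ _ _ this] show ?thesis using c by simp
  qed
  have "snd (flip u) \<bullet> snd (flip w) = snd u \<bullet> snd w"
    if u: "u \<in> no_skid_distribution l q" and w: "w \<in> no_skid_distribution l q" for u w q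
  proof -
    obtain c where c: "fst u = c *\<^sub>R (snd q - fst q)" using u by (auto simp: no_skid_distribution_def)
    obtain d where d: "fst w = d *\<^sub>R (snd q - fst q)" using w by (auto simp: no_skid_distribution_def)
    have 1: "fst u \<bullet> snd w = fst u \<bullet> fst w" using orth[OF w] c by simp
    have 2: "snd u \<bullet> fst w = fst u \<bullet> fst w" using orth[OF u] d by (simp add: inner_commute)
    show ?thesis by (simp add: snd_flip inner_diff_left inner_diff_right 1 2)
  qed
  ultimately show ?thesis unfolding isometry_of_Q_def
    using dimg bounded_linear_imp_has_derivative[OF bounded_linear_flip] by blast
qed

subsection \<open>Bicycle paths as competitors\<close>

lemma has_vector_derivative_scaleR_const:
  "(\<phi> has_real_derivative d) (at t within S) \<Longrightarrow> ((\<lambda>t. \<phi> t *\<^sub>R v) has_vector_derivative d *\<^sub>R v) (at t within S)"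
  using has_vector_derivative_scaleR[of \<phi> d t S "\<lambda>_. v" 0] by simp

lemma inner_plane: "(x::plane) \<bullet> y = x$1 * y$1 + x$2 * y$2"
  by (simp add: inner_vec_def sum_2)

definition rot :: "plane \<Rightarrow> plane" where "rot v = vector [- v$2, v$1]"

lemma rot_nth [simp]: "rot v $ 1 = - v$2" "rot v $ 2 = v$1"
  by (simp_all add: rot_def)

lemma inner_rot [simp]: "v \<bullet> rot v = 0" "rot v \<bullet> v = 0" and inner_rot_rot [simp]: "rot v \<bullet> rot w = v \<bullet> w"
  by (simp_all add: inner_plane)

lemma norm_rot [simp]: "norm (rot v) = norm v"
  by (simp add: norm_eq_sqrt_inner)

lemma norm1_inner: "norm (u::'a::real_inner) = 1 \<Longrightarrow> u \<bullet> u = 1"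
  by (simp add: norm_eq_1)

lemma rot_decompose:
  assumes "norm u = 1"
  shows "x = (x \<bullet> u) *\<^sub>R u + (x \<bullet> rot u) *\<^sub>R rot u"
proof -
  have u: "u$1 * u$1 + u$2 * u$2 = 1" using norm1_inner[OF assms] by (simp add: inner_plane)
  have "(x \<bullet> u) * u$1 + (x \<bullet> rot u) * rot u $ 1 = x$1 * (u$1 * u$1 + u$2 * u$2)"
    "(x \<bullet> u) * u$2 + (x \<bullet> rot u) * rot u $ 2 = x$2 * (u$1 * u$1 + u$2 * u$2)"
    by (simp_all add: inner_plane algebra_simps)
  then show ?thesis by (simp add: vec_eq_iff forall_2 u)
qed

lemma norm_rot_frame:
  assumes "norm u = 1"
  shows "(norm (p *\<^sub>R u + q *\<^sub>R rot u))\<^sup>2 = p\<^sup>2 + q\<^sup>2"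
  using norm1_inner[OF assms] unfolding power2_norm_eq_inner
  by (simp add: inner_add_left inner_add_right power2_eq_square)

lemma front_length_ge:
  assumes \<eta>: "bicycle_path l {c..d} \<eta>" and cd: "c \<le> d"
  shows "norm (snd (\<eta> d) - snd (\<eta> c)) \<le> front_length \<eta> c d"
  unfolding front_length_def
  by (rule abs_continuous_on_norm_diff_le_length[OF cd]) (use bicycle_path_abs_continuous[OF \<eta>] cd in simp)

text \<open>The almost everywhere data of a path with unit front speed. The equation for
  \<open>c t * l\<^sup>2\<close> says that the back velocity is the orthogonal projection of the
  front velocity \<open>v t\<close> to the frame; the final bound makes the back track
  1-Lipschitz.\<close>

definition rolling_velocities ::
  "real \<Rightarrow> (real \<Rightarrow> config) \<Rightarrow> real set \<Rightarrow> (real \<Rightarrow> real) \<Rightarrow> (real \<Rightarrow> plane) \<Rightarrow> bool" where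
  "rolling_velocities l \<gamma> N c v \<longleftrightarrow> negligible N \<and>
    (\<forall>t. t \<notin> N \<longrightarrow> ((\<lambda>s. fst (\<gamma> s)) has_vector_derivative c t *\<^sub>R (snd (\<gamma> t) - fst (\<gamma> t))) (at t)
      \<and> ((\<lambda>s. snd (\<gamma> s)) has_vector_derivative v t) (at t) \<and> norm (v t) = 1
      \<and> c t * l\<^sup>2 = (snd (\<gamma> t) - fst (\<gamma> t)) \<bullet> v t \<and> norm (c t *\<^sub>R (snd (\<gamma> t) - fst (\<gamma> t))) \<le> 1)"

lemmas rolling_velocitiesD =
  rolling_velocities_def[THEN iffD1, THEN conjunct1] rolling_velocities_def[THEN iffD1, THEN conjunct2]

text \<open>The speed bound comes from Cauchy-Schwarz: the squared norm of the projected velocity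
  equals its product with the unit vector \<open>v\<close>.\<close>

lemma infinite_bicycle_path_ae:
  assumes "infinite_bicycle_path l \<gamma>"
  obtains N c v where "rolling_velocities l \<gamma> N c v"
proof -
  have b: "bicycle_path l UNIV \<gamma>" and f: "front_arc_length_param \<gamma>"
    using assms by (auto simp: infinite_bicycle_path_def)
  let ?w = "\<lambda>t. snd (\<gamma> t) - fst (\<gamma> t)"
  let ?P = "\<lambda>t c v. ((\<lambda>s. fst (\<gamma> s)) has_vector_derivative c *\<^sub>R ?w t) (at t)
      \<and> ((\<lambda>s. snd (\<gamma> s)) has_vector_derivative v) (at t) \<and> norm v = 1 \<and> c * l\<^sup>2 = ?w t \<bullet> v \<and> norm (c *\<^sub>R ?w t) \<le> 1"
  have "AE t in lebesgue. \<exists>c::real. ((\<lambda>s. fst (\<gamma> s)) has_vector_derivative c *\<^sub>R ?w t) (at t)"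
    using b by (simp add: bicycle_path_def)
  then have "AE t in lebesgue. \<exists>c v. ?P t c v"
    using f[unfolded front_arc_length_param_def]
  proof eventually_elim
    case (elim t)
    then obtain c v where c: "((\<lambda>s. fst (\<gamma> s)) has_vector_derivative c *\<^sub>R ?w t) (at t)"
      and v: "norm v = 1" "((\<lambda>s. snd (\<gamma> s)) has_vector_derivative v) (at t)" by blast
    have "?w t \<bullet> v = ?w t \<bullet> (c *\<^sub>R ?w t)"
      by (rule no_skid_inner[of UNIV \<gamma> l]) (use bicycle_pathD(1)[OF b] c v in auto)
    moreover have "?w t \<bullet> ?w t = l\<^sup>2" using bicycle_pathD(1)[OF b, of t] by (simp add: Q_iff power2_norm_eq_inner[symmetric])
    ultimately have eq: "?w t \<bullet> v = c * l\<^sup>2" by simp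
    have "(norm (c *\<^sub>R ?w t))\<^sup>2 = c * (c * l\<^sup>2)" 
      using \<open>?w t \<bullet> ?w t = l\<^sup>2\<close> unfolding power2_norm_eq_inner by simp
    also have "\<dots> = (c *\<^sub>R ?w t) \<bullet> v" using eq by simp
    also have "\<dots> \<le> norm (c *\<^sub>R ?w t) * norm v" by (rule norm_cauchy_schwarz)
    finally have "norm (c *\<^sub>R ?w t) * norm (c *\<^sub>R ?w t) \<le> norm (c *\<^sub>R ?w t) * 1" using v by (simp add: power2_eq_square)
    then have "norm (c *\<^sub>R ?w t) \<le> 1" by (metis mult_le_cancel_left_pos norm_ge_zero order_le_less zero_le_one)
    then show ?case using c v eq by metis
  qed
  then have "negligible {t. \<not> (\<exists>c v. ?P t c v)}" by (simp only: AE_lebesgue_iff_negligible)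
  moreover obtain c where "\<forall>t. t \<notin> {t. \<not> (\<exists>c v. ?P t c v)} \<longrightarrow> (\<exists>v. ?P t (c t) v)" 
    using choice[of "\<lambda>t c. \<exists>v. t \<notin> {t. \<not> (\<exists>c v. ?P t c v)} \<longrightarrow> ?P t c v"] by auto
  moreover then obtain v where "\<forall>t. t \<notin> {t. \<not> (\<exists>c v. ?P t c v)} \<longrightarrow> ?P t (c t) (v t)" 
    using choice[of "\<lambda>t v. t \<notin> {t. \<not> (\<exists>c v. ?P t c v)} \<longrightarrow> ?P t (c t) v"] by auto
  ultimately have "rolling_velocities l \<gamma> {t. \<not> (\<exists>c v. ?P t c v)} c v" unfolding rolling_velocities_def by blast
  then show thesis by (rule that)
qed

lemma infinite_bicycle_path_bicycle_path:
  "infinite_bicycle_path l \<gamma> \<Longrightarrow> bicycle_path l I \<gamma>"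
  using bicycle_path_subset[of l UNIV \<gamma> I] by (simp add: infinite_bicycle_path_def)

lemma infinite_bicycle_path_in_Q: "infinite_bicycle_path l \<gamma> \<Longrightarrow> norm (snd (\<gamma> t) - fst (\<gamma> t)) = l"
  using bicycle_pathD(1)[of l UNIV \<gamma> t] by (simp add: infinite_bicycle_path_def Q_iff)

lemma infinite_bicycle_path_abs_continuous:
  assumes "infinite_bicycle_path l \<gamma>" "a \<le> b"
  shows "abs_continuous_on a b (\<lambda>t. fst (\<gamma> t))" "abs_continuous_on a b (\<lambda>t. snd (\<gamma> t))"
  using bicycle_path_abs_continuous[OF infinite_bicycle_path_bicycle_path[OF assms(1), of UNIV]] assms(2) by auto

lemma infinite_bicycle_path_lipschitz:
  assumes "infinite_bicycle_path l \<gamma>" "a \<le> b"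
  shows "norm (snd (\<gamma> b) - snd (\<gamma> a)) \<le> b - a" "norm (fst (\<gamma> b) - fst (\<gamma> a)) \<le> b - a"
proof -
  obtain N c v where "rolling_velocities l \<gamma> N c v"
    by (rule infinite_bicycle_path_ae[OF assms(1)])
  note N = rolling_velocitiesD[OF this]
  have "norm (snd (\<gamma> b) - snd (\<gamma> a)) \<le> 1 * (b - a)"
    by (rule abs_continuous_on_norm_diff_le[OF assms(2) infinite_bicycle_path_abs_continuous(2)[OF assms] N(1), of v])
       (use N(2) in \<open>auto intro: has_vector_derivative_at_within\<close>)
  then show "norm (snd (\<gamma> b) - snd (\<gamma> a)) \<le> b - a" by simp
  have "norm (fst (\<gamma> b) - fst (\<gamma> a)) \<le> 1 * (b - a)"
    by (rule abs_continuous_on_norm_diff_le[OF assms(2) infinite_bicycle_path_abs_continuous(1)[OF assms] N(1), of "\<lambda>t. c t *\<^sub>R (snd (\<gamma> t) - fst (\<gamma> t))"])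
       (use N(2) in \<open>auto intro: has_vector_derivative_at_within\<close>)
  then show "norm (fst (\<gamma> b) - fst (\<gamma> a)) \<le> b - a" by simp
qed

lemma front_length_infinite:
  assumes "infinite_bicycle_path l \<gamma>" "a \<le> b"
  shows "front_length \<gamma> a b = b - a"
proof -
  let ?N = "{t. \<not> (\<exists>v. norm v = 1 \<and> ((\<lambda>s. snd (\<gamma> s)) has_vector_derivative v) (at t))} \<union> {a, b}"
  have "negligible ?N"
    using assms(1) unfolding infinite_bicycle_path_def front_arc_length_param_def AE_lebesgue_iff_negligible
    by (intro negligible_Un) auto
  then have "front_length \<gamma> a b = integral {a..b} (\<lambda>t. 1)"
    unfolding front_length_def
  proof (rule integral_spike)
    fix t assume t: "t \<in> {a..b} - ?N"
    then obtain v where v: "norm v = 1" "((\<lambda>s. snd (\<gamma> s)) has_vector_derivative v) (at t)" by auto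
    have "at t within {a..b} = at t" using t by (intro at_within_Icc_at) auto
    then show "1 = norm (vector_derivative (\<lambda>s. snd (\<gamma> s)) (at t within {a..b}))"
      using v vector_derivative_at by metis
  qed
  then show ?thesis using assms(2) by simp
qed

lemma unit_speed_line_global_minimizer:
  assumes "infinite_bicycle_path l \<gamma>" "unit_speed_line (front_track \<gamma>)"
  shows "global_minimizer l \<gamma>"
  unfolding global_minimizer_def minimizing_on_def
proof (intro allI impI; elim conjE)
  fix a b :: real and \<eta> c d
  assume ab: "a \<le> b" and \<eta>: "c \<le> d" "bicycle_path l {c..d} \<eta>" "\<eta> c = \<gamma> a" "\<eta> d = \<gamma> b"
  obtain p v where pv: "norm v = 1" "\<And>t. snd (\<gamma> t) = p + t *\<^sub>R v"
    using assms(2) by (auto simp: unit_speed_line_def front_track_def)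
  have "snd (\<gamma> b) - snd (\<gamma> a) = (b - a) *\<^sub>R v" by (simp add: pv(2) algebra_simps)
  then have "b - a = norm (snd (\<gamma> b) - snd (\<gamma> a))" using ab pv(1) by simp
  then show "front_length \<gamma> a b \<le> front_length \<eta> c d"
    using front_length_ge[OF \<eta>(2,1)] front_length_infinite[OF assms(1) ab] \<eta> by simp
qed

text \<open>A parametrized curve witnessing \<open>connects l p q L\<close> has front speed at most 1, so that
  \<open>L\<close> bounds the length of a bicycle path from \<open>p\<close> to \<open>q\<close>.\<close>

definition connects :: "real \<Rightarrow> config \<Rightarrow> config \<Rightarrow> real \<Rightarrow> bool" where
  "connects l p q L \<longleftrightarrow> 0 \<le> L \<and> (\<exists>\<eta>. \<eta> 0 = p \<and> \<eta> L = q \<and> (\<exists>C. C-lipschitz_on {0..L} \<eta>) \<and>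
     (\<forall>t\<in>{0..L}. \<eta> t \<in> Q l) \<and>
     (\<exists>F. finite F \<and> (\<forall>t\<in>{0..L} - F. \<exists>c v.
        ((\<lambda>s. fst (\<eta> s)) has_vector_derivative c *\<^sub>R (snd (\<eta> t) - fst (\<eta> t))) (at t) \<and>
        ((\<lambda>s. snd (\<eta> s)) has_vector_derivative v) (at t) \<and> norm v \<le> 1)))"

lemma connectsI:
  assumes "0 \<le> L" "\<eta> 0 = p" "\<eta> L = q" "C-lipschitz_on {0..L} \<eta>" "\<And>t. t \<in> {0..L} \<Longrightarrow> \<eta> t \<in> Q l" "finite F"
    "\<And>t. t \<in> {0..L} - F \<Longrightarrow> \<exists>c v. ((\<lambda>s. fst (\<eta> s)) has_vector_derivative c *\<^sub>R (snd (\<eta> t) - fst (\<eta> t))) (at t) \<and>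
        ((\<lambda>s. snd (\<eta> s)) has_vector_derivative v) (at t) \<and> norm v \<le> 1"
  shows "connects l p q L"
  unfolding connects_def using assms by blast

lemma connects_imp_bicycle_path:
  assumes "connects l p q L"
  obtains \<eta> where "0 \<le> L" "bicycle_path l {0..L} \<eta>" "\<eta> 0 = p" "\<eta> L = q" "front_length \<eta> 0 L \<le> L"
proof -
  obtain \<eta> C F where L: "0 \<le> L" and \<eta>: "\<eta> 0 = p" "\<eta> L = q" "C-lipschitz_on {0..L} \<eta>" "\<forall>t\<in>{0..L}. \<eta> t \<in> Q l"
     "finite F" "\<forall>t\<in>{0..L} - F. \<exists>c v.
        ((\<lambda>s. fst (\<eta> s)) has_vector_derivative c *\<^sub>R (snd (\<eta> t) - fst (\<eta> t))) (at t) \<and>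
        ((\<lambda>s. snd (\<eta> s)) has_vector_derivative v) (at t) \<and> norm v \<le> 1"
    using assms unfolding connects_def by blast
  have "bicycle_path l {0..L} \<eta>"
    unfolding bicycle_path_def AE_lebesgue_iff_negligible
  proof (intro conjI allI impI)
    show "\<forall>t\<in>{0..L}. \<eta> t \<in> Q l" by (rule \<eta>)
    fix a b assume "a \<le> b \<and> {a..b} \<subseteq> {0..L}"
    then show "abs_continuous_on a b \<eta>"
      by (intro lipschitz_abs_continuous_on[of _ _ _ C]) (use lipschitz_onD[OF \<eta>(3)] in \<open>force simp: dist_real_def\<close>)
  next
    show "negligible {t. \<not> (t \<in> {0..L} \<longrightarrow> (\<exists>c. ((\<lambda>s. fst (\<eta> s)) has_vector_derivative c *\<^sub>R (snd (\<eta> t) - fst (\<eta> t))) (at t within {0..L})))}"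
      by (rule negligible_subset[OF negligible_finite[OF \<eta>(5)]]) (use \<eta>(6) in \<open>blast intro: has_vector_derivative_at_within\<close>)
  qed
  moreover have "front_length \<eta> 0 L \<le> L"
  proof (cases "(\<lambda>t. norm (vector_derivative (\<lambda>s. snd (\<eta> s)) (at t within {0..L}))) integrable_on {0..L}")
    case True
    let ?f = "\<lambda>t. norm (vector_derivative (\<lambda>s. snd (\<eta> s)) (at t within {0..L}))"
    have "negligible (F \<union> {0, L})" using \<eta>(5) by (intro negligible_finite) auto
    have "norm (integral {0..L} ?f) \<le> 1 * measure lborel {0..L}"
    proof (rule has_integral_bound_real[of 1 "F \<union> {0, L}" ?f])
      show "(?f has_integral integral {0..L} ?f) {0..L}" using True by (rule integrable_integral)
      fix t assume t: "t \<in> {0..L} - (F \<union> {0, L})"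
      then obtain v where v: "((\<lambda>s. snd (\<eta> s)) has_vector_derivative v) (at t)" "norm v \<le> 1" using \<eta>(6) by blast
      have "at t within {0..L} = at t" using t by (intro at_within_Icc_at) auto
      then have "vector_derivative (\<lambda>s. snd (\<eta> s)) (at t within {0..L}) = v" using v(1) vector_derivative_at by metis
      then show "norm (?f t) \<le> 1" using v(2) by simp
    qed (use \<eta>(5) in auto)
    then show ?thesis using L by (simp add: front_length_def)
  next
    \<comment> \<open>\<open>integral\<close> is 0 on a function that is not integrable, so the
      bound holds by default.\<close>
    case False
    then show ?thesis using L by (simp add: front_length_def not_integrable_integral)
  qed
  ultimately show thesis using that L \<eta> by blast
qed

lemma global_minimizer_connects_le:
  assumes "infinite_bicycle_path l \<gamma>" "global_minimizer l \<gamma>" "s \<le> t" "connects l (\<gamma> s) (\<gamma> t) L"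
  shows "t - s \<le> L"
proof -
  obtain \<eta> where \<eta>: "0 \<le> L" "bicycle_path l {0..L} \<eta>" "\<eta> 0 = \<gamma> s" "\<eta> L = \<gamma> t" "front_length \<eta> 0 L \<le> L"
    by (rule connects_imp_bicycle_path[OF assms(4)])
  then have "front_length \<gamma> s t \<le> front_length \<eta> 0 L"
    using assms(2,3) unfolding global_minimizer_def minimizing_on_def by blast
  then show ?thesis using front_length_infinite[OF assms(1,3)] \<eta> by simp
qed

lemma connects_trans:
  assumes "connects l p q L" "connects l q r M"
  shows "connects l p r (L + M)"
proof -
  obtain \<eta> C F where L: "0 \<le> L" and \<eta>: "\<eta> 0 = p" "\<eta> L = q" "C-lipschitz_on {0..L} \<eta>" "\<forall>t\<in>{0..L}. \<eta> t \<in> Q l"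
     "finite F" "\<forall>t\<in>{0..L} - F. \<exists>c v.
        ((\<lambda>s. fst (\<eta> s)) has_vector_derivative c *\<^sub>R (snd (\<eta> t) - fst (\<eta> t))) (at t) \<and>
        ((\<lambda>s. snd (\<eta> s)) has_vector_derivative v) (at t) \<and> norm v \<le> 1"
    using assms(1) unfolding connects_def by blast
  obtain \<zeta> D G where M: "0 \<le> M" and \<zeta>: "\<zeta> 0 = q" "\<zeta> M = r" "D-lipschitz_on {0..M} \<zeta>" "\<forall>t\<in>{0..M}. \<zeta> t \<in> Q l"
     "finite G" "\<forall>t\<in>{0..M} - G. \<exists>c v.
        ((\<lambda>s. fst (\<zeta> s)) has_vector_derivative c *\<^sub>R (snd (\<zeta> t) - fst (\<zeta> t))) (at t) \<and>
        ((\<lambda>s. snd (\<zeta> s)) has_vector_derivative v) (at t) \<and> norm v \<le> 1"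
    using assms(2) unfolding connects_def by blast
  define \<xi> where "\<xi> = (\<lambda>t. if t \<le> L then \<eta> t else \<zeta> (t - L))"
  have lip: "D-lipschitz_on {L..L + M} (\<lambda>t. \<zeta> (t - L))"
  proof (rule lipschitz_onI)
    fix x y assume "x \<in> {L..L + M}" "y \<in> {L..L + M}"
    then show "dist (\<zeta> (x - L)) (\<zeta> (y - L)) \<le> D * dist x y"
      using lipschitz_onD[OF \<zeta>(3), of "x - L" "y - L"] by (simp add: dist_real_def)
  qed (rule lipschitz_on_nonneg[OF \<zeta>(3)])
  have 1: "(max C D)-lipschitz_on {0..L + M} \<xi>"
    unfolding \<xi>_def by (rule lipschitz_on_concat_max[OF \<eta>(3) lip]) (simp add: \<eta> \<zeta>)
  \<comment> \<open>At the junction \<open>L\<close> the velocity may jump; the exceptional times of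
    \<open>\<zeta>\<close> are shifted by \<open>L\<close>.\<close>
  let ?F = "insert L (F \<union> (\<lambda>t. t + L) ` G)"
  have 2: "\<exists>c v. ((\<lambda>s. fst (\<xi> s)) has_vector_derivative c *\<^sub>R (snd (\<xi> t) - fst (\<xi> t))) (at t) \<and>
        ((\<lambda>s. snd (\<xi> s)) has_vector_derivative v) (at t) \<and> norm v \<le> 1" if t: "t \<in> {0..L + M} - ?F" for t
  proof (cases "t < L")
    case True
    then obtain c v where cv: "((\<lambda>s. fst (\<eta> s)) has_vector_derivative c *\<^sub>R (snd (\<eta> t) - fst (\<eta> t))) (at t)"
        "((\<lambda>s. snd (\<eta> s)) has_vector_derivative v) (at t)" "norm v \<le> 1" using \<eta>(6) t by force
    have eq: "\<xi> s = \<eta> s" if "s \<in> {..<L}" for s using that by (simp add: \<xi>_def)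
    have "((\<lambda>s. fst (\<xi> s)) has_vector_derivative c *\<^sub>R (snd (\<eta> t) - fst (\<eta> t))) (at t)"
      "((\<lambda>s. snd (\<xi> s)) has_vector_derivative v) (at t)"
      by (rule has_vector_derivative_transform_within_open[of _ _ _ "{..<L}"], use cv True eq in auto)+
    moreover have "\<xi> t = \<eta> t" using eq True by simp
    ultimately show ?thesis using cv(3) by metis
  next
    case False
    then have tL: "t > L" using t by auto
    then have "t - L \<in> {0..M} - G" using t by (auto simp: image_iff)
    then obtain c v where cv: "((\<lambda>s. fst (\<zeta> s)) has_vector_derivative c *\<^sub>R (snd (\<zeta> (t - L)) - fst (\<zeta> (t - L)))) (at (t - L))"
        "((\<lambda>s. snd (\<zeta> s)) has_vector_derivative v) (at (t - L))" "norm v \<le> 1" using \<zeta>(6) by blast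
    have eq: "\<xi> s = \<zeta> (s - L)" if "s \<in> {L<..}" for s using that by (simp add: \<xi>_def)
    have sh: "((\<lambda>s. s - L) has_vector_derivative 1) (at t)"
      unfolding has_real_derivative_iff_has_vector_derivative[symmetric] by (auto intro!: derivative_eq_intros)
    have cv': "((\<lambda>s. fst (\<zeta> (s - L))) has_vector_derivative c *\<^sub>R (snd (\<zeta> (t - L)) - fst (\<zeta> (t - L)))) (at t)"
      "((\<lambda>s. snd (\<zeta> (s - L))) has_vector_derivative v) (at t)"
      using vector_diff_chain_at[OF sh cv(1)] vector_diff_chain_at[OF sh cv(2)] by (simp_all add: o_def)
    have "((\<lambda>s. fst (\<xi> s)) has_vector_derivative c *\<^sub>R (snd (\<zeta> (t - L)) - fst (\<zeta> (t - L)))) (at t)"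
      "((\<lambda>s. snd (\<xi> s)) has_vector_derivative v) (at t)"
      by (rule has_vector_derivative_transform_within_open[of _ _ _ "{L<..}"], use cv' tL eq in auto)+
    moreover have "\<xi> t = \<zeta> (t - L)" using eq tL by simp
    ultimately show ?thesis using cv(3) by metis
  qed
  have 3: "\<xi> 0 = p" using \<eta> L by (simp add: \<xi>_def)
  have 4: "\<xi> (L + M) = r"
  \<comment> \<open>For \<open>M = 0\<close> the end point still lies in the branch of
    \<open>\<eta>\<close>.\<close>
  proof (cases "M = 0")
    case True then show ?thesis using \<eta> \<zeta> L by (simp add: \<xi>_def)
  next
    case False then show ?thesis using \<zeta> M by (simp add: \<xi>_def)
  qed
  have 5: "\<xi> t \<in> Q l" if "t \<in> {0..L + M}" for t using that \<eta>(4) \<zeta>(4) by (simp add: \<xi>_def)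
  have 6: "finite ?F" using \<eta>(5) \<zeta>(5) by simp
  show ?thesis by (rule connectsI[OF _ 3 4 1 5 6 2]) (use L M in auto)
qed

lemma has_vector_derivative_imp_lipschitz_on:
  assumes "\<And>t. (g has_vector_derivative g' t) (at t)" "\<And>t. norm (g' t) \<le> C" "0 \<le> C"
  shows "C-lipschitz_on S g"
proof (rule lipschitz_on_subset[OF _ subset_UNIV], rule bounded_derivative_imp_lipschitz)
  fix t
  show "(g has_derivative (\<lambda>h. h *\<^sub>R g' t)) (at t within UNIV)" using assms(1) by (simp add: has_vector_derivative_def)
  show "onorm (\<lambda>h. h *\<^sub>R g' t) \<le> C"
  proof (rule onorm_bound[OF assms(3)])
    fix h :: real show "norm (h *\<^sub>R g' t) \<le> C * norm h"
      using mult_right_mono[OF assms(2)[of t], of "\<bar>h\<bar>"] by (simp add: mult.commute)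
  qed
qed (use assms(3) in auto)

text \<open>Competitors are given by formulas on the whole line, which avoids one-sided derivatives
  at the ends. The bounds 1 for the speeds of the two wheels add up to the Lipschitz constant 2 of
  the pair.\<close>

lemma connects_smooth:
  fixes b f :: "real \<Rightarrow> plane"
  assumes L: "0 \<le> L"
    and b: "\<And>t. (b has_vector_derivative c t *\<^sub>R (f t - b t)) (at t)"
    and f: "\<And>t. (f has_vector_derivative v t) (at t)" "\<And>t. norm (v t) \<le> 1"
    and Q: "\<And>t. norm (f t - b t) = l"
  shows "connects l (b 0, f 0) (b L, f L) L"
proof -
  let ?\<eta> = "\<lambda>t. (b t, f t)"
  have nb: "norm (c t *\<^sub>R (f t - b t)) \<le> 1" for t
  proof -
    let ?w = "f t - b t"
    have "?w \<bullet> v t = ?w \<bullet> (c t *\<^sub>R ?w)"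
      using no_skid_inner[of UNIV ?\<eta> l t "c t *\<^sub>R ?w" "v t"] b f Q by (simp add: Q_iff)
    then have "(c t *\<^sub>R ?w) \<bullet> (c t *\<^sub>R ?w) = (c t *\<^sub>R ?w) \<bullet> v t" by simp
    also have "\<dots> \<le> norm (c t *\<^sub>R ?w) * norm (v t)" by (rule norm_cauchy_schwarz)
    also have "\<dots> \<le> norm (c t *\<^sub>R ?w) * 1" using f(2) by (intro mult_left_mono) auto
    finally have "norm (c t *\<^sub>R ?w) * norm (c t *\<^sub>R ?w) \<le> norm (c t *\<^sub>R ?w) * 1"
      by (simp only: power2_norm_eq_inner[symmetric] power2_eq_square)
    then show ?thesis by (metis mult_le_cancel_left_pos norm_ge_zero order_le_less zero_le_one)
  qed
  have lb: "1-lipschitz_on {0..L} b" and lf: "1-lipschitz_on {0..L} f"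
    by (rule has_vector_derivative_imp_lipschitz_on[OF b nb], simp, rule has_vector_derivative_imp_lipschitz_on[OF f], simp)
  have lip: "2-lipschitz_on {0..L} ?\<eta>"
  proof (rule lipschitz_onI)
    fix x y assume xy: "x \<in> {0..L}" "y \<in> {0..L}"
    have "dist (b x, f x) (b y, f y) \<le> dist (b x) (b y) + dist (f x) (f y)"
      using norm_Pair_le[of "b x - b y" "f x - f y"] by (simp add: dist_norm)
    then show "dist (b x, f x) (b y, f y) \<le> 2 * dist x y"
      using lipschitz_onD[OF lb xy] lipschitz_onD[OF lf xy] by simp
  qed simp
  show ?thesis by (rule connectsI[where \<eta> = "?\<eta>" and F = "{}", OF L _ _ lip]) (use b f Q in \<open>auto simp: Q_iff\<close>)
qed


section \<open>Explicit competitors: turning on the spot, riding straight, tractrix arcs\<close>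

text \<open>A crude bound with a convenient constant: up to \<open>pi / 3\<close> the slope of sine
  is at least 1/2, and beyond that \<open>sin y \<ge> 1 / 2\<close> while
  \<open>y < 2\<close>.\<close>

lemma le_4_sin:
  fixes y :: real
  assumes "0 \<le> y" "y \<le> pi / 2"
  shows "y \<le> 4 * sin y"
proof (cases "y \<le> pi / 3")
  case True
  have "sin 0 - 0 / 2 \<le> sin y - y / 2"
  proof (rule DERIV_nonneg_imp_nondecreasing[OF assms(1)])
    fix x assume x: "0 \<le> x" "x \<le> y"
    have "cos (pi / 3) \<le> cos x" using x True by (intro cos_monotone_0_pi_le) auto
    then have "cos x - 1 / 2 \<ge> 0" by (simp add: cos_60)
    moreover have "((\<lambda>x. sin x - x / 2) has_real_derivative cos x - 1 / 2) (at x)"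
      by (auto intro!: derivative_eq_intros)
    ultimately show "\<exists>y. ((\<lambda>x. sin x - x / 2) has_real_derivative y) (at x) \<and> 0 \<le> y" by blast
  qed
  then show ?thesis using assms by simp
next
  case False
  have "sin (pi / 3) \<le> sin y" using False assms by (intro sin_monotone_2pi_le) auto
  moreover have "sqrt 3 \<ge> 1" by simp
  ultimately have "sin y \<ge> 1 / 2" unfolding sin_60 by linarith
  then show ?thesis using assms pi_less_4 by linarith
qed

text \<open>The back wheel rests and the front wheel runs at unit speed on a circle of radius
  \<open>l\<close>, so the no-skid condition holds with factor 0. The point is the cost: it is
  linear in the distance of the two frames, hence negligible between nearby frames.\<close>

lemma connects_rotate:
  assumes l: "l > 0" and w: "norm w0 = 1" "norm w1 = 1"
  obtains L where "connects l (b, b + l *\<^sub>R w0) (b, b + l *\<^sub>R w1) L" "L \<le> 4 * l * norm (w1 - w0)"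
proof -
  let ?p = "w1 \<bullet> w0" and ?q = "w1 \<bullet> rot w0"
  have w1: "w1 = ?p *\<^sub>R w0 + ?q *\<^sub>R rot w0" by (rule rot_decompose[OF w(1)])
  have "?p\<^sup>2 + ?q\<^sup>2 = 1" using norm_rot_frame[OF w(1), of ?p ?q] w1 w(2) by simp
  then obtain x where x: "?p = cos x" "?q = sin x" using sincos_total_2pi by metis
  \<comment> \<open>The angle of the shorter turn; half of it is at most \<open>pi / 2\<close> in
    absolute value, as \<open>le_4_sin\<close> requires.\<close>
  obtain \<delta> where d: "- pi < \<delta>" "\<delta> \<le> pi" "?q = sin \<delta>" "?p = cos \<delta>" using sincos_principal_value[of x] x by auto
  define \<sigma> :: real where "\<sigma> = (if \<delta> \<ge> 0 then 1 else -1)"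
  have s: "\<bar>\<sigma>\<bar> = 1" "\<sigma> * \<bar>\<delta>\<bar> = \<delta>" "\<sigma> * \<sigma> = 1" by (auto simp: \<sigma>_def)
  define L where "L = l * \<bar>\<delta>\<bar>"
  let ?w = "\<lambda>t. cos (\<sigma> * t / l) *\<^sub>R w0 + sin (\<sigma> * t / l) *\<^sub>R rot w0"
  let ?w' = "\<lambda>t. (- sin (\<sigma> * t / l) * (\<sigma> / l)) *\<^sub>R w0 + (cos (\<sigma> * t / l) * (\<sigma> / l)) *\<^sub>R rot w0"
  have dw: "(?w has_vector_derivative ?w' t) (at t)" for t
    by (intro has_vector_derivative_add has_vector_derivative_scaleR_const) (auto intro!: derivative_eq_intros simp: l less_imp_neq[symmetric])
  have "connects l (b, b + l *\<^sub>R ?w 0) (b, b + l *\<^sub>R ?w L) L"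
  proof (rule connects_smooth[where c = "\<lambda>_. 0" and v = "\<lambda>t. l *\<^sub>R ?w' t"])
    show "0 \<le> L" using l by (simp add: L_def)
    fix t
    show "((\<lambda>t. b + l *\<^sub>R ?w t) has_vector_derivative l *\<^sub>R ?w' t) (at t)"
      using has_vector_derivative_add[OF has_vector_derivative_const bounded_linear.has_vector_derivative[OF bounded_linear_scaleR_right[of l] dw[of t]]] by simp
    have "(norm (?w' t))\<^sup>2 = (\<sigma> / l)\<^sup>2 * ((sin (\<sigma> * t / l))\<^sup>2 + (cos (\<sigma> * t / l))\<^sup>2)"
    proof -
      have "(- x * k)\<^sup>2 + (y * k)\<^sup>2 = k\<^sup>2 * (x\<^sup>2 + y\<^sup>2)" for x y k :: real by (simp add: power2_eq_square algebra_simps)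
      then show ?thesis unfolding norm_rot_frame[OF w(1)] .
    qed
    also have "\<dots> = (1 / l)\<^sup>2" using s(3) unfolding sin_cos_squared_add by (simp add: power_divide power2_eq_square[of \<sigma>])
    finally have "norm (?w' t) = 1 / l" using l by (simp add: power2_eq_iff_nonneg)
    then show "norm (l *\<^sub>R ?w' t) \<le> 1" using l by simp
    have "(norm (?w t))\<^sup>2 = 1" unfolding norm_rot_frame[OF w(1)] by simp
    then have "norm (?w t) = 1" using power2_eq_iff_nonneg[of "norm (?w t)" 1] by simp
    then show "norm (b + l *\<^sub>R ?w t - b) = l" using l by simp
  qed simp
  moreover have "?w 0 = w0" by simp
  moreover have "?w L = w1"
  proof -
    have "\<sigma> * L / l = \<delta>" using s l by (simp add: L_def)
    then show ?thesis using w1 d by simp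
  qed
  ultimately have "connects l (b, b + l *\<^sub>R w0) (b, b + l *\<^sub>R w1) L" by simp
  moreover have "L \<le> 4 * l * norm (w1 - w0)"
  proof -
    have "(norm (w1 - w0))\<^sup>2 = 2 - 2 * cos \<delta>"
      using norm1_inner[OF w(1)] norm1_inner[OF w(2)] d unfolding power2_norm_eq_inner
      by (simp add: inner_diff_left inner_diff_right inner_commute)
    also have "\<dots> = (2 * sin (\<bar>\<delta>\<bar> / 2))\<^sup>2"
    proof -
      have "cos \<delta> = cos (2 * (\<bar>\<delta>\<bar> / 2))" by simp
      also have "\<dots> = 1 - 2 * (sin (\<bar>\<delta>\<bar> / 2))\<^sup>2" by (rule cos_double_sin)
      finally show ?thesis by (simp add: power_mult_distrib)
    qed
    finally have "norm (w1 - w0) = 2 * sin (\<bar>\<delta>\<bar> / 2)"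
      using d by (subst (asm) power2_eq_iff_nonneg) (auto intro!: sin_ge_zero)
    moreover have "\<bar>\<delta>\<bar> / 2 \<le> 4 * sin (\<bar>\<delta>\<bar> / 2)" using d by (intro le_4_sin) auto
    ultimately have "\<bar>\<delta>\<bar> \<le> 4 * norm (w1 - w0)" by simp
    then show ?thesis using l by (simp add: L_def)
  qed
  ultimately show thesis using that by blast
qed

text \<open>For \<open>\<sigma> = -1\<close> the bicycle is ridden backwards: seen along
  \<open>u\<close>, the front wheel is behind the back wheel.\<close>

lemma connects_straight:
  assumes l: "l > 0" and u: "norm u = 1" and \<sigma>: "\<sigma> = 1 \<or> \<sigma> = -1" and r: "r \<ge> 0"
  shows "connects l (b, b + l *\<^sub>R (\<sigma> *\<^sub>R u)) (b + r *\<^sub>R u, b + r *\<^sub>R u + l *\<^sub>R (\<sigma> *\<^sub>R u)) r"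
proof -
  have "connects l (b + 0 *\<^sub>R u, b + 0 *\<^sub>R u + l *\<^sub>R (\<sigma> *\<^sub>R u)) (b + r *\<^sub>R u, b + r *\<^sub>R u + l *\<^sub>R (\<sigma> *\<^sub>R u)) r"
  proof (rule connects_smooth[where c = "\<lambda>_. \<sigma> / l" and v = "\<lambda>_. u", OF r])
    fix t :: real
    have d: "((\<lambda>t. t *\<^sub>R u) has_vector_derivative u) (at t)"
      using has_vector_derivative_scaleR_const[of "\<lambda>t. t" 1 t UNIV u] by simp
    have "((\<lambda>t. b + t *\<^sub>R u) has_vector_derivative 0 + u) (at t)"
      by (intro has_vector_derivative_add has_vector_derivative_const d)
    moreover have "\<sigma> * \<sigma> = 1" using \<sigma> by auto
    ultimately show "((\<lambda>t. b + t *\<^sub>R u) has_vector_derivative (\<sigma> / l) *\<^sub>R (b + t *\<^sub>R u + l *\<^sub>R \<sigma> *\<^sub>R u - (b + t *\<^sub>R u))) (at t)"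
      using l by simp
    have "((\<lambda>t. b + t *\<^sub>R u + l *\<^sub>R \<sigma> *\<^sub>R u) has_vector_derivative 0 + u + 0) (at t)"
      by (intro has_vector_derivative_add has_vector_derivative_const d)
    then show "((\<lambda>t. b + t *\<^sub>R u + l *\<^sub>R \<sigma> *\<^sub>R u) has_vector_derivative u) (at t)" by simp
    show "norm (b + t *\<^sub>R u + l *\<^sub>R \<sigma> *\<^sub>R u - (b + t *\<^sub>R u)) = l" using u l \<sigma> by auto
  qed (use u in auto)
  then show ?thesis by simp
qed

lemma tanh_sech_square: "(tanh x)\<^sup>2 + (1 / cosh (x::real))\<^sup>2 = 1"
proof -
  have "(tanh x)\<^sup>2 + (1 / cosh x)\<^sup>2 = ((sinh x)\<^sup>2 + 1) / (cosh x)\<^sup>2"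
    by (simp add: tanh_def power_divide add_divide_distrib)
  then show ?thesis using cosh_real_pos[of x] unfolding cosh_square_eq[symmetric] by simp
qed

lemma has_real_derivative_tanh_scaled:
  assumes "l > 0"
  shows "((\<lambda>t. tanh ((t - a) / l)) has_real_derivative (1 / cosh ((t - a) / l))\<^sup>2 / l) (at t)"
proof -
  have "((\<lambda>t. tanh ((t - a) / l)) has_real_derivative (1 - (tanh ((t - a) / l))\<^sup>2) * (1 / l)) (at t)"
    using cosh_real_pos[of "(t - a) / l"] assms by (auto intro!: derivative_eq_intros)
  moreover have "1 - (tanh ((t - a) / l))\<^sup>2 = (1 / cosh ((t - a) / l))\<^sup>2" using tanh_sech_square[of "(t - a) / l"] by linarith
  ultimately show ?thesis by (simp only: mult.right_neutral times_divide_eq_right)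
qed

lemma has_real_derivative_sech_scaled:
  assumes "l > 0"
  shows "((\<lambda>t. 1 / cosh ((t - a) / l)) has_real_derivative - (tanh ((t - a) / l) * (1 / cosh ((t - a) / l))) / l) (at t)"
  using cosh_real_pos[of "(t - a) / l"] assms
  by (auto intro!: derivative_eq_intros simp: tanh_def power2_eq_square)

text \<open>The direction of the frame while the front wheel moves along a line with velocity \<open>u\<close> and the
  back wheel describes a tractrix whose cusp is passed at time \<open>a\<close>.\<close>

definition tractrix_frame :: "real \<Rightarrow> plane \<Rightarrow> plane \<Rightarrow> real \<Rightarrow> real \<Rightarrow> plane" where
  "tractrix_frame l u h a t = tanh ((t - a) / l) *\<^sub>R u + (1 / cosh ((t - a) / l)) *\<^sub>R h"

lemma norm_orthonormal:
  fixes u h :: "'a::real_inner"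
  assumes "norm u = 1" "norm h = 1" "u \<bullet> h = 0"
  shows "(norm (p *\<^sub>R u + q *\<^sub>R h))\<^sup>2 = p\<^sup>2 + q\<^sup>2"
  using norm1_inner[OF assms(1)] norm1_inner[OF assms(2)] assms(3) unfolding power2_norm_eq_inner
  by (simp add: inner_add_left inner_add_right power2_eq_square inner_commute)

lemma norm_tractrix_frame:
  assumes "norm u = 1" "norm h = 1" "u \<bullet> h = 0"
  shows "norm (tractrix_frame l u h a t) = 1"
proof -
  have "(norm (tractrix_frame l u h a t))\<^sup>2 = 1"
    unfolding tractrix_frame_def norm_orthonormal[OF assms] by (rule tanh_sech_square)
  then show ?thesis using power2_eq_iff_nonneg[of "norm (tractrix_frame l u h a t)" 1] by simp
qed

text \<open>This is the steering equation: while the front wheel moves with velocity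
  \<open>u\<close>, the frame is turned by the part of \<open>u\<close> orthogonal to it, divided by
  \<open>l\<close>. Every path with a straight front track obeys it.\<close>

lemma tractrix_frame_derivative:
  fixes u h :: plane and a :: real
  assumes l: "l > 0" and "norm u = 1" "norm h = 1" "u \<bullet> h = 0"
  defines "w \<equiv> tractrix_frame l u h a"
  shows "(w has_vector_derivative (1 / l) *\<^sub>R (u - (u \<bullet> w t) *\<^sub>R w t)) (at t)"
proof -
  let ?T = "tanh ((t - a) / l)" and ?S = "1 / cosh ((t - a) / l)"
  have "((\<lambda>t. tanh ((t - a) / l) *\<^sub>R u + (1 / cosh ((t - a) / l)) *\<^sub>R h) has_vector_derivative (?S\<^sup>2 / l) *\<^sub>R u + (- (?T * ?S) / l) *\<^sub>R h) (at t)"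
    by (intro has_vector_derivative_add has_vector_derivative_scaleR_const
      has_real_derivative_tanh_scaled[OF l] has_real_derivative_sech_scaled[OF l])
  moreover have "u \<bullet> w t = ?T" using assms norm1_inner[of u] by (simp add: tractrix_frame_def inner_add_right)
  moreover have "?S\<^sup>2 = 1 - ?T\<^sup>2" using tanh_sech_square[of "(t - a) / l"] by simp
  then have "(?S\<^sup>2 / l) *\<^sub>R u + (- (?T * ?S) / l) *\<^sub>R h = (1 / l) *\<^sub>R (u - ?T *\<^sub>R w t)"
    by (simp only: w_def tractrix_frame_def)
       (simp add: scaleR_diff_right scaleR_add_right scaleR_left_diff_distrib diff_divide_distrib power2_eq_square)
  ultimately show ?thesis by (simp add: w_def tractrix_frame_def[abs_def])
qed

text \<open>The back velocity is the projection of \<open>u\<close> to the frame, so a tractrix with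
  the front wheel on its asymptote satisfies the no-skid condition.\<close>

lemma tractrix_back_derivative:
  fixes u h :: plane and a :: real
  assumes l: "l > 0" and uh: "norm u = 1" "norm h = 1" "u \<bullet> h = 0"
  defines "w \<equiv> tractrix_frame l u h a"
  shows "((\<lambda>t. p + t *\<^sub>R u - l *\<^sub>R w t) has_vector_derivative (u \<bullet> w t) *\<^sub>R w t) (at t)"
proof -
  have d: "((\<lambda>t. t *\<^sub>R u) has_vector_derivative u) (at t)"
    using has_vector_derivative_scaleR_const[of "\<lambda>t. t" 1 t UNIV u] by simp
  have "((\<lambda>t. p + t *\<^sub>R u - l *\<^sub>R w t) has_vector_derivative 0 + u - l *\<^sub>R ((1 / l) *\<^sub>R (u - (u \<bullet> w t) *\<^sub>R w t))) (at t)"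
    unfolding w_def
    by (intro has_vector_derivative_add has_vector_derivative_diff has_vector_derivative_const d
         bounded_linear.has_vector_derivative[OF bounded_linear_scaleR_right] tractrix_frame_derivative[OF assms(1-4)])
  then show ?thesis using l by simp
qed

text \<open>The arc is symmetric about the cusp, which is passed at time \<open>M\<close>. The
  \<open>h\<close> components of the frame agree at both ends, so that the displacement of the back
  wheel is parallel to \<open>u\<close>; it falls short of that of the front wheel by
  \<open>2 * l * T\<close>, which tends to \<open>2 * l\<close> for large \<open>M\<close>.\<close>

lemma connects_tractrix:
  fixes u h b :: plane
  assumes l: "l > 0" and uh: "norm u = 1" "norm h = 1" "u \<bullet> h = 0" and M: "M \<ge> 0"
  defines "T \<equiv> tanh (M / l)" and "S \<equiv> 1 / cosh (M / l)"
  defines "b' \<equiv> b + (2 * M - 2 * l * T) *\<^sub>R u"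
  shows "connects l (b, b + l *\<^sub>R (- T *\<^sub>R u + S *\<^sub>R h)) (b', b' + l *\<^sub>R (T *\<^sub>R u + S *\<^sub>R h)) (2 * M)"
proof -
  let ?w = "tractrix_frame l u h M"
  define p where "p = b + l *\<^sub>R (- T *\<^sub>R u + S *\<^sub>R h)"
  have w0: "?w 0 = - T *\<^sub>R u + S *\<^sub>R h" by (simp add: tractrix_frame_def T_def S_def)
  have w1: "?w (2 * M) = T *\<^sub>R u + S *\<^sub>R h" by (simp add: tractrix_frame_def T_def S_def)
  have "connects l (p + 0 *\<^sub>R u - l *\<^sub>R ?w 0, p + 0 *\<^sub>R u) (p + (2 * M) *\<^sub>R u - l *\<^sub>R ?w (2 * M), p + (2 * M) *\<^sub>R u) (2 * M)"
  proof (rule connects_smooth[where c = "\<lambda>t. (u \<bullet> ?w t) / l" and v = "\<lambda>_. u"])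
    fix t :: real
    show "((\<lambda>t. p + t *\<^sub>R u - l *\<^sub>R ?w t) has_vector_derivative (u \<bullet> ?w t / l) *\<^sub>R (p + t *\<^sub>R u - (p + t *\<^sub>R u - l *\<^sub>R ?w t))) (at t)"
      using tractrix_back_derivative[OF l uh, of p M t] l by simp
    show "((\<lambda>t. p + t *\<^sub>R u) has_vector_derivative u) (at t)"
      using has_vector_derivative_add[OF has_vector_derivative_const[of p] has_vector_derivative_scaleR_const[of "\<lambda>t. t" 1 t UNIV u]] by simp
    show "norm (p + t *\<^sub>R u - (p + t *\<^sub>R u - l *\<^sub>R ?w t)) = l" using norm_tractrix_frame[OF uh] l by simp
  qed (use M uh in auto)
  moreover have "p + (2 * M) *\<^sub>R u = b' + l *\<^sub>R (T *\<^sub>R u + S *\<^sub>R h)"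
    by (simp add: p_def b'_def vec_eq_iff algebra_simps)
  ultimately show ?thesis unfolding w0 w1 by (simp add: p_def)
qed

subsection \<open>Asymptotics of global minimizers\<close>

definition frame :: "real \<Rightarrow> (real \<Rightarrow> config) \<Rightarrow> real \<Rightarrow> plane" where
  "frame l \<gamma> t = (1 / l) *\<^sub>R (snd (\<gamma> t) - fst (\<gamma> t))"

lemma front_eq_frame: "l > 0 \<Longrightarrow> snd (\<gamma> t) = fst (\<gamma> t) + l *\<^sub>R frame l \<gamma> t"
  by (simp add: frame_def)

lemma config_eq_frame: "l > 0 \<Longrightarrow> \<gamma> t = (fst (\<gamma> t), fst (\<gamma> t) + l *\<^sub>R frame l \<gamma> t)"
  by (simp add: front_eq_frame[symmetric])

lemma norm_frame: "infinite_bicycle_path l \<gamma> \<Longrightarrow> l > 0 \<Longrightarrow> norm (frame l \<gamma> t) = 1"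
  using infinite_bicycle_path_in_Q[of l \<gamma> t] by (simp add: frame_def)

lemma frame_flip: "frame l (flip \<circ> \<gamma>) t = - frame l \<gamma> t"
proof -
  have "snd (flip (\<gamma> t)) - fst (flip (\<gamma> t)) = - (snd (\<gamma> t) - fst (\<gamma> t))" by (simp add: snd_flip scaleR_2)
  then show ?thesis unfolding frame_def o_def by (simp only: scaleR_minus_right)
qed

lemma global_minimizer_bound_straight:
  assumes l: "l > 0" and \<gamma>: "infinite_bicycle_path l \<gamma>" "global_minimizer l \<gamma>" and st: "s \<le> t"
    and u: "norm u = 1" "\<sigma> = 1 \<or> \<sigma> = -1" and r: "fst (\<gamma> t) - fst (\<gamma> s) = r *\<^sub>R u" "r \<ge> 0"
  shows "t - s \<le> r + 4 * l * (norm (frame l \<gamma> s - \<sigma> *\<^sub>R u) + norm (frame l \<gamma> t - \<sigma> *\<^sub>R u))"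
proof -
  let ?w = "frame l \<gamma>" and ?b = "\<lambda>t. fst (\<gamma> t)"
  have su: "norm (\<sigma> *\<^sub>R u) = 1" using u by auto
  obtain L1 where L1: "connects l (?b s, ?b s + l *\<^sub>R ?w s) (?b s, ?b s + l *\<^sub>R (\<sigma> *\<^sub>R u)) L1" "L1 \<le> 4 * l * norm (\<sigma> *\<^sub>R u - ?w s)"
    by (rule connects_rotate[OF l norm_frame[OF \<gamma>(1) l] su])
  obtain L2 where L2: "connects l (?b t, ?b t + l *\<^sub>R (\<sigma> *\<^sub>R u)) (?b t, ?b t + l *\<^sub>R ?w t) L2" "L2 \<le> 4 * l * norm (?w t - \<sigma> *\<^sub>R u)"
    by (rule connects_rotate[OF l su norm_frame[OF \<gamma>(1) l]])
  have bt: "?b t = ?b s + r *\<^sub>R u" using r(1) by (simp add: algebra_simps)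
  have "connects l (\<gamma> s) (\<gamma> t) (L1 + r + L2)"
    using connects_trans[OF connects_trans[OF L1(1) connects_straight[OF l u r(2)]] L2(1)[unfolded bt]]
    unfolding bt[symmetric] by (simp add: config_eq_frame[OF l, symmetric])
  then have "t - s \<le> L1 + r + L2" by (rule global_minimizer_connects_le[OF \<gamma> st])
  then show ?thesis using L1(2) L2(2) by (simp add: norm_minus_commute algebra_simps)
qed

lemma global_minimizer_bound_tractrix:
  assumes l: "l > 0" and \<gamma>: "infinite_bicycle_path l \<gamma>" "global_minimizer l \<gamma>" and st: "s \<le> t"
    and u: "norm u = 1" "norm h = 1" "u \<bullet> h = 0" and M: "M \<ge> 0"
    and r: "fst (\<gamma> t) - fst (\<gamma> s) = (2 * M - 2 * l * tanh (M / l)) *\<^sub>R u"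
  shows "t - s \<le> 2 * M + 4 * l * (norm (frame l \<gamma> s - (- tanh (M / l) *\<^sub>R u + (1 / cosh (M / l)) *\<^sub>R h))
      + norm (frame l \<gamma> t - (tanh (M / l) *\<^sub>R u + (1 / cosh (M / l)) *\<^sub>R h)))"
proof -
  let ?w = "frame l \<gamma>" and ?b = "\<lambda>t. fst (\<gamma> t)"
  let ?T = "tanh (M / l)" and ?S = "1 / cosh (M / l)"
  let ?ws = "- ?T *\<^sub>R u + ?S *\<^sub>R h" and ?wt = "?T *\<^sub>R u + ?S *\<^sub>R h"
  have n1: "norm ?wt = 1" using norm_tractrix_frame[OF u, of l 0 M] by (simp add: tractrix_frame_def)
  have n0: "norm ?ws = 1" using norm_tractrix_frame[OF u, of l 0 "- M"] by (simp add: tractrix_frame_def)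
  obtain L1 where L1: "connects l (?b s, ?b s + l *\<^sub>R ?w s) (?b s, ?b s + l *\<^sub>R ?ws) L1" "L1 \<le> 4 * l * norm (?ws - ?w s)"
    by (rule connects_rotate[OF l norm_frame[OF \<gamma>(1) l] n0])
  obtain L2 where L2: "connects l (?b t, ?b t + l *\<^sub>R ?wt) (?b t, ?b t + l *\<^sub>R ?w t) L2" "L2 \<le> 4 * l * norm (?w t - ?wt)"
    by (rule connects_rotate[OF l n1 norm_frame[OF \<gamma>(1) l]])
  have bt: "?b t = ?b s + (2 * M - 2 * l * ?T) *\<^sub>R u" using r(1) by (simp add: algebra_simps)
  have "connects l (\<gamma> s) (\<gamma> t) (L1 + 2 * M + L2)"
    using connects_trans[OF connects_trans[OF L1(1) connects_tractrix[OF l u M]] L2(1)[unfolded bt]]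
    unfolding bt[symmetric] by (simp add: config_eq_frame[OF l, symmetric])
  then have "t - s \<le> L1 + 2 * M + L2" by (rule global_minimizer_connects_le[OF \<gamma> st])
  then show ?thesis using L1(2) L2(2) by (simp add: norm_minus_commute algebra_simps)
qed

text \<open>\<open>M\<close> is found by the intermediate value theorem between 0 and
  \<open>r / 2 + l\<close>. The bound \<open>2 * M \<le> r + 2 * l\<close> limits the length of the
  tractrix ride, and \<open>r / 2 \<le> M\<close> pushes its end frames towards the asymptote when
  \<open>r\<close> is large.\<close>

lemma tractrix_half_length_exists:
  assumes l: "l > 0" and r: "r \<ge> (0::real)"
  obtains M where "M \<ge> 0" "2 * M - 2 * l * tanh (M / l) = r" "r / 2 \<le> M" "2 * M \<le> r + 2 * l"
proof -
  let ?g = "\<lambda>M. 2 * M - 2 * l * tanh (M / l)"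
  have t: "tanh x \<le> 1" for x :: real using tanh_real_lt_1[of x] by simp
  have "\<exists>M\<ge>0. M \<le> r / 2 + l \<and> ?g M = r"
  proof (rule IVT')
    show "?g 0 \<le> r" using r by simp
    have "2 * l * tanh ((r / 2 + l) / l) \<le> 2 * l * 1" using l t by (intro mult_left_mono) auto
    then show "r \<le> ?g (r / 2 + l)" by simp
    show "continuous_on {0..r / 2 + l} ?g"
      using l by (intro continuous_intros) (auto simp: less_imp_neq[OF cosh_real_pos, symmetric])
  qed (use l r in auto)
  then obtain M where M: "M \<ge> 0" "M \<le> r / 2 + l" "?g M = r" by auto
  have "0 \<le> 2 * l * tanh (M / l)" using l M by simp
  then show thesis using that[of M] M by auto
qed

lemma norm_scaleR_unit_diff:
  fixes w v :: "'a::real_inner"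
  assumes "norm w = 1" "norm v = 1" "\<sigma> = 1 \<or> \<sigma> = -1"
  shows "(norm (w - \<sigma> *\<^sub>R v))\<^sup>2 = 2 - 2 * (\<sigma> * (w \<bullet> v))"
  using norm1_inner[OF assms(1)] norm1_inner[OF assms(2)] assms(3) unfolding power2_norm_eq_inner
  by (auto simp: inner_diff_left inner_diff_right inner_commute)

lemma exists_unit_direction:
  fixes x :: plane
  obtains u where "norm u = 1" "x = norm x *\<^sub>R u"
proof (cases "x = 0")
  case True
  then show thesis using that[of "axis 1 1"] by (simp add: norm_axis_1)
next
  case False
  then show thesis using that[of "(1 / norm x) *\<^sub>R x"] by simp
qed

lemma global_minimizer_displacement:
  assumes l: "l > 0" and \<gamma>: "infinite_bicycle_path l \<gamma>" "global_minimizer l \<gamma>" and st: "s \<le> t"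
  shows "t - s \<le> norm (fst (\<gamma> t) - fst (\<gamma> s)) + 16 * l"
proof -
  obtain u where u: "norm u = 1" "fst (\<gamma> t) - fst (\<gamma> s) = norm (fst (\<gamma> t) - fst (\<gamma> s)) *\<^sub>R u"
    by (rule exists_unit_direction)
  have d: "norm (frame l \<gamma> x - 1 *\<^sub>R u) \<le> 2" for x
    using norm_triangle_ineq4[of "frame l \<gamma> x" u] norm_frame[OF \<gamma>(1) l, of x] u by simp
  have "t - s \<le> norm (fst (\<gamma> t) - fst (\<gamma> s)) + 4 * l * (norm (frame l \<gamma> s - 1 *\<^sub>R u) + norm (frame l \<gamma> t - 1 *\<^sub>R u))"
    by (rule global_minimizer_bound_straight[OF l \<gamma> st u(1) _ u(2)]) auto
  \<comment> \<open>The origin of \<open>16 * l\<close>: each of the two turns costs at most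
    \<open>4 * l\<close> times 2, the diameter of the unit circle, whatever the frames are.\<close>
  also have "\<dots> \<le> norm (fst (\<gamma> t) - fst (\<gamma> s)) + 4 * l * (2 + 2)"
    using l d by (intro add_mono mult_left_mono order_refl) auto
  finally show ?thesis by simp
qed

text \<open>By the triangle inequality, enlarging the interval adds at least as much length as
  displacement. So a bound for the excess on arbitrarily large intervals holds on all of
  them.\<close>

lemma excess_mono:
  fixes g :: "real \<Rightarrow> 'a::real_normed_vector"
  assumes lip: "\<And>a b. a \<le> b \<Longrightarrow> norm (g b - g a) \<le> b - a"
    and "s' \<le> s" "s \<le> t" "t \<le> t'"
  shows "(t - s) - norm (g t - g s) \<le> (t' - s') - norm (g t' - g s')"
proof -
  have "norm (g t' - g s') \<le> norm (g t' - g t) + norm (g t - g s) + norm (g s - g s')"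
    using norm_triangle_ineq[of "g t' - g t + (g t - g s)" "g s - g s'"] norm_triangle_ineq[of "g t' - g t" "g t - g s"] by simp
  then show ?thesis using lip[OF assms(2)] lip[OF assms(4)] by linarith
qed

text \<open>One direction has to serve all intervals. The bound holds from \<open>- n\<close> to
  \<open>n\<close> for the direction \<open>u n\<close> of this chord and passes to subintervals
  because the projected displacement is 1-Lipschitz; \<open>v\<close> is a limit point of the
  \<open>u n\<close> on the unit circle.\<close>

lemma global_minimizer_direction:
  assumes l: "l > 0" and \<gamma>: "infinite_bicycle_path l \<gamma>" "global_minimizer l \<gamma>"
  obtains v where "norm v = 1" "\<forall>s t. s \<le> t \<longrightarrow> (t - s) - (fst (\<gamma> t) - fst (\<gamma> s)) \<bullet> v \<le> 16 * l"
proof -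
  let ?b = "\<lambda>t. fst (\<gamma> t)"
  have "\<exists>u. norm u = 1 \<and> ?b (real n) - ?b (- real n) = norm (?b (real n) - ?b (- real n)) *\<^sub>R u" for n
    using exists_unit_direction by metis
  then obtain u where u: "\<And>n. norm (u n) = 1" "\<And>n. ?b (real n) - ?b (- real n) = norm (?b (real n) - ?b (- real n)) *\<^sub>R u n"
    by metis
  have key: "(t - s) - (?b t - ?b s) \<bullet> u n \<le> 16 * l" if "- real n \<le> s" "s \<le> t" "t \<le> real n" for n s t
  proof -
    have m: "(?b y - ?b x) \<bullet> u n \<le> y - x" if "x \<le> y" for x y
      using norm_cauchy_schwarz[of "?b y - ?b x" "u n"] u(1)[of n] infinite_bicycle_path_lipschitz(2)[OF \<gamma>(1) that] by simp
    have "(?b (real n) - ?b (- real n)) \<bullet> u n = norm (?b (real n) - ?b (- real n))"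
      using norm1_inner[OF u(1)[of n]] by (subst u(2)) simp
    moreover have "(?b (real n) - ?b (- real n)) \<bullet> u n = (?b (real n) - ?b t) \<bullet> u n + (?b t - ?b s) \<bullet> u n + (?b s - ?b (- real n)) \<bullet> u n"
      by (simp add: inner_diff_left)
    moreover have "real n - (- real n) \<le> norm (?b (real n) - ?b (- real n)) + 16 * l"
      by (rule global_minimizer_displacement[OF l \<gamma>]) simp
    ultimately show ?thesis using m[OF that(1)] m[OF that(3)] by linarith
  qed
  have "\<forall>n. u n \<in> sphere 0 1" using u(1) by simp
  then obtain v k where v: "v \<in> sphere 0 1" "strict_mono k" "(u \<circ> k) \<longlonglongrightarrow> v"
    using compact_sphere[of "0::plane" 1] unfolding compact_def by metis
  have "(t - s) - (?b t - ?b s) \<bullet> v \<le> 16 * l" if "s \<le> t" for s t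
  proof (rule LIMSEQ_le_const2)
    show "(\<lambda>n. (t - s) - (?b t - ?b s) \<bullet> u (k n)) \<longlonglongrightarrow> (t - s) - (?b t - ?b s) \<bullet> v"
      using v(3) unfolding o_def by (intro tendsto_intros)
    obtain N :: nat where N: "max \<bar>s\<bar> \<bar>t\<bar> \<le> real N" using real_arch_simple by blast
    show "\<exists>N. \<forall>n\<ge>N. (t - s) - (?b t - ?b s) \<bullet> u (k n) \<le> 16 * l"
    proof (intro exI[of _ N] allI impI)
      fix n assume "N \<le> n"
      then have "real N \<le> real (k n)" using seq_suble[OF v(2), of n] by simp
      then show "(t - s) - (?b t - ?b s) \<bullet> u (k n) \<le> 16 * l" using N that by (intro key) auto
    qed
  qed
  then show thesis using that[of v] v(1) by simp
qed

text \<open>The back wheel moves along the frame at speed at most 1, so its velocity component along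
  \<open>v\<close> is at most \<open>\<bar>frame l \<gamma> \<tau> \<bullet> v\<bar>\<close>. Thus
  bounded excess in direction \<open>v\<close> rules out long stretches on which the frame stays
  away from \<open>v\<close> and \<open>- v\<close>.\<close>

lemma frame_inner_bound_displacement:
  assumes l: "l > 0" and \<gamma>: "infinite_bicycle_path l \<gamma>" and st: "s \<le> t" and K: "0 \<le> K"
    and w: "\<And>\<tau>. \<tau> \<in> {s..t} \<Longrightarrow> \<bar>frame l \<gamma> \<tau> \<bullet> v\<bar> \<le> K"
  shows "(fst (\<gamma> t) - fst (\<gamma> s)) \<bullet> v \<le> K * (t - s)"
proof -
  obtain N c f' where "rolling_velocities l \<gamma> N c f'"
    by (rule infinite_bicycle_path_ae[OF \<gamma>])
  note N = rolling_velocitiesD[OF this]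
  let ?g = "\<lambda>t. fst (\<gamma> t) \<bullet> v"
  have "abs_continuous_on s t ?g"
  proof (rule abs_continuous_on_dominated[OF infinite_bicycle_path_abs_continuous(1)[OF \<gamma> st]])
    fix x y
    have "\<bar>(fst (\<gamma> x) - fst (\<gamma> y)) \<bullet> v\<bar> \<le> norm (fst (\<gamma> x) - fst (\<gamma> y)) * norm v" by (rule Cauchy_Schwarz_ineq2)
    then show "dist (?g x) (?g y) \<le> norm v * dist (fst (\<gamma> x)) (fst (\<gamma> y))"
      by (simp add: dist_norm inner_diff_left mult.commute)
  qed
  then have "norm (?g t - ?g s) \<le> K * (t - s)"
  proof (rule abs_continuous_on_norm_diff_le[OF st _ N(1) _ K])
    fix x assume x: "x \<in> {s..t} - N"
    let ?d = "c x *\<^sub>R (snd (\<gamma> x) - fst (\<gamma> x))"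
    have "(?g has_vector_derivative ?d \<bullet> v) (at x)"
      using N(2) x by (intro bounded_linear.has_vector_derivative[OF bounded_linear_inner_left]) auto
    then show "(?g has_vector_derivative ?d \<bullet> v) (at x within {s..t})" by (rule has_vector_derivative_at_within)
    have e: "?d = (c x * l) *\<^sub>R frame l \<gamma> x" using l by (simp add: frame_def)
    have "norm ?d \<le> 1" using N(2) x by auto
    then have "\<bar>c x * l\<bar> \<le> 1" unfolding e using norm_frame[OF \<gamma> l, of x] by simp
    then have "\<bar>c x * l\<bar> * \<bar>frame l \<gamma> x \<bullet> v\<bar> \<le> 1 * K" using w x by (intro mult_mono) auto
    then show "norm (?d \<bullet> v) \<le> K" unfolding e by (simp add: abs_mult)
  qed
  then show ?thesis by (simp add: inner_diff_left)
qed

text \<open>No convergence is claimed, only the existence of arbitrarily remote times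
  \<open>s\<close> and \<open>t\<close>. The direction \<open>u\<close> is that of the chord of the
  back track between them, since the competitors displace the back wheel exactly along it;
  \<open>\<sigma>'\<close> and \<open>\<sigma>\<close> tell whether the frame points backward or
  forward at either end.\<close>

definition frame_limits :: "real \<Rightarrow> (real \<Rightarrow> config) \<Rightarrow> real \<Rightarrow> real \<Rightarrow> bool" where
  "frame_limits l \<gamma> \<sigma>' \<sigma> \<longleftrightarrow> (\<forall>\<epsilon>>0. \<forall>N. \<exists>s t r u. s \<le> - N \<and> N \<le> t \<and> s \<le> t \<and> norm u = 1 \<and>
     fst (\<gamma> t) - fst (\<gamma> s) = r *\<^sub>R u \<and> N \<le> r \<and> 0 \<le> r \<and>
     norm (frame l \<gamma> s - \<sigma>' *\<^sub>R u) < \<epsilon> \<and> norm (frame l \<gamma> t - \<sigma> *\<^sub>R u) < \<epsilon>)"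

text \<open>A frame with \<open>\<bar>w \<bullet> v\<bar> \<le> 1 - \<epsilon>\<close> on a time
  window of length \<open>16 * l / \<epsilon> + 1\<close> would produce an excess above
  \<open>16 * l\<close>. So every such window contains a time with an almost parallel frame, and
  some sign recurs at either end of the time axis.\<close>

lemma global_minimizer_asymptotics:
  assumes l: "l > 0" and \<gamma>: "infinite_bicycle_path l \<gamma>" "global_minimizer l \<gamma>"
  obtains \<sigma>' \<sigma> where "\<sigma>' = 1 \<or> \<sigma>' = (-1::real)" "\<sigma> = 1 \<or> \<sigma> = (-1::real)"
    "frame_limits l \<gamma> \<sigma>' \<sigma>"
proof -
  let ?w = "frame l \<gamma>" and ?b = "\<lambda>t. fst (\<gamma> t)"
  obtain v where v: "norm v = 1" "\<forall>s t. s \<le> t \<longrightarrow> (t - s) - (?b t - ?b s) \<bullet> v \<le> 16 * l"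
    by (rule global_minimizer_direction[OF l \<gamma>])
  have ex: "\<exists>\<tau>. a \<le> \<tau> \<and> \<tau> \<le> a + (16 * l / \<epsilon> + 1) \<and> \<bar>?w \<tau> \<bullet> v\<bar> > 1 - \<epsilon>" if e: "\<epsilon> > 0" for a \<epsilon>
  proof (rule ccontr)
    assume con: "\<not> ?thesis"
    define d where "d = 16 * l / \<epsilon> + 1"
    have d: "d > 0" using l e by (simp add: d_def add_pos_pos)
    have le: "\<bar>?w \<tau> \<bullet> v\<bar> \<le> 1 - \<epsilon>" if "\<tau> \<in> {a..a + d}" for \<tau> using con that unfolding d_def[symmetric] by (force simp: not_less)
    have "0 \<le> 1 - \<epsilon>" using le[of a] d by (smt (verit) atLeastAtMost_iff)
    then have "(?b (a + d) - ?b a) \<bullet> v \<le> (1 - \<epsilon>) * (a + d - a)"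
      using d le by (intro frame_inner_bound_displacement[OF l \<gamma>(1)]) auto
    moreover have "(a + d - a) - (?b (a + d) - ?b a) \<bullet> v \<le> 16 * l"
      by (rule v(2)[rule_format]) (use d in simp)
    ultimately have "\<epsilon> * d \<le> 16 * l" by (simp add: algebra_simps)
    moreover have "\<epsilon> * d = 16 * l + \<epsilon>" using e by (simp add: d_def field_simps)
    ultimately show False using e by simp
  qed
  define P where "P = (\<lambda>\<sigma>::real. \<forall>\<epsilon>>0. \<forall>N. \<exists>\<tau>\<ge>N. \<sigma> * (?w \<tau> \<bullet> v) > 1 - \<epsilon>)"
  define P' where "P' = (\<lambda>\<sigma>::real. \<forall>\<epsilon>>0. \<forall>N. \<exists>\<tau>\<le>N. \<sigma> * (?w \<tau> \<bullet> v) > 1 - \<epsilon>)"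
  have "P 1 \<or> P (-1)"
  proof (rule ccontr)
    assume "\<not> ?thesis"
    then obtain \<epsilon>1 N1 \<epsilon>2 N2 where *: "\<epsilon>1 > 0" "\<epsilon>2 > 0" "\<And>\<tau>. \<tau> \<ge> N1 \<Longrightarrow> \<not> (1 * (?w \<tau> \<bullet> v) > 1 - \<epsilon>1)" "\<And>\<tau>. \<tau> \<ge> N2 \<Longrightarrow> \<not> (-1 * (?w \<tau> \<bullet> v) > 1 - \<epsilon>2)"
      unfolding P_def by meson
    obtain \<tau> where "max N1 N2 \<le> \<tau>" "\<bar>?w \<tau> \<bullet> v\<bar> > 1 - min \<epsilon>1 \<epsilon>2" using ex[of "min \<epsilon>1 \<epsilon>2" "max N1 N2"] * by auto
    then show False using *(3)[of \<tau>] *(4)[of \<tau>] by (auto simp: abs_if min_def split: if_splits)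
  qed
  then obtain \<sigma> where \<sigma>: "\<sigma> = 1 \<or> \<sigma> = -1" "P \<sigma>" by blast
  have "P' 1 \<or> P' (-1)"
  proof (rule ccontr)
    assume "\<not> ?thesis"
    then obtain \<epsilon>1 N1 \<epsilon>2 N2 where *: "\<epsilon>1 > 0" "\<epsilon>2 > 0" "\<And>\<tau>. \<tau> \<le> N1 \<Longrightarrow> \<not> (1 * (?w \<tau> \<bullet> v) > 1 - \<epsilon>1)" "\<And>\<tau>. \<tau> \<le> N2 \<Longrightarrow> \<not> (-1 * (?w \<tau> \<bullet> v) > 1 - \<epsilon>2)"
      unfolding P'_def by meson
    obtain \<tau> where "\<tau> \<le> min N1 N2" "\<bar>?w \<tau> \<bullet> v\<bar> > 1 - min \<epsilon>1 \<epsilon>2" 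
      using ex[of "min \<epsilon>1 \<epsilon>2" "min N1 N2 - (16 * l / min \<epsilon>1 \<epsilon>2 + 1)"] * by auto
    then show False using *(3)[of \<tau>] *(4)[of \<tau>] by (auto simp: abs_if min_def split: if_splits)
  qed
  then obtain \<sigma>' where \<sigma>': "\<sigma>' = 1 \<or> \<sigma>' = -1" "P' \<sigma>'" by blast
  show thesis
  proof (rule that[OF \<sigma>'(1) \<sigma>(1)], unfold frame_limits_def, intro allI impI)
    fix \<epsilon> N :: real assume e: "\<epsilon> > 0"
    \<comment> \<open>Unit vectors with inner product above \<open>1 - \<epsilon>'\<close> have
      distance below \<open>\<epsilon> / 2\<close>, since the squared distance is twice the deficit.
      The other half pays for replacing \<open>v\<close> by the chord direction
      \<open>u\<close>.\<close>
    define \<epsilon>' where "\<epsilon>' = (\<epsilon> / 2)\<^sup>2 / 2"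
    have e': "\<epsilon>' > 0" using e by (simp add: \<epsilon>'_def)
    \<comment> \<open>Large enough for \<open>r > 16 * l / \<epsilon>'\<close>, which brings
      \<open>u\<close> close to \<open>v\<close>.\<close>
    define N' where "N' = max \<bar>N\<bar> (16 * l / \<epsilon>') + 16 * l + 1"
    have N': "N' \<ge> N" "N' > 0" using l by (auto simp: N'_def)
    obtain t where t: "t \<ge> N'" "\<sigma> * (?w t \<bullet> v) > 1 - \<epsilon>'" using \<sigma>(2) e' unfolding P_def by blast
    obtain s where s: "s \<le> - N'" "\<sigma>' * (?w s \<bullet> v) > 1 - \<epsilon>'" using \<sigma>'(2) e' unfolding P'_def by blast
    have st: "s \<le> t" using s t N' by linarith
    define r where "r = norm (?b t - ?b s)"
    obtain u where u: "norm u = 1" "?b t - ?b s = r *\<^sub>R u" unfolding r_def by (rule exists_unit_direction)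
    have "t - s \<le> r + 16 * l" unfolding r_def by (rule global_minimizer_displacement[OF l \<gamma> st])
    then have rN: "r \<ge> N" "r > 16 * l / \<epsilon>'" "r > 0" using s(1) t(1) l unfolding N'_def by (auto simp: max_def split: if_splits)
    have rle: "r \<le> t - s" unfolding r_def by (rule infinite_bicycle_path_lipschitz(2)[OF \<gamma>(1) st])
    have "(t - s) - r * (u \<bullet> v) \<le> 16 * l" using v(2) st u(2) by fastforce
    then have "r * (1 - u \<bullet> v) \<le> 16 * l" using rle by (simp add: algebra_simps)
    then have "1 - u \<bullet> v \<le> 16 * l / r" using rN(3) by (simp add: field_simps)
    also have "\<dots> < \<epsilon>'" using rN(2,3) e' by (simp add: field_simps)
    finally have uv: "1 - u \<bullet> v < \<epsilon>'" .
    have small: "norm x < \<epsilon> / 2" if "(norm x)\<^sup>2 < 2 * \<epsilon>'" for x :: plane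
    proof (rule power2_less_imp_less)
      show "(norm x)\<^sup>2 < (\<epsilon> / 2)\<^sup>2" using that by (simp add: \<epsilon>'_def)
    qed (use e in simp)
    have nu: "norm (u - 1 *\<^sub>R v) < \<epsilon> / 2"
      by (rule small) (use uv in \<open>simp add: norm_scaleR_unit_diff[OF u(1) v(1), of 1, simplified]\<close>)
    have nt: "norm (?w t - \<sigma> *\<^sub>R v) < \<epsilon> / 2"
      by (rule small) (use t(2) in \<open>simp add: norm_scaleR_unit_diff[OF norm_frame[OF \<gamma>(1) l] v(1) \<sigma>(1)]\<close>)
    have ns: "norm (?w s - \<sigma>' *\<^sub>R v) < \<epsilon> / 2"
      by (rule small) (use s(2) in \<open>simp add: norm_scaleR_unit_diff[OF norm_frame[OF \<gamma>(1) l] v(1) \<sigma>'(1)]\<close>)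
    have tri: "norm (x - \<tau> *\<^sub>R u) < \<epsilon>" if "norm (x - \<tau> *\<^sub>R v) < \<epsilon> / 2" "\<tau> = 1 \<or> \<tau> = -1" for x \<tau>
    proof -
      have "x - \<tau> *\<^sub>R u = (x - \<tau> *\<^sub>R v) - \<tau> *\<^sub>R (u - 1 *\<^sub>R v)" by (simp add: algebra_simps)
      then have "norm (x - \<tau> *\<^sub>R u) \<le> norm (x - \<tau> *\<^sub>R v) + norm (\<tau> *\<^sub>R (u - 1 *\<^sub>R v))" by (metis norm_triangle_ineq4)
      also have "norm (\<tau> *\<^sub>R (u - 1 *\<^sub>R v)) = norm (u - 1 *\<^sub>R v)" using that(2) by auto
      finally show ?thesis using that(1) nu by linarith
    qed
    show "\<exists>s t r u. s \<le> - N \<and> N \<le> t \<and> s \<le> t \<and> norm u = 1 \<and> fst (\<gamma> t) - fst (\<gamma> s) = r *\<^sub>R u \<and> N \<le> r \<and> 0 \<le> r \<and>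
        norm (frame l \<gamma> s - \<sigma>' *\<^sub>R u) < \<epsilon> \<and> norm (frame l \<gamma> t - \<sigma> *\<^sub>R u) < \<epsilon>"
      using s(1) t(1) N' st u rN tri[OF nt \<sigma>(1)] tri[OF ns \<sigma>'(1)]
      by (intro exI[of _ s] exI[of _ t] exI[of _ r] exI[of _ u]) auto
  qed
qed

section \<open>From small excess to a straight front track\<close>

text \<open>Equality in the triangle inequality makes adjacent chords parallel; comparison with the
  chord from 0 to 1 gives the formula for the line.\<close>

lemma unit_speed_lineI:
  fixes f :: "real \<Rightarrow> plane"
  assumes d: "\<And>a b. a \<le> b \<Longrightarrow> norm (f b - f a) = b - a"
  shows "unit_speed_line f"
proof -
  have tri: "(b - a) *\<^sub>R (f c - f b) = (c - b) *\<^sub>R (f b - f a)" if "a \<le> b" "b \<le> c" for a b c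
  proof -
    have "norm ((f b - f a) + (f c - f b)) = norm (f b - f a) + norm (f c - f b)"
      using d[of a b] d[of b c] d[of a c] that by simp
    then show ?thesis unfolding norm_triangle_eq using d that by simp
  qed
  have "f t = f 0 + t *\<^sub>R (f 1 - f 0)" for t
  proof -
    consider "t \<le> 0" | "0 \<le> t" "t \<le> 1" | "1 \<le> t" by linarith
    then show ?thesis
    proof cases
      case 1
      then show ?thesis using tri[of t 0 1] by (simp add: algebra_simps)
    next
      case 2
      then show ?thesis using tri[of 0 t 1] by (simp add: algebra_simps)
    next
      case 3
      then show ?thesis using tri[of 0 1 t] by (simp add: algebra_simps)
    qed
  qed
  moreover have "norm (f 1 - f 0) = 1" using d[of 0 1] by simp
  ultimately show ?thesis unfolding unit_speed_line_def by blast
qed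

lemma front_straight_if_excess_small:
  assumes \<gamma>: "infinite_bicycle_path l \<gamma>"
    and ex: "\<And>\<epsilon> N. \<epsilon> > 0 \<Longrightarrow> \<exists>s t. s \<le> - N \<and> N \<le> t \<and> t - s \<le> norm (snd (\<gamma> t) - snd (\<gamma> s)) + \<epsilon>"
  shows "unit_speed_line (front_track \<gamma>)"
proof (rule unit_speed_lineI)
  fix a b :: real assume ab: "a \<le> b"
  let ?f = "\<lambda>t. snd (\<gamma> t)"
  have "b - a \<le> norm (?f b - ?f a)"
  proof (rule field_le_epsilon)
    fix \<epsilon> :: real assume "\<epsilon> > 0"
    then obtain s t where st: "s \<le> - max \<bar>a\<bar> \<bar>b\<bar>" "max \<bar>a\<bar> \<bar>b\<bar> \<le> t" "t - s \<le> norm (?f t - ?f s) + \<epsilon>" using ex by blast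
    have "(b - a) - norm (?f b - ?f a) \<le> (t - s) - norm (?f t - ?f s)"
      by (rule excess_mono[OF infinite_bicycle_path_lipschitz(1)[OF \<gamma>] _ ab]) (use st in auto)
    then show "b - a \<le> norm (?f b - ?f a) + \<epsilon>" using st(3) by linarith
  qed
  then show "norm (front_track \<gamma> b - front_track \<gamma> a) = b - a"
    using infinite_bicycle_path_lipschitz(1)[OF \<gamma> ab] by (simp add: front_track_def)
qed

text \<open>Project to \<open>u\<close>: the front displacement is the back displacement plus
  \<open>l\<close> times the change of the frame, whose component along \<open>u\<close> is nearly
  \<open>\<sigma> - \<sigma>'\<close>.\<close>

lemma front_displacement_ge:
  assumes l: "l > 0" and u: "norm u = 1" "fst (\<gamma> t) - fst (\<gamma> s) = r *\<^sub>R u"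
    and w: "norm (frame l \<gamma> s - \<sigma>' *\<^sub>R u) < \<epsilon>" "norm (frame l \<gamma> t - \<sigma> *\<^sub>R u) < \<epsilon>"
  shows "r + l * (\<sigma> - \<sigma>') - 2 * l * \<epsilon> \<le> norm (snd (\<gamma> t) - snd (\<gamma> s))"
proof -
  let ?w = "frame l \<gamma>"
  have uu: "u \<bullet> u = 1" by (rule norm1_inner[OF u(1)])
  have i: "\<bar>(?w x - \<tau> *\<^sub>R u) \<bullet> u\<bar> \<le> norm (?w x - \<tau> *\<^sub>R u)" for x \<tau>
    using Cauchy_Schwarz_ineq2[of "?w x - \<tau> *\<^sub>R u" u] u(1) by simp
  have "snd (\<gamma> t) - snd (\<gamma> s) = (fst (\<gamma> t) - fst (\<gamma> s)) + l *\<^sub>R (?w t - ?w s)"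
    unfolding front_eq_frame[OF l] by (simp add: algebra_simps)
  then have "(snd (\<gamma> t) - snd (\<gamma> s)) \<bullet> u = r + l * (?w t \<bullet> u - ?w s \<bullet> u)"
    using uu u(2) by (simp add: inner_add_left inner_diff_left)
  moreover have "(snd (\<gamma> t) - snd (\<gamma> s)) \<bullet> u \<le> norm (snd (\<gamma> t) - snd (\<gamma> s))"
    using norm_cauchy_schwarz[of "snd (\<gamma> t) - snd (\<gamma> s)" u] u(1) by simp
  moreover have "?w t \<bullet> u - ?w s \<bullet> u \<ge> \<sigma> - \<sigma>' - 2 * \<epsilon>"
    using i[of t \<sigma>] i[of s \<sigma>'] w uu by (simp add: inner_diff_left)
  then have "l * (?w t \<bullet> u - ?w s \<bullet> u) \<ge> l * (\<sigma> - \<sigma>' - 2 * \<epsilon>)" using l by (intro mult_left_mono) auto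
  ultimately show ?thesis by (simp add: algebra_simps)
qed

lemma front_straight_constant_sign:
  assumes l: "l > 0" and \<gamma>: "infinite_bicycle_path l \<gamma>" "global_minimizer l \<gamma>" and \<sigma>: "\<sigma> = 1 \<or> \<sigma> = (-1::real)"
    and as: "frame_limits l \<gamma> \<sigma> \<sigma>"
  shows "unit_speed_line (front_track \<gamma>)"
proof (rule front_straight_if_excess_small[OF \<gamma>(1)])
  fix \<epsilon> N :: real assume e: "\<epsilon> > 0"
  \<comment> \<open>Two turns of cost \<open>4 * l * \<epsilon>'\<close> and the loss
    \<open>2 * l * \<epsilon>'\<close> in the front displacement.\<close>
  define \<epsilon>' where "\<epsilon>' = \<epsilon> / (10 * l)"
  have e': "\<epsilon>' > 0" "10 * l * \<epsilon>' = \<epsilon>" using e l by (auto simp: \<epsilon>'_def)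
  obtain s t r u where st: "s \<le> - N" "N \<le> t" "s \<le> t" "norm u = 1" "fst (\<gamma> t) - fst (\<gamma> s) = r *\<^sub>R u" "0 \<le> r"
     "norm (frame l \<gamma> s - \<sigma> *\<^sub>R u) < \<epsilon>'" "norm (frame l \<gamma> t - \<sigma> *\<^sub>R u) < \<epsilon>'" using as e'(1) unfolding frame_limits_def by metis
  have "t - s \<le> r + 4 * l * (norm (frame l \<gamma> s - \<sigma> *\<^sub>R u) + norm (frame l \<gamma> t - \<sigma> *\<^sub>R u))"
    by (rule global_minimizer_bound_straight[OF l \<gamma> st(3,4) \<sigma> st(5,6)])
  also have "\<dots> \<le> r + 4 * l * (\<epsilon>' + \<epsilon>')" using l st by (intro add_mono mult_left_mono order_refl) auto
  also have "\<dots> = r + l * (\<sigma> - \<sigma>) - 2 * l * \<epsilon>' + \<epsilon>" using e'(2) by (simp add: algebra_simps)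
  also have "\<dots> \<le> norm (snd (\<gamma> t) - snd (\<gamma> s)) + \<epsilon>"
    using front_displacement_ge[OF l st(4,5,7,8)] by simp
  finally show "\<exists>s t. s \<le> - N \<and> N \<le> t \<and> t - s \<le> norm (snd (\<gamma> t) - snd (\<gamma> s)) + \<epsilon>" using st by blast
qed

text \<open>The tractrix ride has length at most \<open>r + 2 * l\<close>, and this is the front
  displacement up to a small error, because the frame changes from about \<open>- u\<close> to about
  \<open>u\<close>. A straight ride would not do: the half turn needed in addition costs
  \<open>pi * l\<close>, more than the available \<open>2 * l\<close>.\<close>

lemma front_straight_turning:
  assumes l: "l > 0" and \<gamma>: "infinite_bicycle_path l \<gamma>" "global_minimizer l \<gamma>"
    and as: "frame_limits l \<gamma> (-1) 1"
  shows "unit_speed_line (front_track \<gamma>)"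
proof (rule front_straight_if_excess_small[OF \<gamma>(1)])
  fix \<epsilon> N :: real assume e: "\<epsilon> > 0"
  \<comment> \<open>Here each turn spans up to \<open>2 * \<epsilon>'\<close>, as both the frame and
    the end frame of the tractrix ride are only \<open>\<epsilon>'\<close>-close to the asymptotic
    direction: 16 + 2 = 18.\<close>
  define \<epsilon>' where "\<epsilon>' = \<epsilon> / (18 * l)"
  have e': "\<epsilon>' > 0" "18 * l * \<epsilon>' = \<epsilon>" using e l by (auto simp: \<epsilon>'_def)
  \<comment> \<open>The squared distance of the end frame from \<open>u\<close> is
    \<open>2 * (1 - tanh (M / l))\<close>. The factor \<open>2 * l\<close> at \<open>R\<close> below
    comes from \<open>r / 2 \<le> M\<close>.\<close>
  have "eventually (\<lambda>x. tanh x > 1 - \<epsilon>'\<^sup>2 / 2) (at_top :: real filter)"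
    using order_tendstoD(1)[OF tanh_real_at_top, of "1 - \<epsilon>'\<^sup>2 / 2"] e'(1) by simp
  then obtain R where R: "\<And>x. x \<ge> R \<Longrightarrow> tanh x > 1 - \<epsilon>'\<^sup>2 / (2::real)" by (auto simp: eventually_at_top_linorder)
  obtain s t r u where st: "s \<le> - max N (2 * l * R)" "max N (2 * l * R) \<le> t" "s \<le> t" "norm u = 1" "fst (\<gamma> t) - fst (\<gamma> s) = r *\<^sub>R u" "0 \<le> r"
     "norm (frame l \<gamma> s - (-1) *\<^sub>R u) < \<epsilon>'" "norm (frame l \<gamma> t - 1 *\<^sub>R u) < \<epsilon>'" "max N (2 * l * R) \<le> r" using as e'(1) unfolding frame_limits_def by metis
  obtain M where M: "M \<ge> 0" "2 * M - 2 * l * tanh (M / l) = r" "r / 2 \<le> M" "2 * M \<le> r + 2 * l"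
    by (rule tractrix_half_length_exists[OF l st(6)])
  let ?T = "tanh (M / l)" and ?S = "1 / cosh (M / l)"
  let ?ws = "- ?T *\<^sub>R u + ?S *\<^sub>R rot u" and ?wt = "?T *\<^sub>R u + ?S *\<^sub>R rot u"
  have u: "norm (rot u) = 1" "u \<bullet> rot u = 0" using st(4) by simp_all
  have "R \<le> M / l" using st(9) M(3) l by (simp add: field_simps)
  then have T: "1 - ?T < \<epsilon>'\<^sup>2 / 2" using R[of "M / l"] by simp
  have sq: "(?T - 1)\<^sup>2 + ?S\<^sup>2 = 2 * (1 - ?T)"
    using tanh_sech_square[of "M / l"] by (simp add: power2_eq_square algebra_simps)
  have "(norm (?wt - u))\<^sup>2 = (?T - 1)\<^sup>2 + ?S\<^sup>2"
    using norm_orthonormal[OF st(4) u, of "?T - 1" ?S] by (simp add: algebra_simps)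
  then have "(norm (?wt - u))\<^sup>2 < \<epsilon>'\<^sup>2" using sq T by simp
  then have w1: "norm (?wt - u) < \<epsilon>'" using e' by (intro power2_less_imp_less[of "norm (?wt - u)"]) auto
  have "(norm (?ws + u))\<^sup>2 = (1 - ?T)\<^sup>2 + ?S\<^sup>2"
    using norm_orthonormal[OF st(4) u, of "1 - ?T" ?S] by (simp add: algebra_simps)
  then have "(norm (?ws + u))\<^sup>2 < \<epsilon>'\<^sup>2" using sq T by (simp add: power2_commute)
  then have w0: "norm (?ws + u) < \<epsilon>'" using e' by (intro power2_less_imp_less[of "norm (?ws + u)"]) auto
  have d0: "norm (frame l \<gamma> s - ?ws) \<le> 2 * \<epsilon>'"
  proof -
    have e: "frame l \<gamma> s - ?ws = (frame l \<gamma> s - (-1) *\<^sub>R u) - (?ws + u)" by simp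
    show ?thesis unfolding e using norm_triangle_ineq4[of "frame l \<gamma> s - (-1) *\<^sub>R u" "?ws + u"] st(7) w0 by linarith
  qed
  have d1: "norm (frame l \<gamma> t - ?wt) \<le> 2 * \<epsilon>'"
  proof -
    have e: "frame l \<gamma> t - ?wt = (frame l \<gamma> t - 1 *\<^sub>R u) - (?wt - u)" by simp
    show ?thesis unfolding e using norm_triangle_ineq4[of "frame l \<gamma> t - 1 *\<^sub>R u" "?wt - u"] st(8) w1 by linarith
  qed
  have "t - s \<le> 2 * M + 4 * l * (norm (frame l \<gamma> s - ?ws) + norm (frame l \<gamma> t - ?wt))"
    using global_minimizer_bound_tractrix[OF l \<gamma> st(3,4) u M(1)] st(5) M(2) by simp
  also have "\<dots> \<le> r + 2 * l + 4 * l * (2 * \<epsilon>' + 2 * \<epsilon>')" using l d0 d1 M(4) by (intro add_mono mult_left_mono) auto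
  also have "\<dots> = r + l * (1 - (-1)) - 2 * l * \<epsilon>' + \<epsilon>" using e'(2) by (simp add: algebra_simps)
  also have "\<dots> \<le> norm (snd (\<gamma> t) - snd (\<gamma> s)) + \<epsilon>"
    using front_displacement_ge[OF l st(4,5,7,8)] by simp
  finally show "\<exists>s t. s \<le> - N \<and> N \<le> t \<and> t - s \<le> norm (snd (\<gamma> t) - snd (\<gamma> s)) + \<epsilon>" using st by (intro exI[of _ s] exI[of _ t]) auto
qed

theorem global_minimizer_straight_front:
  assumes l: "l > 0" and \<gamma>: "infinite_bicycle_path l \<gamma>" "global_minimizer l \<gamma>"
  shows "unit_speed_line (front_track \<gamma>) \<or> unit_speed_line (front_track (flip \<circ> \<gamma>))"
proof -
  obtain \<sigma>' \<sigma> where \<sigma>: "\<sigma>' = 1 \<or> \<sigma>' = (-1::real)" "\<sigma> = 1 \<or> \<sigma> = (-1::real)"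
    and as: "frame_limits l \<gamma> \<sigma>' \<sigma>"
    by (rule global_minimizer_asymptotics[OF l \<gamma>])
  consider "\<sigma>' = \<sigma>" | "\<sigma>' = -1" "\<sigma> = 1" | "\<sigma>' = 1" "\<sigma> = -1" using \<sigma> by auto
  then show ?thesis
  proof cases
    case 1
    then show ?thesis using front_straight_constant_sign[OF l \<gamma> \<sigma>(2)] as by simp
  next
    case 2
    then show ?thesis using front_straight_turning[OF l \<gamma>] as by simp
  next
    \<comment> \<open>Flipping negates the frame and keeps the back track, so both signs
      change.\<close>
    case 3
    have "norm (frame l (flip \<circ> \<gamma>) x - (- \<tau>) *\<^sub>R u) = norm (frame l \<gamma> x - \<tau> *\<^sub>R u)" for x \<tau> u
    proof -
      have "frame l (flip \<circ> \<gamma>) x - (- \<tau>) *\<^sub>R u = - (frame l \<gamma> x - \<tau> *\<^sub>R u)" by (simp add: frame_flip)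
      then show ?thesis by (simp only: norm_minus_cancel)
    qed
    from this[of _ 1] this[of _ "-1"] have "frame_limits l (flip \<circ> \<gamma>) (-1) 1"
      using as unfolding 3 frame_limits_def by simp
    then show ?thesis
      using front_straight_turning[OF l infinite_bicycle_path_flip[OF \<gamma>(1)] global_minimizer_flip[OF \<gamma>]] by blast
  qed
qed

subsection \<open>Straight front tracks\<close>

text \<open>A gain of regularity: the curve is the integral of its almost everywhere derivative, and
  where that agrees with a continuous \<open>F\<close>, the integral is differentiable at every
  time.\<close>

lemma abs_continuous_continuous_derivative:
  fixes g :: "real \<Rightarrow> 'a::banach"
  assumes g: "\<And>a b. a \<le> b \<Longrightarrow> abs_continuous_on a b g" and N: "negligible N"
    and F: "continuous_on UNIV F" "\<And>t. t \<notin> N \<Longrightarrow> (g has_vector_derivative F t) (at t)"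
  shows "(g has_vector_derivative F t) (at t)"
proof -
  let ?a = "t - 1" and ?b = "t + 1"
  have eq: "g u = g ?a + integral {?a..u} F" if "u \<in> {?a..?b}" for u
  proof -
    have "(F has_integral (g u - g ?a)) {?a..u}"
      using that F(2) by (intro fundamental_theorem_of_calculus_abs_continuous[OF _ g N]) (auto intro: has_vector_derivative_at_within)
    then show ?thesis by (simp add: integral_unique)
  qed
  have "((\<lambda>u. integral {?a..u} F) has_vector_derivative F t) (at t within {?a..?b})"
    by (rule integral_has_vector_derivative[OF continuous_on_subset[OF F(1)]]) auto
  then have "((\<lambda>u. g ?a + integral {?a..u} F) has_vector_derivative 0 + F t) (at t within {?a..?b})"
    by (intro has_vector_derivative_add has_vector_derivative_const)
  then have "(g has_vector_derivative F t) (at t within {?a..?b})"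
    using has_vector_derivative_transform[of t "{?a..?b}" g, OF _ eq] by simp
  moreover have "at t within {?a..?b} = at t" by (intro at_within_Icc_at) auto
  ultimately show ?thesis by simp
qed

lemma frame_continuous:
  assumes "l > 0" "infinite_bicycle_path l \<gamma>"
  shows "continuous_on UNIV (frame l \<gamma>)" "continuous_on UNIV (\<lambda>t. fst (\<gamma> t))" "continuous_on UNIV (\<lambda>t. snd (\<gamma> t))"
proof -
  have loc: "continuous_on UNIV g" if g: "\<And>a b. a \<le> b \<Longrightarrow> norm (g b - g a) \<le> b - a" for g :: "real \<Rightarrow> plane"
  proof -
    have "1-lipschitz_on UNIV g"
    proof (rule lipschitz_onI)
      fix x y :: real
      show "dist (g x) (g y) \<le> 1 * dist x y"
        using g[of x y] g[of y x] by (cases "x \<le> y") (auto simp: dist_norm norm_minus_commute)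
    qed simp
    then show ?thesis by (rule lipschitz_on_continuous_on)
  qed
  show b: "continuous_on UNIV (\<lambda>t. fst (\<gamma> t))" and f: "continuous_on UNIV (\<lambda>t. snd (\<gamma> t))"
    by (rule loc, rule infinite_bicycle_path_lipschitz[OF assms(2)], simp)+
  show "continuous_on UNIV (frame l \<gamma>)"
    unfolding frame_def by (intro continuous_intros b f)
qed

text \<open>The steering equation holds almost everywhere by the projection rule for the back
  velocity; its right-hand side is continuous in \<open>t\<close>, so it holds at all times.\<close>

lemma straight_front_frame_derivative:
  assumes l: "l > 0" and \<gamma>: "infinite_bicycle_path l \<gamma>"
    and v: "norm v = 1" "\<And>t. snd (\<gamma> t) = p + t *\<^sub>R v"
  defines "w \<equiv> frame l \<gamma>"
  shows "(w has_vector_derivative (1 / l) *\<^sub>R (v - (v \<bullet> w t) *\<^sub>R w t)) (at t)"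
proof -
  obtain N c f' where "rolling_velocities l \<gamma> N c f'"
    by (rule infinite_bicycle_path_ae[OF \<gamma>])
  note N = rolling_velocitiesD[OF this]
  have lw: "snd (\<gamma> t) - fst (\<gamma> t) = l *\<^sub>R w t" for t using l by (simp add: w_def frame_def)
  have dsnd: "((\<lambda>s. snd (\<gamma> s)) has_vector_derivative v) (at t)" for t
    using has_vector_derivative_add[OF has_vector_derivative_const[of p] has_vector_derivative_scaleR_const[of "\<lambda>t. t" 1 t UNIV v]]
    unfolding v(2) by simp
  show ?thesis
  proof (rule abs_continuous_continuous_derivative[OF _ N(1)])
    fix a b :: real assume ab: "a \<le> b"
    show "abs_continuous_on a b w"
    proof (rule abs_continuous_on_dominated2[OF infinite_bicycle_path_abs_continuous[OF \<gamma> ab]])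
      fix x y
      have "w x - w y = (1 / l) *\<^sub>R ((snd (\<gamma> x) - snd (\<gamma> y)) - (fst (\<gamma> x) - fst (\<gamma> y)))"
        by (simp add: w_def frame_def algebra_simps)
      then have "norm (w x - w y) = (1 / l) * norm ((snd (\<gamma> x) - snd (\<gamma> y)) - (fst (\<gamma> x) - fst (\<gamma> y)))" using l by simp
      also have "\<dots> \<le> (1 / l) * (norm (snd (\<gamma> x) - snd (\<gamma> y)) + norm (fst (\<gamma> x) - fst (\<gamma> y)))"
        using l by (intro mult_left_mono norm_triangle_ineq4) auto
      finally show "dist (w x) (w y) \<le> (1 / l) * dist (fst (\<gamma> x)) (fst (\<gamma> y)) + (1 / l) * dist (snd (\<gamma> x)) (snd (\<gamma> y))"
        by (simp add: dist_norm algebra_simps)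
    qed
  next
    show "continuous_on UNIV (\<lambda>t. (1 / l) *\<^sub>R (v - (v \<bullet> w t) *\<^sub>R w t))"
      unfolding w_def by (intro continuous_intros frame_continuous[OF l \<gamma>])
  next
    fix t assume t: "t \<notin> N"
    then have "f' t = v" using N(2) dsnd vector_derivative_unique_at by blast
    then have "c t * l\<^sup>2 = l * (v \<bullet> w t)" using N(2) t unfolding lw by (simp add: inner_commute)
    then have ct: "c t * l = v \<bullet> w t" using l by (simp add: power2_eq_square)
    have "((\<lambda>s. snd (\<gamma> s) - fst (\<gamma> s)) has_vector_derivative v - c t *\<^sub>R (l *\<^sub>R w t)) (at t)"
      using N(2) t unfolding lw[symmetric] by (intro has_vector_derivative_diff dsnd) auto
    then have "(w has_vector_derivative (1 / l) *\<^sub>R (v - c t *\<^sub>R (l *\<^sub>R w t))) (at t)"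
      unfolding w_def frame_def[abs_def] by (rule bounded_linear.has_vector_derivative[OF bounded_linear_scaleR_right])
    then show "(w has_vector_derivative (1 / l) *\<^sub>R (v - (v \<bullet> w t) *\<^sub>R w t)) (at t)" using ct by simp
  qed
qed

text \<open>For two solutions \<open>w1\<close>, \<open>w2\<close> on the unit circle, \<open>D = 1 - w1 \<bullet> w2\<close> satisfies the linear equation
  \<open>D' = - (v \<bullet> w1 + v \<bullet> w2) / l * D\<close>.\<close>

lemma steering_equation_unique:
  fixes w1 w2 :: "real \<Rightarrow> 'a::real_inner"
  assumes l: "l > 0" and v: "norm v = 1" and n: "\<And>t. norm (w1 t) = 1" "\<And>t. norm (w2 t) = 1"
    and d: "\<And>t. (w1 has_vector_derivative (1 / l) *\<^sub>R (v - (v \<bullet> w1 t) *\<^sub>R w1 t)) (at t)"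
       "\<And>t. (w2 has_vector_derivative (1 / l) *\<^sub>R (v - (v \<bullet> w2 t) *\<^sub>R w2 t)) (at t)"
    and 0: "w1 0 = w2 0"
  shows "w1 t = w2 t"
proof -
  let ?D = "\<lambda>t. 1 - w1 t \<bullet> w2 t"
  let ?k = "\<lambda>t. (v \<bullet> w1 t + v \<bullet> w2 t) / l"
  have D: "(?D has_real_derivative - (?k t * ?D t)) (at t)" for t
  proof -
    let ?u1 = "(1 / l) *\<^sub>R (v - (v \<bullet> w1 t) *\<^sub>R w1 t)" and ?u2 = "(1 / l) *\<^sub>R (v - (v \<bullet> w2 t) *\<^sub>R w2 t)"
    have "((\<lambda>t. w1 t \<bullet> w2 t) has_vector_derivative w1 t \<bullet> ?u2 + ?u1 \<bullet> w2 t) (at t)"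
      by (rule bounded_bilinear.has_vector_derivative[OF bounded_bilinear_inner d])
    then have "(?D has_vector_derivative 0 - (w1 t \<bullet> ?u2 + ?u1 \<bullet> w2 t)) (at t)"
      by (intro has_vector_derivative_diff has_vector_derivative_const)
    moreover have "0 - (w1 t \<bullet> ?u2 + ?u1 \<bullet> w2 t) = - (?k t * ?D t)"
      using l by (simp add: inner_diff_left inner_diff_right inner_commute field_simps)
    ultimately show ?thesis by (simp add: has_real_derivative_iff_has_vector_derivative)
  qed
  have b: "\<bar>v \<bullet> w1 t\<bar> \<le> 1" "\<bar>v \<bullet> w2 t\<bar> \<le> 1" for t
    using Cauchy_Schwarz_ineq2[of v "w1 t"] Cauchy_Schwarz_ineq2[of v "w2 t"] n v by simp_all
  have Dpos: "?D t \<ge> 0" for t using norm_cauchy_schwarz[of "w1 t" "w2 t"] n by simp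
  have D0: "?D 0 = 0" using 0 norm1_inner[OF n(1)[of 0]] by simp
  \<comment> \<open>Integrating factors for the linear equation of \<open>?D\<close>: as
    \<open>\<bar>?k t\<bar> \<le> 2 / l\<close>, the choice \<open>m = -2\<close> makes the product
    nonincreasing, for use at positive times, and \<open>m = 2\<close> nondecreasing, for negative
    times.\<close>
  have E: "((\<lambda>t. ?D t * exp (m * t / l)) has_real_derivative ?D t * exp (m * t / l) * (m / l - ?k t)) (at t)" for m t
  proof -
    have "((\<lambda>t. exp (m * t / l)) has_real_derivative exp (m * t / l) * (m / l)) (at t)"
      using l by (auto intro!: derivative_eq_intros)
    moreover have "- (k * d) * x + x * q * d = d * x * (q - k)" for k d x q :: real by (simp add: algebra_simps)
    ultimately show ?thesis by (rule DERIV_cong[OF DERIV_mult[OF D]])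
  qed
  have "?D t \<le> 0"
  proof (cases "0 \<le> t")
    case True
    have "?D 0 * exp (-2 * 0 / l) \<ge> ?D t * exp (-2 * t / l)"
    proof (rule DERIV_nonpos_imp_nonincreasing[OF True, of "\<lambda>t. ?D t * exp (-2 * t / l)"])
      fix x
      have "-2 / l - ?k x = - ((2 + v \<bullet> w1 x + v \<bullet> w2 x) / l)" by (simp add: add_divide_distrib)
      moreover have "(2 + v \<bullet> w1 x + v \<bullet> w2 x) / l \<ge> 0" using b[of x] l by (intro divide_nonneg_pos) (auto simp: abs_le_iff)
      ultimately have "-2 / l - ?k x \<le> 0" by linarith
      then have "?D x * exp (-2 * x / l) * (-2 / l - ?k x) \<le> 0"
        using Dpos[of x] by (intro mult_nonneg_nonpos mult_nonneg_nonneg) auto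
      then show "\<exists>y. ((\<lambda>t. ?D t * exp (-2 * t / l)) has_real_derivative y) (at x) \<and> y \<le> 0" using E[of "-2" x] by blast
    qed
    then have "?D t * exp (-2 * t / l) \<le> 0" unfolding D0 by simp
    then show ?thesis by (simp add: mult_le_0_iff not_le[symmetric])
  next
    case False
    have "?D t * exp (2 * t / l) \<le> ?D 0 * exp (2 * 0 / l)"
    proof (rule DERIV_nonneg_imp_nondecreasing[of t 0 "\<lambda>t. ?D t * exp (2 * t / l)"])
      fix x
      have "2 / l - ?k x \<ge> 0" using b[of x] l by (simp add: diff_divide_distrib[symmetric])
      then have "?D x * exp (2 * x / l) * (2 / l - ?k x) \<ge> 0"
        using Dpos[of x] by (intro mult_nonneg_nonneg) auto
      then show "\<exists>y. ((\<lambda>t. ?D t * exp (2 * t / l)) has_real_derivative y) (at x) \<and> y \<ge> 0" using E[of 2 x] by blast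
    qed (use False in simp)
    then have "?D t * exp (2 * t / l) \<le> 0" unfolding D0 by simp
    then show ?thesis by (simp add: mult_le_0_iff not_le[symmetric])
  qed
  then have "w1 t \<bullet> w2 t = 1" using Dpos[of t] by simp
  then have "(w1 t - w2 t) \<bullet> (w1 t - w2 t) = 0"
    using norm1_inner[OF n(1)[of t]] norm1_inner[OF n(2)[of t]] by (simp add: inner_diff_left inner_diff_right inner_commute)
  then show ?thesis by simp
qed

lemma tanh_surj:
  fixes x :: real
  assumes "\<bar>x\<bar> < 1"
  obtains z where "tanh z = x"
proof -
  let ?X = "(1 + x) / (1 - x)"
  have X: "?X > 0" using assms by (auto intro!: divide_pos_pos)
  then have s: "(sqrt ?X)\<^sup>2 = ?X" by simp
  have "tanh (ln (sqrt ?X)) = ((sqrt ?X)\<^sup>2 - 1) / ((sqrt ?X)\<^sup>2 + 1)"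
    using X by (intro tanh_ln_real) simp
  also have "\<dots> = x" unfolding s using assms by (simp add: field_simps)
  finally show thesis using that by blast
qed

text \<open>The steering equation has the equilibria \<open>v\<close> and \<open>- v\<close>. Any
  other start is a point of a tractrix solution: the component along \<open>v\<close> is
  \<open>tanh z\<close>, which fixes the time shift \<open>a = - l * z\<close>, and the sign of the
  component along \<open>rot v\<close> selects the side.\<close>

lemma straight_front_cases:
  assumes l: "l > 0" and \<gamma>: "infinite_bicycle_path l \<gamma>"
    and v: "norm v = 1" "\<And>t. snd (\<gamma> t) = p + t *\<^sub>R v"
  obtains \<sigma> where "\<sigma> = 1 \<or> \<sigma> = (-1::real)" "\<And>t. frame l \<gamma> t = \<sigma> *\<^sub>R v"
  | \<sigma> a where "\<sigma> = 1 \<or> \<sigma> = (-1::real)" "\<And>t. frame l \<gamma> t = tractrix_frame l v (\<sigma> *\<^sub>R rot v) a t"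
proof -
  let ?w = "frame l \<gamma>"
  have n: "norm (?w t) = 1" for t by (rule norm_frame[OF \<gamma> l])
  have d: "(?w has_vector_derivative (1 / l) *\<^sub>R (v - (v \<bullet> ?w t) *\<^sub>R ?w t)) (at t)" for t
    by (rule straight_front_frame_derivative[OF l \<gamma> v])
  define x where "x = ?w 0 \<bullet> v"
  define y where "y = ?w 0 \<bullet> rot v"
  have w0: "?w 0 = x *\<^sub>R v + y *\<^sub>R rot v" unfolding x_def y_def by (rule rot_decompose[OF v(1)])
  have xy: "x\<^sup>2 + y\<^sup>2 = 1" using norm_rot_frame[OF v(1), of x y] n[of 0] unfolding w0[symmetric] by simp
  show thesis
  proof (cases "y = 0")
    case True
    then have x: "x = 1 \<or> x = -1" using xy by (simp add: power2_eq_1_iff)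
    have "?w t = x *\<^sub>R v" for t
    proof (rule steering_equation_unique[OF l v(1) n _ d])
      show "((\<lambda>t. x *\<^sub>R v) has_vector_derivative (1 / l) *\<^sub>R (v - (v \<bullet> x *\<^sub>R v) *\<^sub>R x *\<^sub>R v)) (at t)" for t
      proof -
        have eq: "(1 / l) *\<^sub>R (v - (v \<bullet> x *\<^sub>R v) *\<^sub>R x *\<^sub>R v) = 0" using x norm1_inner[OF v(1)] by auto
        show ?thesis unfolding eq by (rule has_vector_derivative_const)
      qed
    qed (use x v w0 True in auto)
    then show thesis using that(1) x by blast
  next
    case False
    define \<sigma> :: real where "\<sigma> = (if y > 0 then 1 else -1)"
    have \<sigma>: "\<sigma> = 1 \<or> \<sigma> = -1" "\<bar>y\<bar> * \<sigma> = y" using False by (auto simp: \<sigma>_def)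
    have "y\<^sup>2 > 0" using False by simp
    then have "x\<^sup>2 < 1" using xy by linarith
    then have "\<bar>x\<bar> < 1" by (simp add: abs_square_less_1)
    then obtain z where z: "tanh z = x" by (rule tanh_surj)
    have "(1 / cosh z)\<^sup>2 = \<bar>y\<bar>\<^sup>2" using tanh_sech_square[of z] z xy by simp
    then have sech: "1 / cosh z = \<bar>y\<bar>" using cosh_real_pos[of z] by (subst (asm) power2_eq_iff_nonneg) auto
    define a where "a = - l * z"
    have az: "(0 - a) / l = z" using l by (simp add: a_def)
    let ?h = "\<sigma> *\<^sub>R rot v"
    have h: "norm ?h = 1" "v \<bullet> ?h = 0" using v \<sigma> by auto
    have "?w t = tractrix_frame l v ?h a t" for t
    proof (rule steering_equation_unique[OF l v(1) n norm_tractrix_frame[OF v(1) h] d tractrix_frame_derivative[OF l v(1) h]])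
      show "?w 0 = tractrix_frame l v ?h a 0"
        unfolding tractrix_frame_def az z sech w0 using \<sigma>(2) by simp
    qed
    then show thesis using that(2)[OF \<sigma>(1)] by blast
  qed
qed

text \<open>The model tractrix in an orthonormal frame: \<open>P\<close> is the foot of the cusp on
  the asymptote, \<open>e\<close> the direction of the asymptote, and \<open>h\<close> points from
  the asymptote to the cusp.\<close>

definition tractrix_curve :: "real \<Rightarrow> plane \<Rightarrow> plane \<Rightarrow> plane \<Rightarrow> real \<Rightarrow> plane" where
  "tractrix_curve l P e h s = P + (s - l * tanh (s / l)) *\<^sub>R e + (l / cosh (s / l)) *\<^sub>R h"

text \<open>An isometry of the plane is an orthogonal map followed by a translation, so only the
  images \<open>e\<close>, \<open>h\<close> of the axis vectors and \<open>P\<close> of the origin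
  matter.\<close>

lemma is_tractrix_iff:
  "is_tractrix l S \<longleftrightarrow> (\<exists>P e h. norm e = 1 \<and> norm h = 1 \<and> e \<bullet> h = 0 \<and> S = range (tractrix_curve l P e h))"
proof
  assume "is_tractrix l S"
  then obtain g :: "plane \<Rightarrow> plane" where g: "\<forall>x y. dist (g x) (g y) = dist x y"
    "S = g ` range (\<lambda>t::real. vector [t - l * tanh (t / l), l / cosh (t / l)])"
    unfolding is_tractrix_def by blast
  define G where "G = (\<lambda>x. g x - g 0)"
  have G: "orthogonal_transformation G"
    unfolding orthogonal_transformation_isometry using g(1) by (simp add: G_def dist_norm)
  let ?e = "G (axis 1 1)" and ?h = "G (axis 2 1)"
  have lin: "linear G" using G by (rule orthogonal_transformation_linear)
  have vec: "vector [x, y] = x *\<^sub>R axis 1 1 + y *\<^sub>R (axis 2 1 :: plane)" for x y :: real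
    by (simp add: vec_eq_iff forall_2 axis_def)
  have "g (vector [x, y]) = g 0 + x *\<^sub>R ?e + y *\<^sub>R ?h" for x y
  proof -
    have "g (vector [x, y]) = g 0 + G (x *\<^sub>R axis 1 1 + y *\<^sub>R axis 2 1)" using vec[of x y] by (simp add: G_def)
    also have "\<dots> = g 0 + (x *\<^sub>R ?e + y *\<^sub>R ?h)" by (simp only: linear_add[OF lin] linear_scale[OF lin])
    finally show ?thesis by (simp only: add.assoc)
  qed
  then have "S = range (tractrix_curve l (g 0) ?e ?h)"
    unfolding g(2) tractrix_curve_def by (simp add: image_image)
  moreover have "norm ?e = 1" "norm ?h = 1" using orthogonal_transformation_norm[OF G] by (simp_all add: norm_axis_1)
  moreover have "?e \<bullet> ?h = 0" using G by (simp add: orthogonal_transformation_def inner_axis_axis)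
  ultimately show "\<exists>P e h. norm e = 1 \<and> norm h = 1 \<and> e \<bullet> h = 0 \<and> S = range (tractrix_curve l P e h)" by blast
next
  assume "\<exists>P e h. norm e = 1 \<and> norm h = 1 \<and> e \<bullet> h = 0 \<and> S = range (tractrix_curve l P e h)"
  then obtain P e h where e: "norm e = 1" "norm h = 1" "e \<bullet> h = 0" and S: "S = range (tractrix_curve l P e h)" by blast
  let ?g = "\<lambda>x::plane. P + x$1 *\<^sub>R e + x$2 *\<^sub>R h"
  have "dist (?g x) (?g y) = dist x y" for x y
  proof -
    have "?g x - ?g y = (x$1 - y$1) *\<^sub>R e + (x$2 - y$2) *\<^sub>R h" by (simp add: algebra_simps)
    then have "(norm (?g x - ?g y))\<^sup>2 = (x$1 - y$1)\<^sup>2 + (x$2 - y$2)\<^sup>2" using norm_orthonormal[OF e] by simp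
    also have "\<dots> = (norm (x - y))\<^sup>2" unfolding power2_norm_eq_inner by (simp add: inner_plane power2_eq_square)
    finally show ?thesis by (simp add: dist_norm)
  qed
  moreover have "S = ?g ` range (\<lambda>t::real. vector [t - l * tanh (t / l), l / cosh (t / l)])"
    unfolding S tractrix_curve_def by (simp add: image_image)
  ultimately show "is_tractrix l S" unfolding is_tractrix_def by (intro exI[of _ ?g]) auto
qed

text \<open>The chords from the cusp to the points with parameters \<open>2 * l\<close> and
  \<open>- 2 * l\<close> would both be multiples of \<open>v\<close>, and so would their difference
  and sum, which are nonzero multiples of the orthogonal vectors \<open>e\<close> and
  \<open>h\<close>.\<close>

lemma tractrix_not_line:
  assumes l: "l > 0" and S: "is_tractrix l S"
  shows "\<not> is_line S"
proof
  assume "is_line S"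
  then obtain p v where pv: "v \<noteq> 0" "S = range (\<lambda>s::real. p + s *\<^sub>R v)" unfolding is_line_def by blast
  obtain P e h where e: "norm e = 1" "norm h = 1" "e \<bullet> h = 0" and S: "S = range (tractrix_curve l P e h)"
    using S unfolding is_tractrix_iff by blast
  let ?\<tau> = "tractrix_curve l P e h"
  have "?\<tau> s \<in> range (\<lambda>s::real. p + s *\<^sub>R v)" for s using S pv(2) by blast
  then have "\<exists>r. ?\<tau> s = p + r *\<^sub>R v" for s by (simp add: image_iff)
  then obtain r where r: "\<And>s. ?\<tau> s = p + r s *\<^sub>R v" by metis
  let ?X = "2 * l - l * tanh 2" and ?Y = "l / cosh 2 - l"
  have X: "?X > 0" using l tanh_real_lt_1[of 2] by (simp add: algebra_simps)
  have "cosh (0::real) < cosh 2" by (rule cosh_real_strict_mono) auto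
  then have Y: "?Y < 0" using l by (simp add: field_simps)
  define A where "A = r (2 * l) - r 0"
  define B where "B = r (- 2 * l) - r 0"
  have "A *\<^sub>R v = ?\<tau> (2 * l) - ?\<tau> 0" "B *\<^sub>R v = ?\<tau> (- 2 * l) - ?\<tau> 0"
    unfolding r A_def B_def by (simp_all add: algebra_simps)
  then have AB: "A *\<^sub>R v = ?X *\<^sub>R e + ?Y *\<^sub>R h" "B *\<^sub>R v = - ?X *\<^sub>R e + ?Y *\<^sub>R h"
    using l by (simp_all add: tractrix_curve_def algebra_simps)
  have gen: "(x *\<^sub>R e + y *\<^sub>R h) - (- x *\<^sub>R e + y *\<^sub>R h) = (2 * x) *\<^sub>R e" 
    "(x *\<^sub>R e + y *\<^sub>R h) + (- x *\<^sub>R e + y *\<^sub>R h) = (2 * y) *\<^sub>R h" for x y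
    by (simp_all add: vec_eq_iff)
  have e1: "(A - B) *\<^sub>R v = (2 * ?X) *\<^sub>R e" using gen(1)[of ?X ?Y] unfolding AB[symmetric] by (simp only: scaleR_left_diff_distrib[of A B v])
  have e2: "(A + B) *\<^sub>R v = (2 * ?Y) *\<^sub>R h" using gen(2)[of ?X ?Y] unfolding AB[symmetric] by (simp only: scaleR_left_distrib[of A B v])
  have "A - B \<noteq> 0" using e1 X e(1) by auto
  moreover have "A + B \<noteq> 0" using e2 Y e(2) by auto
  moreover have "((A - B) *\<^sub>R v) \<bullet> ((A + B) *\<^sub>R v) = 0" unfolding e1 e2 using e(3) by simp
  ultimately show False using pv(1) by auto
qed

text \<open>The second alternative is meant for the flip of a minimizer: if the back track is a
  line, the front wheel runs on the same line, and flipping gives a line again instead of a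
  soliton.\<close>

lemma straight_front_dichotomy:
  assumes l: "l > 0" and \<gamma>: "infinite_bicycle_path l \<gamma>" and f: "unit_speed_line (front_track \<gamma>)"
  shows "is_tractrix l (range (back_track \<gamma>)) \<or>
    is_line (range (back_track \<gamma>)) \<and> unit_speed_line (front_track (flip \<circ> \<gamma>))"
proof -
  obtain p v where v: "norm v = 1" "\<And>t. snd (\<gamma> t) = p + t *\<^sub>R v"
    using f by (auto simp: unit_speed_line_def front_track_def)
  have b: "back_track \<gamma> t = p + t *\<^sub>R v - l *\<^sub>R frame l \<gamma> t" for t
    using front_eq_frame[OF l, of \<gamma> t] v(2)[of t] by (simp add: back_track_def algebra_simps)
  from straight_front_cases[OF l \<gamma> v] show ?thesis
  proof cases
    case (1 \<sigma>)
    have bt: "back_track \<gamma> t = (p - (l * \<sigma>) *\<^sub>R v) + t *\<^sub>R v" for t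
      by (simp add: b 1(2) algebra_simps)
    then have "back_track \<gamma> = (\<lambda>t. (p - (l * \<sigma>) *\<^sub>R v) + t *\<^sub>R v)" by (rule ext)
    moreover have "v \<noteq> 0" using v(1) by auto
    ultimately have "is_line (range (back_track \<gamma>))" unfolding is_line_def by metis
    moreover have "front_track (flip \<circ> \<gamma>) t = (p - (2 * (l * \<sigma>)) *\<^sub>R v) + t *\<^sub>R v" for t
      unfolding front_track_def o_def snd_flip v(2) bt[unfolded back_track_def] by (simp add: vec_eq_iff algebra_simps)
    then have "unit_speed_line (front_track (flip \<circ> \<gamma>))" unfolding unit_speed_line_def using v(1) by blast
    ultimately show ?thesis by blast
  next
    case (2 \<sigma> a)
    let ?h = "- \<sigma> *\<^sub>R rot v"
    have "back_track \<gamma> t = tractrix_curve l (p + a *\<^sub>R v) v ?h (t - a)" for t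
      by (simp add: b 2(2) tractrix_frame_def tractrix_curve_def algebra_simps)
    then have "back_track \<gamma> = tractrix_curve l (p + a *\<^sub>R v) v ?h \<circ> (\<lambda>t. t - a)" by auto
    moreover have "surj (\<lambda>t::real. t - a)" by (rule surjI[of _ "\<lambda>t. t + a"]) simp
    ultimately have "range (back_track \<gamma>) = range (tractrix_curve l (p + a *\<^sub>R v) v ?h)" by (metis image_comp)
    moreover have "norm ?h = 1" "v \<bullet> ?h = 0" using v(1) 2(1) by auto
    ultimately have "is_tractrix l (range (back_track \<gamma>))" unfolding is_tractrix_iff using v(1) by blast
    then show ?thesis by blast
  qed
qed

lemma straight_front_tractrix:
  assumes l: "l > 0" and \<gamma>: "infinite_bicycle_path l \<gamma>"
    and f: "unit_speed_line (front_track \<gamma>)" and b: "is_tractrix l (range (back_track \<gamma>))"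
  obtains p v \<sigma> a where "norm v = 1" "\<And>t. snd (\<gamma> t) = p + t *\<^sub>R v" "\<sigma> = 1 \<or> \<sigma> = (-1::real)"
    "\<And>t. frame l \<gamma> t = tractrix_frame l v (\<sigma> *\<^sub>R rot v) a t"
proof -
  obtain p v where v: "norm v = 1" "\<And>t. snd (\<gamma> t) = p + t *\<^sub>R v"
    using f by (auto simp: unit_speed_line_def front_track_def)
  from straight_front_cases[OF l \<gamma> v] show thesis
  proof cases
    case (1 \<sigma>)
    have "back_track \<gamma> = (\<lambda>t. (p - (l * \<sigma>) *\<^sub>R v) + t *\<^sub>R v)"
    proof
      fix t show "back_track \<gamma> t = (p - (l * \<sigma>) *\<^sub>R v) + t *\<^sub>R v"
        using front_eq_frame[OF l, of \<gamma> t] v(2)[of t] 1(2)[of t] by (simp add: back_track_def algebra_simps)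
    qed
    moreover have "v \<noteq> 0" using v(1) by auto
    ultimately have "is_line (range (back_track \<gamma>))" unfolding is_line_def by metis
    then show thesis using tractrix_not_line[OF l b] by blast
  next
    case (2 \<sigma> a)
    then show thesis using that v 2 by blast
  qed
qed

subsection \<open>Euler solitons\<close>

text \<open>The class \<open>P\<close> is closed under scaling because \<open>Ck_on\<close>
  differentiates in every direction \<open>r\<close>, and the derivative in direction
  \<open>r\<close> is \<open>r\<close> times \<open>h'\<close>.\<close>

lemma smooth_on_UNIV_coinduct:
  fixes h :: "real \<Rightarrow> 'a::real_normed_vector"
  assumes P: "P h"
    and d: "\<And>h. P h \<Longrightarrow> \<exists>h'. P h' \<and> (\<forall>t. (h has_vector_derivative h' t) (at t))"
    and s: "\<And>h r. P h \<Longrightarrow> P (\<lambda>t. r *\<^sub>R h t)"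
  shows "smooth_on UNIV h"
proof -
  have "\<forall>h. P h \<longrightarrow> Ck_on k UNIV h" for k
  proof (induction k)
    case 0
    show ?case
    proof (intro allI impI)
      fix h assume "P h"
      then obtain h' where "\<And>t. (h has_vector_derivative h' t) (at t)" using d by blast
      then have "continuous_on UNIV h"
        by (intro continuous_at_imp_continuous_on ballI has_vector_derivative_continuous)
      then show "Ck_on 0 UNIV h" by simp
    qed
  next
    case (Suc k)
    show ?case
    proof (intro allI impI)
      fix h assume "P h"
      then obtain h' where h': "P h'" "\<And>t. (h has_vector_derivative h' t) (at t)" using d by blast
      have "frechet_derivative h (at t) = (\<lambda>r. r *\<^sub>R h' t)" for t
        using frechet_derivative_at[of h "\<lambda>r. r *\<^sub>R h' t" t] h'(2)[of t] by (simp add: has_vector_derivative_def)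
      moreover have "h differentiable_on UNIV"
        unfolding differentiable_on_def differentiable_def using h'(2) by (auto simp: has_vector_derivative_def)
      ultimately show "Ck_on (Suc k) UNIV h" using Suc s[OF h'(1)] by simp
    qed
  qed
  then show ?thesis using P unfolding smooth_on_def by blast
qed

text \<open>An algebra of functions that contains the coordinates of the soliton and is closed under
  differentiation; this gives smoothness without computing higher derivatives.\<close>

inductive hyperbolic_fun :: "real \<Rightarrow> real \<Rightarrow> (real \<Rightarrow> real) \<Rightarrow> bool" for l a where
  const: "hyperbolic_fun l a (\<lambda>_. k)"
| ident: "hyperbolic_fun l a (\<lambda>t. t)"
| tanh: "hyperbolic_fun l a (\<lambda>t. tanh ((t - a) / l))"
| sech: "hyperbolic_fun l a (\<lambda>t. 1 / cosh ((t - a) / l))"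
| add: "hyperbolic_fun l a f \<Longrightarrow> hyperbolic_fun l a g \<Longrightarrow> hyperbolic_fun l a (\<lambda>t. f t + g t)"
| mult: "hyperbolic_fun l a f \<Longrightarrow> hyperbolic_fun l a g \<Longrightarrow> hyperbolic_fun l a (\<lambda>t. f t * g t)"

lemma hyperbolic_fun_derivative:
  assumes "hyperbolic_fun l a g" "l > 0"
  shows "\<exists>g'. hyperbolic_fun l a g' \<and> (\<forall>t. (g has_real_derivative g' t) (at t))"
  using assms(1)
proof induction
  case (const k)
  show ?case using hyperbolic_fun.const[of l a 0] by (auto intro: exI[of _ "\<lambda>_. 0"])
next
  case ident
  show ?case using hyperbolic_fun.const[of l a 1] by (auto intro: exI[of _ "\<lambda>_. 1"])
next
  case tanh
  let ?S = "\<lambda>t. 1 / cosh ((t - a) / l)"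
  have "hyperbolic_fun l a (\<lambda>t. (1 / l) * (?S t * ?S t))" by (intro hyperbolic_fun.intros)
  moreover have "((\<lambda>t. tanh ((t - a) / l)) has_real_derivative (1 / l) * (?S t * ?S t)) (at t)" for t
    using has_real_derivative_tanh_scaled[OF assms(2), of a t] by (simp add: power2_eq_square mult_ac)
  ultimately show ?case by blast
next
  case sech
  let ?S = "\<lambda>t. 1 / cosh ((t - a) / l)"
  have "hyperbolic_fun l a (\<lambda>t. (- 1 / l) * (tanh ((t - a) / l) * ?S t))" by (intro hyperbolic_fun.intros)
  moreover have "(?S has_real_derivative (- 1 / l) * (tanh ((t - a) / l) * ?S t)) (at t)" for t
    using has_real_derivative_sech_scaled[OF assms(2), of a t] by (simp add: mult_ac)
  ultimately show ?case by blast
next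
  case (add f g)
  then obtain f' g' where "hyperbolic_fun l a f'" "hyperbolic_fun l a g'"
    "\<forall>t. (f has_real_derivative f' t) (at t)" "\<forall>t. (g has_real_derivative g' t) (at t)" by blast
  then show ?case by (intro exI[of _ "\<lambda>t. f' t + g' t"] conjI allI hyperbolic_fun.add DERIV_add) auto
next
  case (mult f g)
  then obtain f' g' where "hyperbolic_fun l a f'" "hyperbolic_fun l a g'"
    "\<forall>t. (f has_real_derivative f' t) (at t)" "\<forall>t. (g has_real_derivative g' t) (at t)" by blast
  then show ?case using mult.hyps
    by (intro exI[of _ "\<lambda>t. f' t * g t + g' t * f t"] conjI allI hyperbolic_fun.add hyperbolic_fun.mult DERIV_mult) auto
qed

lemma smooth_on_hyperbolic_combination:
  fixes x y z :: "'a::real_normed_vector"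
  assumes "hyperbolic_fun l a f" "hyperbolic_fun l a g" "hyperbolic_fun l a k" "l > 0"
  shows "smooth_on UNIV (\<lambda>t. f t *\<^sub>R x + g t *\<^sub>R y + k t *\<^sub>R z)"
proof (rule smooth_on_UNIV_coinduct[of "\<lambda>h. \<exists>f g k. hyperbolic_fun l a f \<and> hyperbolic_fun l a g \<and> hyperbolic_fun l a k \<and>
     h = (\<lambda>t. f t *\<^sub>R x + g t *\<^sub>R y + k t *\<^sub>R z)"])
  fix h assume "\<exists>f g k. hyperbolic_fun l a f \<and> hyperbolic_fun l a g \<and> hyperbolic_fun l a k \<and> h = (\<lambda>t. f t *\<^sub>R x + g t *\<^sub>R y + k t *\<^sub>R z)"
  then obtain f g k where h: "hyperbolic_fun l a f" "hyperbolic_fun l a g" "hyperbolic_fun l a k" "h = (\<lambda>t. f t *\<^sub>R x + g t *\<^sub>R y + k t *\<^sub>R z)" by blast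
  obtain f' g' k' where d: "hyperbolic_fun l a f'" "hyperbolic_fun l a g'" "hyperbolic_fun l a k'"
    "\<And>t. (f has_real_derivative f' t) (at t)" "\<And>t. (g has_real_derivative g' t) (at t)" "\<And>t. (k has_real_derivative k' t) (at t)"
    using hyperbolic_fun_derivative[OF h(1) assms(4)] hyperbolic_fun_derivative[OF h(2) assms(4)] hyperbolic_fun_derivative[OF h(3) assms(4)] by metis
  let ?h' = "\<lambda>t. f' t *\<^sub>R x + g' t *\<^sub>R y + k' t *\<^sub>R z"
  have "(h has_vector_derivative ?h' t) (at t)" for t
    unfolding h(4) by (intro has_vector_derivative_add has_vector_derivative_scaleR_const d)
  then show "\<exists>h'. (\<exists>f g k. hyperbolic_fun l a f \<and> hyperbolic_fun l a g \<and> hyperbolic_fun l a k \<and> h' = (\<lambda>t. f t *\<^sub>R x + g t *\<^sub>R y + k t *\<^sub>R z))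
      \<and> (\<forall>t. (h has_vector_derivative h' t) (at t))"
    using d(1-3) by (intro exI[of _ ?h']) blast
  fix r
  have "(\<lambda>t. r *\<^sub>R h t) = (\<lambda>t. (r * f t) *\<^sub>R x + (r * g t) *\<^sub>R y + (r * k t) *\<^sub>R z)"
    by (simp add: h(4) scaleR_add_right)
  moreover have "hyperbolic_fun l a (\<lambda>t. r * f t)" "hyperbolic_fun l a (\<lambda>t. r * g t)" "hyperbolic_fun l a (\<lambda>t. r * k t)"
    by (intro hyperbolic_fun.mult hyperbolic_fun.const h)+
  ultimately show "\<exists>f g k. hyperbolic_fun l a f \<and> hyperbolic_fun l a g \<and> hyperbolic_fun l a k \<and> (\<lambda>t. r *\<^sub>R h t) = (\<lambda>t. f t *\<^sub>R x + g t *\<^sub>R y + k t *\<^sub>R z)"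
    by blast
qed (use assms in blast)

section \<open>The Euler soliton as the flip of a straight front track\<close>

context
  fixes l a \<sigma> :: real and p v :: plane and T S :: "real \<Rightarrow> real" and h :: plane and c :: "real \<Rightarrow> plane"
  assumes l: "l > 0" and v: "norm v = 1" and \<sigma>: "\<sigma> = 1 \<or> \<sigma> = -1"
  defines "T \<equiv> \<lambda>t. tanh ((t - a) / l)" and "S \<equiv> \<lambda>t. 1 / cosh ((t - a) / l)" and "h \<equiv> \<sigma> *\<^sub>R rot v"
    and "c \<equiv> \<lambda>t. p + t *\<^sub>R v - (2 * l) *\<^sub>R tractrix_frame l v (\<sigma> *\<^sub>R rot v) a t"
begin

lemma soliton_TS: "(T t)\<^sup>2 + (S t)\<^sup>2 = 1"
  unfolding T_def S_def by (rule tanh_sech_square)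

lemma soliton_S_pos: "S t > 0"
  unfolding S_def using cosh_real_pos by simp

lemma soliton_dT: "(T has_real_derivative (S t)\<^sup>2 / l) (at t)"
  unfolding T_def S_def by (rule has_real_derivative_tanh_scaled[OF l])

lemma soliton_dS: "(S has_real_derivative - (T t * S t) / l) (at t)"
  unfolding T_def S_def by (rule has_real_derivative_sech_scaled[OF l])

lemma soliton_h: "norm h = 1" "v \<bullet> h = 0"
  unfolding h_def using v \<sigma> by auto

lemma soliton_eq: "c t = 1 *\<^sub>R p + (t - 2 * l * T t) *\<^sub>R v + (- 2 * l * S t) *\<^sub>R h"
  unfolding c_def tractrix_frame_def T_def S_def h_def by (simp add: algebra_simps)

lemma soliton_smooth: "smooth_on UNIV c"
proof -
  have eq: "c = (\<lambda>t. 1 *\<^sub>R p + (t + (- 2 * l) * T t) *\<^sub>R v + ((- 2 * l) * S t) *\<^sub>R h)"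
    by (rule ext) (simp add: soliton_eq)
  have T: "hyperbolic_fun l a T" unfolding T_def by (rule hyperbolic_fun.tanh)
  have S: "hyperbolic_fun l a S" unfolding S_def by (rule hyperbolic_fun.sech)
  show ?thesis
    unfolding eq
    by (rule smooth_on_hyperbolic_combination[OF hyperbolic_fun.const
          hyperbolic_fun.add[OF hyperbolic_fun.ident hyperbolic_fun.mult[OF hyperbolic_fun.const T]]
          hyperbolic_fun.mult[OF hyperbolic_fun.const S] l])
qed

text \<open>Since \<open>c\<close> is the line minus \<open>2 * l\<close> times the frame, its
  velocity is the mirror image of \<open>v\<close> in the frame
  \<open>T t *\<^sub>R v + S t *\<^sub>R h\<close>.\<close>

lemma soliton_velocity: "(c has_vector_derivative (2 * (T t)\<^sup>2 - 1) *\<^sub>R v + (2 * T t * S t) *\<^sub>R h) (at t)"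
proof -
  have "((\<lambda>t. t - 2 * l * T t) has_real_derivative 1 - 2 * l * ((S t)\<^sup>2 / l)) (at t)"
    by (intro DERIV_diff DERIV_ident DERIV_cmult soliton_dT)
  moreover have "1 - 2 * l * ((S t)\<^sup>2 / l) = 2 * (T t)\<^sup>2 - 1" using l soliton_TS[of t] by simp
  ultimately have 1: "((\<lambda>t. t - 2 * l * T t) has_real_derivative 2 * (T t)\<^sup>2 - 1) (at t)" by (simp only:)
  have "((\<lambda>t. - 2 * l * S t) has_real_derivative - 2 * l * (- (T t * S t) / l)) (at t)"
    by (intro DERIV_cmult soliton_dS)
  moreover have "- 2 * l * (- (T t * S t) / l) = 2 * T t * S t" using l by simp
  ultimately have 2: "((\<lambda>t. - 2 * l * S t) has_real_derivative 2 * T t * S t) (at t)" by (simp only:)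
  have "((\<lambda>t. 1 *\<^sub>R p + (t - 2 * l * T t) *\<^sub>R v + (- 2 * l * S t) *\<^sub>R h) has_vector_derivative
      0 + (2 * (T t)\<^sup>2 - 1) *\<^sub>R v + (2 * T t * S t) *\<^sub>R h) (at t)"
    by (intro has_vector_derivative_add has_vector_derivative_scaleR_const 1 2 has_vector_derivative_const)
  then show ?thesis unfolding soliton_eq[abs_def] by simp
qed

lemma soliton_acceleration:
  "((\<lambda>t. (2 * (T t)\<^sup>2 - 1) *\<^sub>R v + (2 * T t * S t) *\<^sub>R h) has_vector_derivative
     (4 * T t * (S t)\<^sup>2 / l) *\<^sub>R v + (2 / l * ((S t)^3 - (T t)\<^sup>2 * S t)) *\<^sub>R h) (at t)"
proof (intro has_vector_derivative_add has_vector_derivative_scaleR_const)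
  show "((\<lambda>t. 2 * (T t)\<^sup>2 - 1) has_real_derivative 4 * T t * (S t)\<^sup>2 / l) (at t)"
    by (rule DERIV_cong, (rule derivative_eq_intros soliton_dT refl)+) simp
  show "((\<lambda>t. 2 * T t * S t) has_real_derivative 2 / l * ((S t)^3 - (T t)\<^sup>2 * S t)) (at t)"
    by (rule DERIV_cong, (rule derivative_eq_intros soliton_dT soliton_dS refl)+)
       (simp add: power2_eq_square power3_eq_cube algebra_simps diff_divide_distrib)
qed

text \<open>With \<open>T\<close> and \<open>S\<close> read as cosine and sine of the frame angle,
  the tangent has twice this angle, and the angle has derivative \<open>- S t / l\<close>. The
  factor \<open>\<sigma>\<close> is the orientation of the pair \<open>v\<close>,
  \<open>h\<close>.\<close>

lemma soliton_curvature: "curvature c t = - \<sigma> * (2 * S t / l)"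
proof -
  have vd: "vector_derivative c (at s) = (2 * (T s)\<^sup>2 - 1) *\<^sub>R v + (2 * T s * S s) *\<^sub>R h" for s
    by (rule vector_derivative_at[OF soliton_velocity])
  then have v1: "(\<lambda>s. vector_derivative c (at s)) = (\<lambda>s. (2 * (T s)\<^sup>2 - 1) *\<^sub>R v + (2 * T s * S s) *\<^sub>R h)" by auto
  have v2: "vector_derivative (\<lambda>s. vector_derivative c (at s)) (at t) =
      (4 * T t * (S t)\<^sup>2 / l) *\<^sub>R v + (2 / l * ((S t)^3 - (T t)\<^sup>2 * S t)) *\<^sub>R h"
    unfolding v1 by (rule vector_derivative_at[OF soliton_acceleration])
  have det: "(A *\<^sub>R v + B *\<^sub>R h)$1 * (C *\<^sub>R v + D *\<^sub>R h)$2 - (A *\<^sub>R v + B *\<^sub>R h)$2 * (C *\<^sub>R v + D *\<^sub>R h)$1 = (A * D - B * C) * \<sigma>" for A B C D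
  proof -
    have "v$1 * v$1 + v$2 * v$2 = 1" using norm1_inner[OF v] by (simp add: inner_plane)
    moreover have "(A *\<^sub>R v + B *\<^sub>R h)$1 * (C *\<^sub>R v + D *\<^sub>R h)$2 - (A *\<^sub>R v + B *\<^sub>R h)$2 * (C *\<^sub>R v + D *\<^sub>R h)$1
      = (A * D - B * C) * \<sigma> * (v$1 * v$1 + v$2 * v$2)"
      by (simp add: h_def algebra_simps)
    ultimately show ?thesis by simp
  qed
  have "curvature c t = ((2 * (T t)\<^sup>2 - 1) * (2 / l * ((S t)^3 - (T t)\<^sup>2 * S t)) - (2 * T t * S t) * (4 * T t * (S t)\<^sup>2 / l)) * \<sigma>"
    unfolding curvature_def Let_def v2 unfolding vd by (rule det)
  also have "(2 * (T t)\<^sup>2 - 1) * (2 / l * ((S t)^3 - (T t)\<^sup>2 * S t)) - (2 * T t * S t) * (4 * T t * (S t)\<^sup>2 / l)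
     = (2 * S t / l) * ((2 * (T t)\<^sup>2 - 1) * ((S t)\<^sup>2 - (T t)\<^sup>2) - 4 * (T t)\<^sup>2 * (S t)\<^sup>2)"
    by (simp add: power2_eq_square power3_eq_cube algebra_simps diff_divide_distrib add_divide_distrib)
  also have "(2 * (T t)\<^sup>2 - 1) * ((S t)\<^sup>2 - (T t)\<^sup>2) - 4 * (T t)\<^sup>2 * (S t)\<^sup>2 = -1"
  proof -
    have S2: "(S t)\<^sup>2 = 1 - (T t)\<^sup>2" using soliton_TS[of t] by simp
    show ?thesis unfolding S2 by (simp add: power2_eq_square algebra_simps)
  qed
  finally show ?thesis by simp
qed

lemma soliton_curvature_derivs:
  "deriv (curvature c) t = \<sigma> * (2 / l\<^sup>2) * (T t * S t)"
  "deriv (deriv (curvature c)) t = \<sigma> * (2 / l^3) * ((S t)^3 - (T t)\<^sup>2 * S t)"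
proof -
  have k: "curvature c = (\<lambda>t. (- \<sigma> * (2 / l)) * S t)" by (rule ext) (simp add: soliton_curvature)
  have d1: "(curvature c has_real_derivative \<sigma> * (2 / l\<^sup>2) * (T t * S t)) (at t)" for t
    unfolding k by (rule DERIV_cong[OF DERIV_cmult[OF soliton_dS]]) (simp add: power2_eq_square)
  then show "deriv (curvature c) t = \<sigma> * (2 / l\<^sup>2) * (T t * S t)" by (rule DERIV_imp_deriv)
  have k1: "deriv (curvature c) = (\<lambda>t. \<sigma> * (2 / l\<^sup>2) * (T t * S t))" using DERIV_imp_deriv[OF d1] by auto
  have "(deriv (curvature c) has_real_derivative \<sigma> * (2 / l^3) * ((S t)^3 - (T t)\<^sup>2 * S t)) (at t)"
    unfolding k1
    by (rule DERIV_cong[OF DERIV_cmult[OF DERIV_mult[OF soliton_dT soliton_dS]]])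
       (simp add: power2_eq_square power3_eq_cube algebra_simps diff_divide_distrib)
  then show "deriv (deriv (curvature c)) t = \<sigma> * (2 / l^3) * ((S t)^3 - (T t)\<^sup>2 * S t)" by (rule DERIV_imp_deriv)
qed

text \<open>The curvature is a sech profile of height \<open>2 / l\<close> and rate
  \<open>1 / l\<close>; such a profile solves the elastica equation with zero energy for
  \<open>A = - 1 / l\<^sup>2\<close>.\<close>

lemma soliton_euler: "euler_soliton c"
  unfolding euler_soliton_def
proof (intro exI[of _ "- 1 / l\<^sup>2"] conjI allI)
  have \<sigma>2: "\<sigma>^3 = \<sigma>" "\<sigma>\<^sup>2 = 1" "\<sigma>^4 = 1" using \<sigma> by auto
  show "- 1 / l\<^sup>2 < 0" using l by simp
  show "elastica (- 1 / l\<^sup>2) c"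
    unfolding elastica_def
  proof (intro conjI allI soliton_smooth)
    fix t
    have "(norm (vector_derivative c (at t)))\<^sup>2 = (2 * (T t)\<^sup>2 - 1)\<^sup>2 + (2 * T t * S t)\<^sup>2"
      unfolding vector_derivative_at[OF soliton_velocity] by (rule norm_orthonormal[OF v soliton_h])
    also have "\<dots> = ((T t)\<^sup>2 + (S t)\<^sup>2)\<^sup>2"
    proof -
      have S2: "(S t)\<^sup>2 = 1 - (T t)\<^sup>2" using soliton_TS[of t] by simp
      show ?thesis unfolding power_mult_distrib S2 by (simp add: power2_eq_square algebra_simps)
    qed
    finally have "(norm (vector_derivative c (at t)))\<^sup>2 = 1" unfolding soliton_TS by simp
    then show "norm (vector_derivative c (at t)) = 1" by (simp add: power2_eq_1_iff) (smt (verit) norm_ge_zero)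
    have T2: "(T t)\<^sup>2 = 1 - (S t)\<^sup>2" using soliton_TS[of t] by simp
    have "curvature c t ^ 3 = - \<sigma> * (8 * (S t)^3 / l^3)"
      unfolding soliton_curvature by (simp add: power_mult_distrib power_divide \<sigma>2)
    then show "deriv (deriv (curvature c)) t + (1/2) * curvature c t ^ 3 + - 1 / l\<^sup>2 * curvature c t = 0"
      unfolding soliton_curvature_derivs soliton_curvature T2
      by (simp add: power2_eq_square power3_eq_cube algebra_simps diff_divide_distrib add_divide_distrib)
  qed
  fix t
  have T2: "(T t)\<^sup>2 = 1 - (S t)\<^sup>2" using soliton_TS[of t] by simp
  have k: "(deriv (curvature c) t)\<^sup>2 = 4 / l^4 * ((T t)\<^sup>2 * (S t)\<^sup>2)" "curvature c t ^ 4 = 16 / l^4 * (S t)^4" "(curvature c t)\<^sup>2 = 4 / l\<^sup>2 * (S t)\<^sup>2"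
    unfolding soliton_curvature_derivs soliton_curvature
    by (simp_all add: power_mult_distrib power_divide \<sigma>2 power_even_abs)
  show "elastica_energy (- 1 / l\<^sup>2) c t = 0"
    unfolding elastica_energy_def k T2
    by (simp add: power2_eq_square power4_eq_xxxx algebra_simps diff_divide_distrib add_divide_distrib)
next
  \<comment> \<open>The introduction rule has instantiated the time with the value of
    \<open>A\<close> as well; any time will do, as the curvature has no zero.\<close>
  show "curvature c (- 1 / l\<^sup>2) \<noteq> 0" unfolding soliton_curvature using l \<sigma> soliton_S_pos[of "- 1 / l\<^sup>2"] by auto
qed

lemma soliton_S_le_1: "S t \<le> 1"
  unfolding S_def using cosh_real_ge_1 by simp

lemma soliton_T_abs: "\<bar>T t\<bar> \<le> 1"
  unfolding T_def using tanh_real_bounds[of "(t - a) / l"] by (auto simp: abs_le_iff)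

lemma soliton_S_tendsto: "(S \<longlongrightarrow> 0) at_top"
proof -
  have "filterlim (\<lambda>t. (t - a) / l) at_top at_top"
    unfolding filterlim_at_top
  proof
    fix Z
    show "eventually (\<lambda>t. Z \<le> (t - a) / l) at_top"
      using eventually_ge_at_top[of "Z * l + a"] by eventually_elim (use l in \<open>simp add: field_simps\<close>)
  qed
  from tendsto_inverse_0_at_top[OF filterlim_compose[OF cosh_real_at_top this]]
  show ?thesis by (simp add: S_def inverse_eq_divide)
qed

lemma soliton_inner: "n \<bullet> c t = n \<bullet> p + (t - 2 * l * T t) * (n \<bullet> v) - 2 * l * S t * (n \<bullet> h)"
  by (simp add: soliton_eq inner_add_right inner_diff_right)

text \<open>The strip between the asymptote and the parallel at distance \<open>2 * l\<close>
  contains the curve. Conversely, the normal \<open>n\<close> of a strip must be orthogonal to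
  \<open>v\<close>, as the term \<open>t * (n \<bullet> v)\<close> is otherwise unbounded; the
  heights then range from the value at the crest \<open>t = a\<close> to the limit on the asymptote,
  which is not attained.\<close>

lemma soliton_width: "width (range c) = ereal (2 * l)"
  unfolding width_def
proof (rule antisym)
  show "Inf {ereal (s - r) | r s. r \<le> s \<and> (\<exists>n. norm n = 1 \<and> range c \<subseteq> {x. r \<le> n \<bullet> x \<and> n \<bullet> x \<le> s})} \<le> ereal (2 * l)"
  proof (rule Inf_lower, rule CollectI, rule exI[of _ "h \<bullet> p - 2 * l"], rule exI[of _ "h \<bullet> p"], intro conjI exI[of _ h])
    show "range c \<subseteq> {x. h \<bullet> p - 2 * l \<le> h \<bullet> x \<and> h \<bullet> x \<le> h \<bullet> p}"
    proof safe
      fix t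
      have i: "h \<bullet> c t = h \<bullet> p - 2 * l * S t"
        using soliton_inner[of h t] soliton_h norm1_inner[OF soliton_h(1)] by (simp add: inner_commute)
      have "2 * l * S t \<le> 2 * l * 1" using l soliton_S_le_1 by (intro mult_left_mono) auto
      then show "h \<bullet> p - 2 * l \<le> h \<bullet> c t" using i by simp
      have "0 \<le> 2 * l * S t" using l soliton_S_pos[of t] by simp
      then show "h \<bullet> c t \<le> h \<bullet> p" using i by simp
    qed
  qed (use l soliton_h in auto)
  show "ereal (2 * l) \<le> Inf {ereal (s - r) | r s. r \<le> s \<and> (\<exists>n. norm n = 1 \<and> range c \<subseteq> {x. r \<le> n \<bullet> x \<and> n \<bullet> x \<le> s})}"
  proof (rule Inf_greatest, safe)
    fix r s n assume n: "norm n = 1" and "range c \<subseteq> {x. r \<le> n \<bullet> x \<and> n \<bullet> x \<le> s}"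
    then have rs: "r \<le> n \<bullet> c t" "n \<bullet> c t \<le> s" for t by auto
    have nv: "n \<bullet> v = 0"
    proof (rule ccontr)
      assume nz: "n \<bullet> v \<noteq> 0"
      define K where "K = \<bar>r\<bar> + \<bar>s\<bar> + \<bar>n \<bullet> p\<bar> + 2 * l + 2 * l"
      have "\<bar>t * (n \<bullet> v)\<bar> \<le> K" for t
      proof -
        have b1: "\<bar>n \<bullet> v\<bar> \<le> 1" "\<bar>n \<bullet> h\<bar> \<le> 1"
          using Cauchy_Schwarz_ineq2[of n v] Cauchy_Schwarz_ineq2[of n h] n v soliton_h by simp_all
        have "\<bar>T t\<bar> * \<bar>n \<bullet> v\<bar> \<le> 1 * 1" "\<bar>S t\<bar> * \<bar>n \<bullet> h\<bar> \<le> 1 * 1"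
          using b1 soliton_T_abs[of t] soliton_S_le_1[of t] soliton_S_pos[of t] by (intro mult_mono; simp)+
        then have "2 * l * (\<bar>T t\<bar> * \<bar>n \<bullet> v\<bar>) \<le> 2 * l * (1 * 1)" "2 * l * (\<bar>S t\<bar> * \<bar>n \<bullet> h\<bar>) \<le> 2 * l * (1 * 1)"
          using l by (intro mult_left_mono; simp)+
        then have "\<bar>2 * l * T t * (n \<bullet> v)\<bar> \<le> 2 * l" "\<bar>2 * l * S t * (n \<bullet> h)\<bar> \<le> 2 * l"
          using l by (simp_all add: abs_mult)
        moreover have "t * (n \<bullet> v) = n \<bullet> c t - n \<bullet> p + 2 * l * T t * (n \<bullet> v) + 2 * l * S t * (n \<bullet> h)"
          by (simp add: soliton_inner algebra_simps)
        ultimately show ?thesis using rs[of t] unfolding K_def by linarith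
      qed
      from this[of "(K + 1) / (n \<bullet> v)"] show False using nz by simp
    qed
    have nh: "n \<bullet> h = 1 \<or> n \<bullet> h = -1"
    proof -
      have "(n \<bullet> rot v)\<^sup>2 = 1"
        using norm_rot_frame[OF v, of "n \<bullet> v" "n \<bullet> rot v"] n nv unfolding rot_decompose[OF v, of n, symmetric] by simp
      then have "(n \<bullet> h)\<^sup>2 = 1" using \<sigma> by (auto simp: h_def)
      then show ?thesis by (simp add: power2_eq_1_iff)
    qed
    have ic: "n \<bullet> c t = n \<bullet> p - 2 * l * S t * (n \<bullet> h)" for t using soliton_inner[of n t] nv by simp
    have lim: "((\<lambda>t. n \<bullet> c t) \<longlongrightarrow> n \<bullet> p - 2 * l * 0 * (n \<bullet> h)) at_top"
      unfolding ic by (intro tendsto_intros soliton_S_tendsto)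
    have "n \<bullet> p - 2 * l * 0 * (n \<bullet> h) \<le> s"
      by (rule tendsto_upperbound[OF lim]) (use rs in auto)
    moreover have "r \<le> n \<bullet> p - 2 * l * 0 * (n \<bullet> h)"
      by (rule tendsto_lowerbound[OF lim]) (use rs in auto)
    moreover have "n \<bullet> c a = n \<bullet> p - 2 * l * (n \<bullet> h)" using ic[of a] by (simp add: S_def)
    ultimately have "2 * l \<le> s - r" using nh rs[of a] l by auto
    then show "ereal (2 * l) \<le> ereal (s - r)" by simp
  qed
qed

end

lemma type1_tractrix_flip_type2:
  assumes l: "l > 0" and \<gamma>: "infinite_bicycle_path l \<gamma>"
    and f: "unit_speed_line (front_track \<gamma>)" and b: "is_tractrix l (range (back_track \<gamma>))"
  shows "type2_path l (flip \<circ> \<gamma>)"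
proof -
  obtain p v \<sigma> a where v: "norm v = 1" "\<And>t. snd (\<gamma> t) = p + t *\<^sub>R v" "\<sigma> = 1 \<or> \<sigma> = (-1::real)"
    "\<And>t. frame l \<gamma> t = tractrix_frame l v (\<sigma> *\<^sub>R rot v) a t"
    using straight_front_tractrix[OF l \<gamma> f b] by metis
  have "front_track (flip \<circ> \<gamma>) = (\<lambda>t. p + t *\<^sub>R v - (2 * l) *\<^sub>R tractrix_frame l v (\<sigma> *\<^sub>R rot v) a t)"
  proof
    fix t
    have "fst (\<gamma> t) = p + t *\<^sub>R v - l *\<^sub>R frame l \<gamma> t" using front_eq_frame[OF l, of \<gamma> t] v(2)[of t] by simp
    then show "front_track (flip \<circ> \<gamma>) t = p + t *\<^sub>R v - (2 * l) *\<^sub>R tractrix_frame l v (\<sigma> *\<^sub>R rot v) a t"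
      unfolding front_track_def o_def snd_flip v(2) v(4) by (simp add: vec_eq_iff)
  qed
  then show ?thesis
    using soliton_euler[OF l v(1,3), of p a] soliton_width[OF l v(1,3), of p a] b
    by (simp add: type2_path_def back_track_def)
qed

section \<open>The converse: a soliton front track over a tractrix\<close>

lemma smooth_on_real_vector_derivative:
  fixes c :: "real \<Rightarrow> 'a::real_normed_vector"
  assumes c: "smooth_on UNIV c"
  shows "(c has_vector_derivative vector_derivative c (at t)) (at t)" "smooth_on UNIV (\<lambda>t. vector_derivative c (at t))"
    "continuous_on UNIV c"
proof -
  have "Ck_on (Suc 0) UNIV c" using c unfolding smooth_on_def by blast
  then have "c differentiable (at t)" for t by (simp add: differentiable_on_def)
  then have d: "(c has_vector_derivative vector_derivative c (at t)) (at t)" for t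
    using vector_derivative_works by blast
  then show "(c has_vector_derivative vector_derivative c (at t)) (at t)" .
  have fd: "frechet_derivative c (at t) 1 = vector_derivative c (at t)" for t
    using frechet_derivative_at[OF d[of t, unfolded has_vector_derivative_def]] by (metis scaleR_one)
  show "smooth_on UNIV (\<lambda>t. vector_derivative c (at t))"
    unfolding smooth_on_def
  proof
    fix k
    have "Ck_on (Suc k) UNIV c" using c unfolding smooth_on_def by blast
    then have "Ck_on k UNIV (\<lambda>t. frechet_derivative c (at t) 1)" by simp
    then show "Ck_on k UNIV (\<lambda>t. vector_derivative c (at t))" by (simp add: fd)
  qed
  have "Ck_on 0 UNIV c" using c unfolding smooth_on_def by blast
  then show "continuous_on UNIV c" by simp
qed

lemma derivative_zero_if_locally_constant:
  fixes g :: "real \<Rightarrow> 'a::real_normed_vector"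
  assumes "(g has_vector_derivative d) (at t)" "open I" "t \<in> I" "\<And>s. s \<in> I \<Longrightarrow> g s = k"
  shows "d = 0"
proof -
  have "(g has_vector_derivative 0) (at t)"
    by (rule has_vector_derivative_transform_within_open[OF has_vector_derivative_const[of k] assms(2,3)]) (simp add: assms(4))
  then show ?thesis using assms(1) vector_derivative_unique_at by blast
qed

lemma has_vector_derivative_inner:
  fixes f g :: "real \<Rightarrow> 'a::real_inner"
  assumes "(f has_vector_derivative f') (at t)" "(g has_vector_derivative g') (at t)"
  shows "((\<lambda>t. f t \<bullet> g t) has_vector_derivative f t \<bullet> g' + f' \<bullet> g t) (at t)"
  by (rule bounded_bilinear.has_vector_derivative[OF bounded_bilinear_inner assms])

lemma curvature_rot:
  "curvature c t = rot (vector_derivative c (at t)) \<bullet> vector_derivative (\<lambda>s. vector_derivative c (at s)) (at t)"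
  by (simp add: curvature_def Let_def inner_plane)

lemma curvature_continuous:
  assumes "smooth_on UNIV c"
  shows "continuous_on UNIV (curvature c)"
proof -
  let ?c1 = "\<lambda>t. vector_derivative c (at t)"
  have 1: "continuous_on UNIV ?c1" and 2: "continuous_on UNIV (\<lambda>t. vector_derivative ?c1 (at t))"
    using smooth_on_real_vector_derivative[OF smooth_on_real_vector_derivative(2)[OF assms]]
      smooth_on_real_vector_derivative(3)[OF smooth_on_real_vector_derivative(2)[OF smooth_on_real_vector_derivative(2)[OF assms]]] by auto
  show ?thesis unfolding curvature_def Let_def
    by (intro continuous_intros 1 2)
qed

text \<open>On a circle of radius \<open>l\<close> the curvature is \<open>1 / l\<close> or
  \<open>- 1 / l\<close>, hence constant on the arc by continuity. For a constant curvature
  \<open>k \<noteq> 0\<close> the differential equation gives \<open>k\<^sup>2 = - 2 * A\<close>,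
  but zero energy gives \<open>k\<^sup>2 = - 4 * A\<close>.\<close>

lemma euler_soliton_no_circular_arc:
  assumes c: "euler_soliton c" and I: "\<alpha> < \<beta>" and l: "l > 0" and circ: "\<And>t. t \<in> {\<alpha><..<\<beta>} \<Longrightarrow> norm (c t - q) = l"
  shows False
proof -
  let ?I = "{\<alpha><..<\<beta>}"
  let ?c1 = "\<lambda>t. vector_derivative c (at t)"
  let ?c2 = "\<lambda>t. vector_derivative ?c1 (at t)"
  let ?k = "curvature c"
  obtain A where A: "A < 0" "elastica A c" "\<forall>t. elastica_energy A c t = 0" using c unfolding euler_soliton_def by blast
  then have sm: "smooth_on UNIV c" and unit: "\<And>t. norm (?c1 t) = 1"
    and ode: "\<And>t. deriv (deriv ?k) t + (1/2) * ?k t ^ 3 + A * ?k t = 0" unfolding elastica_def by auto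
  have d1: "(c has_vector_derivative ?c1 t) (at t)" for t by (rule smooth_on_real_vector_derivative[OF sm])
  have d2: "(?c1 has_vector_derivative ?c2 t) (at t)" for t
    by (rule smooth_on_real_vector_derivative[OF smooth_on_real_vector_derivative(2)[OF sm]])
  have dg: "((\<lambda>t. c t - q) has_vector_derivative ?c1 t) (at t)" for t
    using has_vector_derivative_diff[OF d1 has_vector_derivative_const[of q]] by simp
  have o: "open ?I" by simp
  have g1: "(c t - q) \<bullet> ?c1 t = 0" if t: "t \<in> ?I" for t
  proof -
    have "(c t - q) \<bullet> ?c1 t + ?c1 t \<bullet> (c t - q) = 0"
      by (rule derivative_zero_if_locally_constant[OF has_vector_derivative_inner[OF dg dg] o t, of "l\<^sup>2"])
         (use circ in \<open>simp add: power2_norm_eq_inner[symmetric]\<close>)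
    then show ?thesis by (simp add: inner_commute)
  qed
  have g2: "(c t - q) \<bullet> ?c2 t = -1" if t: "t \<in> ?I" for t
  proof -
    have "(c t - q) \<bullet> ?c2 t + ?c1 t \<bullet> ?c1 t = 0"
      by (rule derivative_zero_if_locally_constant[OF has_vector_derivative_inner[OF dg d2] o t, of 0])
         (use g1 in simp)
    then show ?thesis using norm1_inner[OF unit[of t]] by simp
  qed
  have ksq: "(?k t)\<^sup>2 * l\<^sup>2 = 1" if t: "t \<in> ?I" for t
  proof -
    let ?u = "?c1 t" and ?g = "c t - q"
    have g: "?g = (?g \<bullet> rot ?u) *\<^sub>R rot ?u" using rot_decompose[OF unit[of t], of ?g] g1[OF t] by simp
    have "?g \<bullet> ?c2 t = (?g \<bullet> rot ?u) * ?k t" by (subst g) (simp add: curvature_rot)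
    then have "(?g \<bullet> rot ?u) * ?k t = -1" using g2[OF t] by simp
    moreover have "(?g \<bullet> rot ?u)\<^sup>2 = l\<^sup>2"
    proof -
      have "norm ?g = \<bar>?g \<bullet> rot ?u\<bar>" by (subst g) (simp add: unit)
      then show ?thesis using circ[OF t] by (metis power2_abs)
    qed
    ultimately show ?thesis by (metis (no_types, lifting) mult.commute power2_minus power_mult_distrib power_one)
  qed
  have kv: "?k t \<in> {1 / l, - 1 / l}" if t: "t \<in> ?I" for t
  proof -
    have "(?k t * l)\<^sup>2 = 1" using ksq[OF t] by (simp add: power_mult_distrib)
    then have "?k t * l = 1 \<or> ?k t * l = -1" by (simp only: power2_eq_1_iff)
    then show ?thesis using l by (auto simp: field_simps)
  qed
  have "?k ` ?I \<subseteq> {1 / l, - 1 / l}" by (rule image_subsetI, rule kv)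
  then have "finite (?k ` ?I)" by (rule finite_subset) simp
  with continuous_on_subset[OF curvature_continuous[OF sm] subset_UNIV]
  have "?k constant_on ?I" by (rule continuous_finite_range_constant[OF connected_Ioo])
  then obtain k where "\<forall>t\<in>?I. ?k t = k" unfolding constant_on_def by (elim exE)
  then have k: "?k t = k" if "t \<in> ?I" for t using that by (rule bspec)
  have dk: "deriv ?k t = 0" if t: "t \<in> ?I" for t
  proof (rule DERIV_imp_deriv)
    show "(?k has_real_derivative 0) (at t)"
      by (rule has_field_derivative_transform_within_open[OF DERIV_const o t]) (simp add: k)
  qed
  have ddk: "deriv (deriv ?k) t = 0" if t: "t \<in> ?I" for t
  proof (rule DERIV_imp_deriv)
    show "(deriv ?k has_real_derivative 0) (at t)"
      by (rule has_field_derivative_transform_within_open[OF DERIV_const o t]) (simp add: dk)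
  qed
  define m where "m = (\<alpha> + \<beta>) / 2"
  have m: "m \<in> ?I" using I by (simp add: m_def)
  have "k \<noteq> 0" using ksq[OF m] k[OF m] by auto
  have "(1/2) * k ^ 3 + A * k = 0" using ode[of m] ddk[OF m] k[OF m] by simp
  then have "k * ((1/2) * k\<^sup>2 + A) = 0" by (simp add: power2_eq_square power3_eq_cube algebra_simps)
  then have e1: "k\<^sup>2 = - 2 * A" using \<open>k \<noteq> 0\<close> by simp
  have "(1/8) * k ^ 4 + (A/2) * k\<^sup>2 = 0" using A(3)[rule_format, of m] dk[OF m] k[OF m] by (simp add: elastica_energy_def)
  then have "k\<^sup>2 * ((1/8) * k\<^sup>2 + A/2) = 0" by (simp add: power2_eq_square power4_eq_xxxx algebra_simps)
  then have "k\<^sup>2 = - 4 * A" using \<open>k \<noteq> 0\<close> by simp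
  then show False using e1 A(1) by simp
qed

text \<open>Recovers the parameter of a point of the tractrix from its coordinate along the
  asymptote. The derivative of \<open>X\<close> is \<open>(tanh (s / l))\<^sup>2\<close>, which
  vanishes only at the cusp: \<open>X\<close> is still strictly increasing, but \<open>Y\<close> has
  infinite slope there.\<close>

lemma tractrix_abscissa_inverse:
  assumes l: "l > 0"
  defines "X \<equiv> \<lambda>s. s - l * tanh (s / l)"
  obtains Y where "\<And>x. X (Y x) = x" "\<And>s. Y (X s) = s" "continuous_on UNIV Y"
    "\<And>x. Y x \<noteq> 0 \<Longrightarrow> (Y has_real_derivative inverse ((tanh (Y x / l))\<^sup>2)) (at x)"
proof -
  have dX: "(X has_real_derivative (tanh (s / l))\<^sup>2) (at s)" for s
  proof -
    have "((\<lambda>s. tanh ((s - 0) / l)) has_real_derivative (1 / cosh ((s - 0) / l))\<^sup>2 / l) (at s)"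
      by (rule has_real_derivative_tanh_scaled[OF l])
    then have "(X has_real_derivative 1 - l * ((1 / cosh (s / l))\<^sup>2 / l)) (at s)"
      unfolding X_def by (intro DERIV_diff DERIV_ident DERIV_cmult) simp
    moreover have "1 - l * ((1 / cosh (s / l))\<^sup>2 / l) = (tanh (s / l))\<^sup>2" using l tanh_sech_square[of "s / l"] by simp
    ultimately show ?thesis by simp
  qed
  have cX: "continuous_on A X" for A
    using dX by (intro continuous_at_imp_continuous_on ballI DERIV_isCont)
  have half: "X x < X y" if "x < y" "0 \<le> x \<or> y \<le> 0" for x y
  proof (rule DERIV_pos_imp_increasing_open[OF that(1) _ cX])
    fix s assume "x < s" "s < y"
    then have "s \<noteq> 0" using that(2) by auto
    then have "(tanh (s / l))\<^sup>2 > 0" using l by simp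
    then show "\<exists>d. (X has_real_derivative d) (at s) \<and> d > 0" using dX by blast
  qed
  have mono: "X x < X y" if "x < y" for x y
  proof (cases "0 \<le> x \<or> y \<le> 0")
    case False
    then have "X x < X 0" "X 0 < X y" by (auto intro!: half)
    then show ?thesis by simp
  qed (use half that in blast)
  have "\<exists>s. X s = x" for x
  proof -
    have b: "\<bar>l * tanh z\<bar> \<le> l" for z
    proof -
      have "\<bar>tanh z\<bar> \<le> 1" using tanh_real_bounds[of z] by (auto simp: abs_le_iff)
      then show ?thesis using l by (simp add: abs_mult mult_left_le)
    qed
    have "\<exists>s\<ge>x - l. s \<le> x + l \<and> X s = x"
      by (rule IVT') (use b[of "(x - l) / l"] b[of "(x + l) / l"] l cX in \<open>auto simp: X_def abs_le_iff\<close>)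
    then show ?thesis by blast
  qed
  then obtain Y where Y: "\<And>x. X (Y x) = x" by metis
  have inj: "X x = X y \<Longrightarrow> x = y" for x y using mono[of x y] mono[of y x] by (cases x y rule: linorder_cases) auto
  have YX: "Y (X s) = s" for s using Y inj by blast
  have "range Y = UNIV" using YX by (metis UNIV_eq_I range_eqI)
  moreover have "Y x \<le> Y y" if "x \<le> y" for x y
  proof (rule ccontr)
    assume "\<not> Y x \<le> Y y"
    then have "X (Y y) < X (Y x)" by (intro mono) simp
    then show False using that Y by simp
  qed
  ultimately have cY: "continuous_on UNIV Y" by (intro continuous_onI_mono) auto
  have "(Y has_real_derivative inverse ((tanh (Y x / l))\<^sup>2)) (at x)" if "Y x \<noteq> 0" for x
  proof (rule DERIV_inverse_function[where a = "x - 1" and b = "x + 1", OF dX])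
    show "(tanh (Y x / l))\<^sup>2 \<noteq> 0" using that l by simp
    show "isCont Y x" using cY by (simp add: continuous_on_eq_continuous_at)
  qed (use Y in auto)
  then show thesis using that Y YX cY by blast
qed

lemma unit_vectors_eq:
  fixes w W :: "'a::real_inner"
  assumes "norm w = 1" "norm W = 1" "w \<bullet> W = \<epsilon>" "\<epsilon>\<^sup>2 = 1"
  shows "w = \<epsilon> *\<^sub>R W"
proof -
  have "\<epsilon> = 1 \<or> \<epsilon> = -1" using assms(4) by (simp only: power2_eq_1_iff)
  from norm_scaleR_unit_diff[OF assms(1,2) this] have "(norm (w - \<epsilon> *\<^sub>R W))\<^sup>2 = 2 - 2 * \<epsilon>\<^sup>2"
    unfolding assms(3) by (simp only: power2_eq_square)
  then have "(norm (w - \<epsilon> *\<^sub>R W))\<^sup>2 = 0" unfolding assms(4) by simp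
  then show ?thesis by simp
qed

text \<open>With \<open>s\<close> the tractrix parameter of the back wheel and \<open>W\<close> the
  tangent direction, the frame is \<open>\<epsilon> *\<^sub>R W (s t)\<close> for a constant sign
  \<open>\<epsilon>\<close>. For \<open>\<epsilon> = 1\<close> the front wheel itself stays on the
  asymptote, which the nonzero curvature excludes; for \<open>\<epsilon> = -1\<close> the flipped
  front wheel does, and it remains to show that it moves with constant velocity.\<close>

theorem euler_soliton_front_flip_straight:
  assumes l: "l > 0" and \<gamma>: "infinite_bicycle_path l \<gamma>"
    and f: "euler_soliton (front_track \<gamma>)" and tr: "is_tractrix l (range (back_track \<gamma>))"
  shows "unit_speed_line (front_track (flip \<circ> \<gamma>))"
proof -
  let ?b = "\<lambda>t. fst (\<gamma> t)" and ?f = "\<lambda>t. snd (\<gamma> t)" and ?w = "frame l \<gamma>"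
  have fF: "front_track \<gamma> = ?f" by (simp add: front_track_def[abs_def])
  obtain A where A: "elastica A ?f" "\<exists>t. curvature ?f t \<noteq> 0" using f unfolding euler_soliton_def fF by blast
  then have sm: "smooth_on UNIV ?f" and unit: "\<And>t. norm (vector_derivative ?f (at t)) = 1" unfolding elastica_def by auto
  define f1 where "f1 = (\<lambda>t. vector_derivative ?f (at t))"
  define f2 where "f2 = (\<lambda>t. vector_derivative f1 (at t))"
  have sm1: "smooth_on UNIV f1" unfolding f1_def by (rule smooth_on_real_vector_derivative[OF sm])
  have d1: "(?f has_vector_derivative f1 t) (at t)" for t unfolding f1_def by (rule smooth_on_real_vector_derivative[OF sm])
  have d2: "(f1 has_vector_derivative f2 t) (at t)" for t unfolding f2_def by (rule smooth_on_real_vector_derivative[OF sm1])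
  have cf1: "continuous_on UNIV f1" by (rule smooth_on_real_vector_derivative(3)[OF sm1])
  obtain P e h where e: "norm e = 1" "norm h = 1" "e \<bullet> h = 0" and S: "range (back_track \<gamma>) = range (tractrix_curve l P e h)"
    using tr unfolding is_tractrix_iff by blast
  have mh: "norm (- h) = 1" "e \<bullet> (- h) = 0" using e by simp_all
  define W where "W = tractrix_frame l e (- h) 0"
  have nW: "norm (W s) = 1" for s unfolding W_def by (rule norm_tractrix_frame[OF e(1) mh])
  have dW: "(W has_vector_derivative (1 / l) *\<^sub>R (e - (e \<bullet> W s) *\<^sub>R W s)) (at s)" for s
    unfolding W_def by (rule tractrix_frame_derivative[OF l e(1) mh])
  have cW: "continuous_on UNIV W"
    using dW by (intro continuous_at_imp_continuous_on ballI has_vector_derivative_continuous)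
  let ?\<tau> = "\<lambda>s. P + s *\<^sub>R e - l *\<^sub>R W s"
  have \<tau>: "tractrix_curve l P e h s = ?\<tau> s" for s
    by (simp add: tractrix_curve_def W_def tractrix_frame_def algebra_simps)
  have d\<tau>: "(?\<tau> has_vector_derivative (e \<bullet> W s) *\<^sub>R W s) (at s)" for s
    unfolding W_def by (rule tractrix_back_derivative[OF l e(1) mh])
  obtain Y where Y: "\<And>x. Y x - l * tanh (Y x / l) = x" "\<And>s. Y (s - l * tanh (s / l)) = s" "continuous_on UNIV Y"
    "\<And>x. Y x \<noteq> 0 \<Longrightarrow> (Y has_real_derivative inverse ((tanh (Y x / l))\<^sup>2)) (at x)"
    by (rule tractrix_abscissa_inverse[OF l]) blast
  define s where "s = (\<lambda>t. Y ((?b t - P) \<bullet> e))"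
  have bs: "?b t = ?\<tau> (s t)" for t
  proof -
    have "?b t \<in> range (tractrix_curve l P e h)" using S by (metis back_track_def rangeI)
    then obtain r where r: "?b t = tractrix_curve l P e h r" by blast
    then have "(?b t - P) \<bullet> e = r - l * tanh (r / l)"
      using norm1_inner[OF e(1)] e(3) by (simp add: tractrix_curve_def inner_add_right inner_commute)
    then have "s t = r" using Y(2) by (simp add: s_def)
    then show ?thesis using r \<tau> by simp
  qed
  have cs: "continuous_on UNIV s"
    unfolding s_def by (rule continuous_on_compose2[OF Y(3)]) (auto intro!: continuous_intros frame_continuous[OF l \<gamma>])
  have cWs: "continuous_on UNIV (\<lambda>t. W (s t))" by (rule continuous_on_compose2[OF cW cs]) auto
  let ?\<phi> = "\<lambda>t. ?w t \<bullet> W (s t)"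
  have c\<phi>: "continuous_on UNIV ?\<phi>" by (intro continuous_intros frame_continuous[OF l \<gamma>] cWs)
  have nw: "norm (?w t) = 1" for t by (rule norm_frame[OF \<gamma> l])
  have fw: "?f t - ?b t = l *\<^sub>R ?w t" for t using front_eq_frame[OF l, of \<gamma> t] by simp
  obtain N c f' where "rolling_velocities l \<gamma> N c f'"
    by (rule infinite_bicycle_path_ae[OF \<gamma>])
  note N = rolling_velocitiesD[OF this]
  \<comment> \<open>Away from the cusp \<open>s\<close> is differentiable along with the back track,
    so the chain rule writes the back velocity as a multiple of \<open>W (s t)\<close>; if it is
    nonzero, the frame is parallel to \<open>W (s t)\<close>.\<close>
  have alt: "c t = 0" if t: "t \<notin> N" "(?\<phi> t)\<^sup>2 \<noteq> 1" "s t \<noteq> 0" for t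
  proof (rule ccontr)
    assume c0: "c t \<noteq> 0"
    have db: "(?b has_vector_derivative c t *\<^sub>R (?f t - ?b t)) (at t)" using N(2) t(1) by blast
    let ?x = "\<lambda>t. (?b t - P) \<bullet> e"
    have "(?x has_vector_derivative (c t *\<^sub>R (?f t - ?b t) - 0) \<bullet> e) (at t)"
      by (intro bounded_linear.has_vector_derivative[OF bounded_linear_inner_left] has_vector_derivative_diff db has_vector_derivative_const)
    then have dx: "(?x has_real_derivative (c t *\<^sub>R (?f t - ?b t) - 0) \<bullet> e) (at t)"
      by (simp add: has_real_derivative_iff_has_vector_derivative)
    have "Y (?x t) \<noteq> 0" using t(3) by (simp add: s_def)
    from DERIV_chain2[OF Y(4)[OF this] dx] obtain k where "(s has_real_derivative k) (at t)" unfolding s_def by blast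
    then have "(s has_vector_derivative k) (at t)" by (simp add: has_real_derivative_iff_has_vector_derivative)
    from vector_diff_chain_at[OF this d\<tau>]
    have "((\<lambda>t. ?\<tau> (s t)) has_vector_derivative k *\<^sub>R ((e \<bullet> W (s t)) *\<^sub>R W (s t))) (at t)" by (simp add: o_def)
    then have "(?b has_vector_derivative k *\<^sub>R ((e \<bullet> W (s t)) *\<^sub>R W (s t))) (at t)" unfolding bs[symmetric] .
    then have "c t *\<^sub>R (?f t - ?b t) = k *\<^sub>R ((e \<bullet> W (s t)) *\<^sub>R W (s t))" using db vector_derivative_unique_at by blast
    then have eq: "(c t * l) *\<^sub>R ?w t = (k * (e \<bullet> W (s t))) *\<^sub>R W (s t)" unfolding fw by simp
    have cl: "c t * l \<noteq> 0" using c0 l by simp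
    have "norm ((c t * l) *\<^sub>R ?w t) = norm ((k * (e \<bullet> W (s t))) *\<^sub>R W (s t))" by (simp only: eq)
    then have ab: "\<bar>c t * l\<bar> = \<bar>k * (e \<bullet> W (s t))\<bar>" unfolding norm_scaleR nw nW by simp
    have "((c t * l) *\<^sub>R ?w t) \<bullet> W (s t) = k * (e \<bullet> W (s t))" unfolding eq using norm1_inner[OF nW[of "s t"]] by simp
    then have "(c t * l) * ?\<phi> t = k * (e \<bullet> W (s t))" by simp
    then have "(c t * l)\<^sup>2 * (?\<phi> t)\<^sup>2 = (c t * l)\<^sup>2" using ab by (metis power_mult_distrib power2_abs)
    then show False using cl t(2) by simp
  qed
  have arc: False if b: "m - d < m + d" "\<And>t. t \<in> {m - d..m + d} \<Longrightarrow> ?b t = q" for m d q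
  proof (rule euler_soliton_no_circular_arc[OF f b(1) l])
    fix t assume "t \<in> {m - d<..<m + d}"
    then have "?b t = q" using b(2) by simp
    then show "norm (front_track \<gamma> t - q) = l" using infinite_bicycle_path_in_Q[OF \<gamma>, of t] by (simp add: fF)
  qed
  have sq: "(?\<phi> t)\<^sup>2 = 1" for t
  proof (rule ccontr)
    assume t: "(?\<phi> t)\<^sup>2 \<noteq> 1"
    let ?U = "{t. (?\<phi> t)\<^sup>2 \<noteq> 1}"
    have U: "open ?U" by (intro open_Collect_neq continuous_intros c\<phi>)
    have V: "open (?U \<inter> {t. s t \<noteq> 0})" by (intro open_Int U open_Collect_neq cs continuous_intros)
    show False
    \<comment> \<open>Either the back wheel sits in the cusp throughout \<open>?U\<close>, or there
      is an interval of times away from the cusp on which its velocity is 0 almost everywhere. In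
      both cases it rests and the front wheel describes a circular arc.\<close>
    proof (cases "?U \<inter> {t. s t \<noteq> 0} = {}")
      case True
      obtain d where d: "d > 0" "cball t d \<subseteq> ?U" using U t open_contains_cball by blast
      have "?b x = ?\<tau> 0" if "x \<in> {t - d..t + d}" for x
      proof -
        have "x \<in> ?U" using d(2) that by (auto simp: cball_eq_atLeastAtMost)
        then have "s x = 0" using True by blast
        then show ?thesis using bs[of x] by simp
      qed
      note const = this
      show False by (rule arc[of t d "?\<tau> 0"]) (use d(1) const in auto)
    next
      case False
      then obtain x where x: "x \<in> ?U \<inter> {t. s t \<noteq> 0}" by blast
      obtain d where d: "d > 0" "cball x d \<subseteq> ?U \<inter> {t. s t \<noteq> 0}" using V x open_contains_cball by blast
      have "?b y = ?b (x - d)" if y: "y \<in> {x - d..x + d}" for y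
      proof -
        have "norm (?b y - ?b (x - d)) \<le> 0 * (y - (x - d))"
        proof (rule abs_continuous_on_norm_diff_le[OF _ infinite_bicycle_path_abs_continuous(1)[OF \<gamma>] N(1)])
          fix z assume z: "z \<in> {x - d..y} - N"
          then have "z \<in> cball x d" using y by (auto simp: cball_eq_atLeastAtMost)
          then have "c z = 0" using alt[of z] d(2) z by blast
          then have "(?b has_vector_derivative 0) (at z)" using N(2) z by fastforce
          then show "(?b has_vector_derivative 0) (at z within {x - d..y})" by (rule has_vector_derivative_at_within)
        qed (use y in auto)
        then show ?thesis by simp
      qed
      note const = this
      show False by (rule arc[OF _ const]) (use d(1) in simp)
    qed
  qed
  then have "?\<phi> ` UNIV \<subseteq> {1, -1}" by (auto simp: power2_eq_1_iff)
  then have "finite (?\<phi> ` UNIV)" by (rule finite_subset) simp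
  with c\<phi> have "?\<phi> constant_on UNIV" by (rule continuous_finite_range_constant[OF connected_UNIV])
  then obtain \<epsilon> where "\<forall>t\<in>UNIV. ?\<phi> t = \<epsilon>" unfolding constant_on_def by (elim exE)
  then have \<epsilon>: "?\<phi> t = \<epsilon>" for t by (rule bspec) simp
  have \<epsilon>2: "\<epsilon>\<^sup>2 = 1" using sq[of 0] unfolding \<epsilon> .
  have w: "?w t = \<epsilon> *\<^sub>R W (s t)" for t by (rule unit_vectors_eq[OF nw nW \<epsilon> \<epsilon>2])
  have "\<epsilon> \<noteq> 1"
  proof
    assume "\<epsilon> = 1"
    then have fs: "?f t = P + s t *\<^sub>R e" for t using front_eq_frame[OF l, of \<gamma> t] bs[of t] w[of t] by simp
    have "f1 t \<bullet> h = 0" for t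
    proof (rule derivative_zero_if_locally_constant[of "\<lambda>t. ?f t \<bullet> h" _ t UNIV "P \<bullet> h"])
      show "((\<lambda>t. ?f t \<bullet> h) has_vector_derivative f1 t \<bullet> h) (at t)"
        by (rule bounded_linear.has_vector_derivative[OF bounded_linear_inner_left d1])
      show "?f r \<bullet> h = P \<bullet> h" for r unfolding fs using e(3) by (simp add: inner_add_left)
    qed auto
    note 1 = this
    have 2: "f2 t \<bullet> h = 0" for t
    proof (rule derivative_zero_if_locally_constant[of "\<lambda>t. f1 t \<bullet> h" _ t UNIV 0])
      show "((\<lambda>t. f1 t \<bullet> h) has_vector_derivative f2 t \<bullet> h) (at t)"
        by (rule bounded_linear.has_vector_derivative[OF bounded_linear_inner_left d2])
    qed (use 1 in auto)
    have "curvature ?f t = 0" for t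
    proof -
      have r: "f1 t = (f1 t \<bullet> rot h) *\<^sub>R rot h" "f2 t = (f2 t \<bullet> rot h) *\<^sub>R rot h"
        using rot_decompose[OF e(2), of "f1 t"] rot_decompose[OF e(2), of "f2 t"] 1 2 by simp_all
      have "curvature ?f t = rot (f1 t) \<bullet> f2 t" by (simp add: curvature_rot f1_def f2_def)
      also have "\<dots> = rot ((f1 t \<bullet> rot h) *\<^sub>R rot h) \<bullet> ((f2 t \<bullet> rot h) *\<^sub>R rot h)" using r by metis
      also have "\<dots> = 0" by (simp add: inner_plane)
      finally show ?thesis .
    qed
    then show False using A(2) by blast
  qed
  then have "\<epsilon> = -1" using \<epsilon>2 by (simp add: power2_eq_1_iff)
  then have wW: "?w t = - W (s t)" for t using w by simp
  let ?F = "\<lambda>t. snd (flip (\<gamma> t))"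
  have F: "?F t = P + s t *\<^sub>R e" for t
    using front_eq_frame[OF l, of \<gamma> t] bs[of t] wW[of t] by (simp add: snd_flip scaleR_2)
  \<comment> \<open>The mirror image of \<open>e\<close> in \<open>W r\<close>: the velocity of the
    soliton with respect to the tractrix parameter \<open>r\<close>, which is thus an arc length
    parameter.\<close>
  define Z where "Z = (\<lambda>r. (2 * (e \<bullet> W r)) *\<^sub>R W r - e)"
  have nZ: "Z r \<bullet> Z r = 1" for r
    using norm1_inner[OF e(1)] norm1_inner[OF nW[of r]]
    by (simp add: Z_def inner_diff_left inner_diff_right inner_commute)
  have fZ: "?f t = P + s t *\<^sub>R e - (2 * l) *\<^sub>R W (s t)" for t
    using front_eq_frame[OF l, of \<gamma> t] bs[of t] wW[of t] by (simp add: scaleR_2 flip: scaleR_scaleR)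
  have dZ: "((\<lambda>r. P + r *\<^sub>R e - (2 * l) *\<^sub>R W r) has_vector_derivative Z r) (at r)" for r
  proof -
    have "((\<lambda>r. r *\<^sub>R e) has_vector_derivative 1 *\<^sub>R e) (at r)"
      by (rule has_vector_derivative_scaleR_const) simp
    then have "((\<lambda>r. P + r *\<^sub>R e - (2 * l) *\<^sub>R W r) has_vector_derivative 0 + 1 *\<^sub>R e - (2 * l) *\<^sub>R ((1 / l) *\<^sub>R (e - (e \<bullet> W r) *\<^sub>R W r))) (at r)"
      by (intro has_vector_derivative_add has_vector_derivative_diff has_vector_derivative_const
         bounded_linear.has_vector_derivative[OF bounded_linear_scaleR_right] dW)
    moreover have "0 + 1 *\<^sub>R e - (2 * l) *\<^sub>R ((1 / l) *\<^sub>R (e - (e \<bullet> W r) *\<^sub>R W r)) = Z r"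
      using l by (simp add: Z_def vec_eq_iff algebra_simps)
    ultimately show ?thesis by simp
  qed
  have chain: "f1 t = k *\<^sub>R Z (s t)" if "(s has_vector_derivative k) (at t)" for t k
  proof -
    have "(?f has_vector_derivative k *\<^sub>R Z (s t)) (at t)"
      unfolding fZ using vector_diff_chain_at[OF that dZ] by (simp add: o_def)
    then show ?thesis using d1 vector_derivative_unique_at by blast
  qed
  \<comment> \<open>Where \<open>s\<close> is differentiable, its derivative is
    \<open>?\<psi>\<close>, because \<open>f1 t\<close> is then this derivative times the unit
    vector \<open>Z (s t)\<close>. As \<open>?\<psi>\<close> is continuous, \<open>s\<close> turns
    out to be differentiable everywhere.\<close>
  let ?\<psi> = "\<lambda>t. f1 t \<bullet> Z (s t)"
  have cZ: "continuous_on UNIV (\<lambda>t. Z (s t))" unfolding Z_def by (intro continuous_intros cWs)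
  have \<gamma>': "infinite_bicycle_path l (flip \<circ> \<gamma>)" by (rule infinite_bicycle_path_flip[OF \<gamma>])
  obtain N' c' F' where "rolling_velocities l (flip \<circ> \<gamma>) N' c' F'"
    by (rule infinite_bicycle_path_ae[OF \<gamma>'])
  note N' = rolling_velocitiesD[OF this]
  \<comment> \<open>Absolute continuity of \<open>s\<close> is read off the flipped front wheel; the
    expression through the back wheel does not show it, since \<open>Y\<close> has infinite slope at
    the cusp.\<close>
  have sF: "s t = (?F t - P) \<bullet> e" for t using norm1_inner[OF e(1)] by (simp add: F)
  have ds: "(s has_vector_derivative ?\<psi> t) (at t)" for t
  proof (rule abs_continuous_continuous_derivative[OF _ N'(1)])
    fix a b :: real assume ab: "a \<le> b"
    show "abs_continuous_on a b s"
    proof (rule abs_continuous_on_dominated[OF infinite_bicycle_path_abs_continuous(2)[OF \<gamma>' ab], of _ 1])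
      fix x y
      have "\<bar>(?F x - ?F y) \<bullet> e\<bar> \<le> norm (?F x - ?F y)" using Cauchy_Schwarz_ineq2[of "?F x - ?F y" e] e(1) by simp
      then show "dist (s x) (s y) \<le> 1 * dist (snd ((flip \<circ> \<gamma>) x)) (snd ((flip \<circ> \<gamma>) y))"
        unfolding sF by (simp add: dist_norm inner_diff_left)
    qed
  next
    show "continuous_on UNIV ?\<psi>" by (intro continuous_intros cf1 cZ)
  next
    fix t assume "t \<notin> N'"
    then have "(?F has_vector_derivative F' t) (at t)" using N'(2) by simp
    then have "((\<lambda>t. (?F t - P) \<bullet> e) has_vector_derivative (F' t - 0) \<bullet> e) (at t)"
      by (intro bounded_linear.has_vector_derivative[OF bounded_linear_inner_left] has_vector_derivative_diff has_vector_derivative_const)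
    then have s': "(s has_vector_derivative F' t \<bullet> e) (at t)" unfolding sF[symmetric] by simp
    have "?\<psi> t = F' t \<bullet> e" unfolding chain[OF s'] using nZ by simp
    then show "(s has_vector_derivative ?\<psi> t) (at t)" using s' by simp
  qed
  have "(?\<psi> t)\<^sup>2 = 1" for t
  proof -
    have "f1 t = ?\<psi> t *\<^sub>R Z (s t)" by (rule chain[OF ds])
    moreover have "f1 t \<bullet> f1 t = 1" using norm1_inner[OF unit] by (simp add: f1_def)
    ultimately have "(?\<psi> t *\<^sub>R Z (s t)) \<bullet> (?\<psi> t *\<^sub>R Z (s t)) = 1" by metis
    then show ?thesis using nZ by (simp add: power2_eq_square)
  qed
  note \<psi>sq = this
  then have "?\<psi> ` UNIV \<subseteq> {1, -1}" by (auto simp: power2_eq_1_iff)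
  then have "finite (?\<psi> ` UNIV)" by (rule finite_subset) simp
  moreover have "continuous_on UNIV ?\<psi>" by (intro continuous_intros cf1 cZ)
  ultimately have "?\<psi> constant_on UNIV" by (intro continuous_finite_range_constant[OF connected_UNIV])
  then obtain k where "\<forall>t\<in>UNIV. ?\<psi> t = k" unfolding constant_on_def by (elim exE)
  then have k: "?\<psi> t = k" for t by (rule bspec) simp
  have k2: "\<bar>k\<bar> = 1" using \<psi>sq[of 0] unfolding k by (auto simp: power2_eq_1_iff)
  have "s t = s 0 + t * k" for t
  proof -
    have "((\<lambda>t. s t - t * k) has_real_derivative k - 1 * k) (at x)" for x
      using ds[of x] unfolding k has_real_derivative_iff_has_vector_derivative[symmetric]
      by (intro DERIV_diff DERIV_cmult_right DERIV_ident)
    then have "\<forall>x. ((\<lambda>t. s t - t * k) has_real_derivative 0) (at x)" by simp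
    from DERIV_isconst_all[OF this, of t 0] show ?thesis by simp
  qed
  then have "?F t = (P + s 0 *\<^sub>R e) + t *\<^sub>R (k *\<^sub>R e)" for t unfolding F by (metis add.assoc scaleR_left_distrib scaleR_scaleR)
  moreover have "norm (k *\<^sub>R e) = 1" using k2 e(1) by simp
  ultimately show ?thesis unfolding unit_speed_line_def front_track_def o_def by blast
qed

theorem theorem1p2:
  fixes l :: real
  assumes "l > 0"
  shows "(\<forall>\<gamma>. infinite_bicycle_path l \<gamma> \<longrightarrow>
            (global_minimizer l \<gamma> \<longleftrightarrow> type1_path l \<gamma> \<or> type2_path l \<gamma>)) \<and>
         isometry_of_Q l flip \<and> (\<forall>q\<in>Q l. flip (flip q) = q) \<and>
         (\<forall>\<gamma>. infinite_bicycle_path l \<gamma> \<and> is_tractrix l (range (back_track \<gamma>)) \<longrightarrow>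
            (type1_path l \<gamma> \<longrightarrow> infinite_bicycle_path l (flip \<circ> \<gamma>) \<and> type2_path l (flip \<circ> \<gamma>)) \<and>
            (type2_path l \<gamma> \<longrightarrow> infinite_bicycle_path l (flip \<circ> \<gamma>) \<and> type1_path l (flip \<circ> \<gamma>)))"
proof -
  note l = assms
  have t1: "unit_speed_line (front_track \<gamma>)" if "type1_path l \<gamma>" for \<gamma> using that by (simp add: type1_path_def)
  have t2: "unit_speed_line (front_track (flip \<circ> \<gamma>))" if "infinite_bicycle_path l \<gamma>" "type2_path l \<gamma>" for \<gamma>
    using euler_soliton_front_flip_straight[OF l that(1)] that(2) by (simp add: type2_path_def)
  have type1: "type1_path l \<gamma>" if "infinite_bicycle_path l \<gamma>" "unit_speed_line (front_track \<gamma>)" for \<gamma>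
    using straight_front_dichotomy[OF l that] that(2) by (auto simp: type1_path_def)
  have min: "type1_path l \<gamma> \<or> type2_path l \<gamma>" if \<gamma>: "infinite_bicycle_path l \<gamma>" "global_minimizer l \<gamma>" for \<gamma>
    using global_minimizer_straight_front[OF l \<gamma>]
  proof
    assume "unit_speed_line (front_track \<gamma>)"
    then show ?thesis using type1[OF \<gamma>(1)] by blast
  next
    assume s: "unit_speed_line (front_track (flip \<circ> \<gamma>))"
    let ?\<gamma>' = "flip \<circ> \<gamma>"
    have \<gamma>': "infinite_bicycle_path l ?\<gamma>'" by (rule infinite_bicycle_path_flip[OF \<gamma>(1)])
    from straight_front_dichotomy[OF l \<gamma>' s] show ?thesis
    proof
      assume "is_tractrix l (range (back_track ?\<gamma>'))"
      from type1_tractrix_flip_type2[OF l \<gamma>' s this] show ?thesis by simp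
    next
      \<comment> \<open>A minimizer whose flip has a straight back track has a straight front track
        itself, so it is of the first type.\<close>
      assume "is_line (range (back_track ?\<gamma>')) \<and> unit_speed_line (front_track (flip \<circ> ?\<gamma>'))"
      then have "unit_speed_line (front_track \<gamma>)" by simp
      then show ?thesis using type1[OF \<gamma>(1)] by blast
    qed
  qed
  have "global_minimizer l \<gamma>" if \<gamma>: "infinite_bicycle_path l \<gamma>" and t: "type1_path l \<gamma> \<or> type2_path l \<gamma>" for \<gamma>
    using t
  proof
    assume "type1_path l \<gamma>"
    then show ?thesis using unit_speed_line_global_minimizer[OF \<gamma>] t1 by blast
  next
    assume "type2_path l \<gamma>"
    let ?\<gamma>' = "flip \<circ> \<gamma>"
    have \<gamma>': "infinite_bicycle_path l ?\<gamma>'" by (rule infinite_bicycle_path_flip[OF \<gamma>])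
    have "global_minimizer l ?\<gamma>'"
      by (rule unit_speed_line_global_minimizer[OF \<gamma>' t2[OF \<gamma> \<open>type2_path l \<gamma>\<close>]])
    from global_minimizer_flip[OF \<gamma>' this] show ?thesis by simp
  qed
  moreover have "type2_path l (flip \<circ> \<gamma>)"
    if "infinite_bicycle_path l \<gamma>" "is_tractrix l (range (back_track \<gamma>))" "type1_path l \<gamma>" for \<gamma>
    using type1_tractrix_flip_type2[OF l that(1) t1[OF that(3)] that(2)] .
  moreover have "type1_path l (flip \<circ> \<gamma>)" if "infinite_bicycle_path l \<gamma>" "type2_path l \<gamma>" for \<gamma>
    by (rule type1[OF infinite_bicycle_path_flip[OF that(1)] t2[OF that]])
  ultimately show ?thesis
    using min isometry_of_Q_flip infinite_bicycle_path_flip by auto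
qed

end
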